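(* Let $p$ be a prime, let $R$ be an $F$-finite Dedekind domain of characteristic $p$ with field of fractions $K$, and let $\phi\colon F_*R\to R$ be a Frobenius splitting (an $R$-linear map with $\phi(F_*1)=1$). Let $L/K$ be a finite Galois extension and let $S$ be the normalization of $R$ in $L$. Suppose that $\phi$ extends to an $S$-linear map $\psi\colon F_*S\to S$ (i.e. $\psi(F_*r)=\phi(F_*r)$ for all $r\in R$). Then the following statements are equivalent: (a) $S/R$ is tamely ramified over every center of $F$-purity of $(R,\phi)$. (b) The centers of $F$-purity of $(S,\psi)$ are exactly those prime ideals of $S$ lying over centers of $F$-purity of $(R,\phi)$. (c) $\mathrm{Tr}_{L/K}(S)=R$, i.e. $S/R$ is tamely ramified over every prime of $R$. In that case, the Cohen--Seidenberg theorems (lying-over, incomparability, going-up and going-down) hold for centers of $F$-purity, i.e. for the contraction map $\mathfrak q\mapsto \mathfrak q\cap R$ from centers of $F$-purity of $(S,\psi)$ to centers of $F$-purity of $(R,\phi)$.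
   Context: $F_*R$ is $R$ viewed as an $R$-module by restriction of scalars along the Frobenius $F\colon R\to R$, $r\mapsto r^p$; its elements are written $F_*r$, so $r'F_*r=F_*(r'^pr)$. $R$ is $F$-finite if $F_*R$ is a finitely generated $R$-module. Center of $F$-purity of $(R,\phi)$: a prime ideal $\mathfrak p\subset R$ such that $\phi(F_*\mathfrak p)\subset\mathfrak p$ and $\phi(F_*R)\not\subset\mathfrak p$ (equivalently, the induced map $F_*\kappa(\mathfrak p)\to\kappa(\mathfrak p)$ is nonzero). Similarly for $(S,\psi)$. The trace $\mathrm{Tr}_{L/K}\colon L\to K$ restricts to an $R$-linear map $\mathrm{Tr}\colon S\to R$. For a prime $\mathfrak p$ of $R$ set $\mathfrak p^{\mathrm{Tr}}=\{s\in S\mid \mathrm{Tr}(sS)\subset\mathfrak p\}$. One says $S/R$ is tamely ramified over $\mathfrak p$ if $\mathfrak p^{\mathrm{Tr}}=\sqrt{\mathfrak pS}$. *)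

theory Defs
  imports "HOL-Algebra.Algebra" "HOL-Computational_Algebra.Primes"
begin

text \<open>
  All rings are subsets of an ambient field \<open>L\<close>: a subset \<open>R\<close> stands for the
  ring \<open>L\<lparr>carrier := R\<rparr>\<close>. Maps are HOL functions of which only the
  values on the relevant carrier matter.
\<close>

definition has_characteristic :: "('a, 'b) ring_scheme \<Rightarrow> nat \<Rightarrow> bool" where
  "has_characteristic A p \<longleftrightarrow> (\<forall>n::nat. [n] \<cdot>\<^bsub>A\<^esub> \<one>\<^bsub>A\<^esub> = \<zero>\<^bsub>A\<^esub> \<longleftrightarrow> p dvd n)"


section \<open>Modules and Frobenius\<close>

definition self_module :: "('a, 'b) ring_scheme \<Rightarrow> ('a, 'a) module" where
  "self_module A =
     \<lparr> carrier = carrier A, monoid.mult = monoid.mult A, one = \<one>\<^bsub>A\<^esub>,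
       ring.zero = \<zero>\<^bsub>A\<^esub>, add = add A, smult = (\<lambda>a x. a \<otimes>\<^bsub>A\<^esub> x) \<rparr>"

text \<open>\<open>F\<^sub>*A\<close>: an element \<open>F\<^sub>*x\<close> is represented by \<open>x\<close> itself.\<close>

definition frobenius_pushforward :: "nat \<Rightarrow> ('a, 'b) ring_scheme \<Rightarrow> ('a, 'a) module" where
  "frobenius_pushforward p A =
     \<lparr> carrier = carrier A, monoid.mult = monoid.mult A, one = \<one>\<^bsub>A\<^esub>,
       ring.zero = \<zero>\<^bsub>A\<^esub>, add = add A, smult = (\<lambda>a x. (a [^]\<^bsub>A\<^esub> p) \<otimes>\<^bsub>A\<^esub> x) \<rparr>"

definition linear_maps ::
  "('a, 'b) ring_scheme \<Rightarrow> ('a, 'm, 'c) module_scheme \<Rightarrow> ('a, 'n, 'd) module_scheme \<Rightarrow> ('m \<Rightarrow> 'n) set" where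
  "linear_maps A M N = {f \<in> carrier M \<rightarrow> carrier N.
     (\<forall>x\<in>carrier M. \<forall>y\<in>carrier M. f (x \<oplus>\<^bsub>M\<^esub> y) = f x \<oplus>\<^bsub>N\<^esub> f y) \<and>
     (\<forall>a\<in>carrier A. \<forall>x\<in>carrier M. f (a \<odot>\<^bsub>M\<^esub> x) = a \<odot>\<^bsub>N\<^esub> f x)}"

definition finitely_generated_module ::
  "('a, 'b) ring_scheme \<Rightarrow> ('a, 'm, 'c) module_scheme \<Rightarrow> bool" where
  "finitely_generated_module A M \<longleftrightarrow>
     (\<exists>B. finite B \<and> B \<subseteq> carrier M \<and>
        (\<forall>x\<in>carrier M. \<exists>c\<in>B \<rightarrow> carrier A. x = (\<Oplus>\<^bsub>M\<^esub>b\<in>B. c b \<odot>\<^bsub>M\<^esub> b)))"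

definition F_finite :: "nat \<Rightarrow> ('a, 'b) ring_scheme \<Rightarrow> bool" where
  "F_finite p A \<longleftrightarrow> finitely_generated_module A (frobenius_pushforward p A)"

definition frobenius_splitting :: "nat \<Rightarrow> ('a, 'b) ring_scheme \<Rightarrow> ('a \<Rightarrow> 'a) \<Rightarrow> bool" where
  "frobenius_splitting p A \<phi> \<longleftrightarrow>
     \<phi> \<in> linear_maps A (frobenius_pushforward p A) (self_module A) \<and> \<phi> \<one>\<^bsub>A\<^esub> = \<one>\<^bsub>A\<^esub>"

definition centers_of_F_purity :: "('a, 'b) ring_scheme \<Rightarrow> ('a \<Rightarrow> 'a) \<Rightarrow> 'a set set" where
  "centers_of_F_purity A \<phi> =
     {P. primeideal P A \<and> \<phi> ` P \<subseteq> P \<and> \<not> \<phi> ` carrier A \<subseteq> P}"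


section \<open>Integral closure, fraction fields, Dedekind domains\<close>

definition is_fraction_field :: "('a, 'b) ring_scheme \<Rightarrow> 'a set \<Rightarrow> 'a set \<Rightarrow> bool" where
  "is_fraction_field L R K \<longleftrightarrow>
     subring R L \<and> K = {a \<otimes>\<^bsub>L\<^esub> inv\<^bsub>L\<^esub> b | a b. a \<in> R \<and> b \<in> R - {\<zero>\<^bsub>L\<^esub>}}"

text \<open>The leading coefficient of a polynomial in \<open>HOL-Algebra\<close> is the head of its list.\<close>

definition integral_over :: "('a, 'b) ring_scheme \<Rightarrow> 'a set \<Rightarrow> 'a \<Rightarrow> bool" where
  "integral_over L R x \<longleftrightarrow>
     (\<exists>f\<in>carrier (univ_poly L R). f \<noteq> [] \<and> hd f = \<one>\<^bsub>L\<^esub> \<and> ring.eval L f x = \<zero>\<^bsub>L\<^esub>)"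

definition integral_closure :: "('a, 'b) ring_scheme \<Rightarrow> 'a set \<Rightarrow> 'a set \<Rightarrow> 'a set" where
  "integral_closure L R E = {x \<in> E. integral_over L R x}"

text \<open>Fields count as Dedekind domains here. \<open>K\<close> is meant to be the fraction field of \<open>R\<close>.\<close>

definition dedekind_domain :: "('a, 'b) ring_scheme \<Rightarrow> 'a set \<Rightarrow> 'a set \<Rightarrow> bool" where
  "dedekind_domain L K R \<longleftrightarrow>
     noetherian_domain (L\<lparr>carrier := R\<rparr>) \<and>
     integral_closure L R K = R \<and>
     (\<forall>P. primeideal P (L\<lparr>carrier := R\<rparr>) \<and> P \<noteq> {\<zero>\<^bsub>L\<^esub>} \<longrightarrow> maximalideal P (L\<lparr>carrier := R\<rparr>))"


section \<open>Galois extensions and the trace\<close>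

definition galois_group :: "('a, 'b) ring_scheme \<Rightarrow> 'a set \<Rightarrow> ('a \<Rightarrow> 'a) set" where
  "galois_group L K = {\<sigma> \<in> ring_iso L L. \<forall>x\<in>K. \<sigma> x = x}"

definition finite_galois_extension :: "('a, 'b) ring_scheme \<Rightarrow> 'a set \<Rightarrow> bool" where
  "finite_galois_extension L K \<longleftrightarrow>
     field L \<and> subfield K L \<and> ring.finite_dimension L K (carrier L) \<and>
     {x \<in> carrier L. \<forall>\<sigma>\<in>galois_group L K. \<sigma> x = x} = K"

definition is_basis :: "('a, 'b) ring_scheme \<Rightarrow> 'a set \<Rightarrow> 'a list \<Rightarrow> bool" where
  "is_basis L K Us \<longleftrightarrow> ring.independent L K Us \<and> ring.Span L K Us = carrier L"

definition coordinates :: "('a, 'b) ring_scheme \<Rightarrow> 'a set \<Rightarrow> 'a list \<Rightarrow> 'a \<Rightarrow> 'a list" where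
  "coordinates L K Us x =
     (THE Ks. length Ks = length Us \<and> set Ks \<subseteq> K \<and> ring.combine L Ks Us = x)"

text \<open>The trace of the \<open>K\<close>-linear endomorphism \<open>y \<mapsto> x y\<close> of \<open>L\<close>; it is computed
  in a chosen basis, on which it does not depend.\<close>

definition field_trace :: "('a, 'b) ring_scheme \<Rightarrow> 'a set \<Rightarrow> 'a \<Rightarrow> 'a" where
  "field_trace L K x =
     (let Us = (SOME Us. is_basis L K Us)
      in \<Oplus>\<^bsub>L\<^esub>i\<in>{..<length Us}. coordinates L K Us (x \<otimes>\<^bsub>L\<^esub> Us ! i) ! i)"


section \<open>Tame ramification\<close>

definition radical_of_ideal :: "('a, 'b) ring_scheme \<Rightarrow> 'a set \<Rightarrow> 'a set" where
  "radical_of_ideal A I = {x \<in> carrier A. \<exists>n::nat. x [^]\<^bsub>A\<^esub> n \<in> I}"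

definition trace_ideal :: "('a, 'b) ring_scheme \<Rightarrow> 'a set \<Rightarrow> 'a set \<Rightarrow> 'a set \<Rightarrow> 'a set" where
  "trace_ideal L K S P = {s \<in> S. \<forall>t\<in>S. field_trace L K (s \<otimes>\<^bsub>L\<^esub> t) \<in> P}"

definition tamely_ramified_over :: "('a, 'b) ring_scheme \<Rightarrow> 'a set \<Rightarrow> 'a set \<Rightarrow> 'a set \<Rightarrow> bool" where
  "tamely_ramified_over L K S P \<longleftrightarrow>
     trace_ideal L K S P
       = radical_of_ideal (L\<lparr>carrier := S\<rparr>) (genideal (L\<lparr>carrier := S\<rparr>) P)"


section \<open>Cohen--Seidenberg properties\<close>

text \<open>\<open>CS\<close> is a set of prime ideals of an overring of \<open>R\<close>, \<open>CR\<close> one of prime ideals of \<open>R\<close>.\<close>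

definition lying_over :: "'a set \<Rightarrow> 'a set set \<Rightarrow> 'a set set \<Rightarrow> bool" where
  "lying_over R CS CR \<longleftrightarrow> (\<forall>P\<in>CR. \<exists>Q\<in>CS. Q \<inter> R = P)"

definition incomparability :: "'a set \<Rightarrow> 'a set set \<Rightarrow> bool" where
  "incomparability R CS \<longleftrightarrow> (\<forall>Q\<in>CS. \<forall>Q'\<in>CS. Q \<subset> Q' \<longrightarrow> Q \<inter> R \<noteq> Q' \<inter> R)"

definition going_up :: "'a set \<Rightarrow> 'a set set \<Rightarrow> 'a set set \<Rightarrow> bool" where
  "going_up R CS CR \<longleftrightarrow>
     (\<forall>P\<in>CR. \<forall>P'\<in>CR. \<forall>Q\<in>CS. P \<subseteq> P' \<and> Q \<inter> R = P \<longrightarrow> (\<exists>Q'\<in>CS. Q \<subseteq> Q' \<and> Q' \<inter> R = P'))"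

definition going_down :: "'a set \<Rightarrow> 'a set set \<Rightarrow> 'a set set \<Rightarrow> bool" where
  "going_down R CS CR \<longleftrightarrow>
     (\<forall>P\<in>CR. \<forall>P'\<in>CR. \<forall>Q'\<in>CS. P \<subseteq> P' \<and> Q' \<inter> R = P' \<longrightarrow> (\<exists>Q\<in>CS. Q \<subseteq> Q' \<and> Q \<inter> R = P))"

end

theory Submission
  imports Defs
begin

text \<open>
  The argument rests on one identity: \<open>Tr (\<psi> x) = \<phi> (Tr x)\<close> for \<open>x \<in> S\<close> (\<open>trace_psi\<close>).
  A \<open>p\<^bsup>-1\<^esup>\<close>-linear map on a separable extension is determined by its restriction to the
  base field, because \<open>L\<close> is generated over \<open>K\<close> by \<open>p\<close>-th powers; so \<open>\<psi>\<close> commutes with the Galois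
  group. Write \<open>PTr P\<close> for the ideal of all \<open>s\<close> with \<open>Tr (s S) \<subseteq> P\<close>; tameness over \<open>P\<close> says that it
  is the radical of \<open>PS\<close>.

  Condition (a) implies (c): the ideal \<open>Tr S\<close> of \<open>R\<close> is stable under \<open>\<phi>\<close> by the identity. If it
  is proper, a maximal \<open>\<phi>\<close>-stable proper ideal \<open>P\<close> containing it is prime, hence a center of purity
  (\<open>center_above_trace\<close>). Then \<open>PTr P\<close> is all of \<open>S\<close>, which contradicts tameness over \<open>P\<close>.

  Condition (c) implies tameness over every prime \<open>P\<close>: an element with trace one forces \<open>PTr P\<close> to
  meet \<open>R\<close> in \<open>P\<close>. As this ideal is Galois stable, the characteristic polynomial of any of its
  elements is \<open>X\<^sup>n\<close> modulo \<open>P\<close>, and the element lies in the radical of \<open>PS\<close>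
  (\<open>PTr_subset_rad\<close>). The other inclusion always holds (\<open>rad_subset_PTr\<close>).

  Condition (a) implies (b): by the identity \<open>PTr P\<close> is stable under \<open>\<psi>\<close>, so for tame \<open>P\<close> the radical
  of \<open>PS\<close> is stable, and with it every prime over \<open>P\<close>, these being minimal over the radical
  (\<open>tame_imp_center_above\<close>). Contractions of centers are always centers.

  Condition (b) implies (c), the hardest part (\<open>centers_above_imp_onto\<close>): suppose \<open>Tr S \<subseteq> P\<close>
  for a center \<open>P\<close>, and let \<open>M\<close> be the fractional ideal of all \<open>y \<in> L\<close> with
  \<open>Tr (y S) \<subseteq> P\<close>, taken locally at \<open>P\<close>. It contains \<open>S\<close>. A prime \<open>Q\<close> over \<open>P\<close> is
  the ideal of denominators of some \<open>c \<notin> S\<close> (\<open>prime_above\<close>), so \<open>c Q \<subseteq> S \<subseteq> M\<close>. As \<open>Q\<close> is stable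
  under \<open>\<psi>\<close> and \<open>\<phi>\<close> preserves \<open>P\<close> and fixes one, the inclusion \<open>c Q \<subseteq> M\<close> implies
  \<open>c\<^sup>p Q \<subseteq> M\<close>. All the iterated \<open>p\<close>-th powers of \<open>c\<close> therefore have a
  common denominator; so \<open>c\<close> is integral locally at \<open>P\<close>, although \<open>Q\<close> is its denominator ideal.
  In terms of valuations: a stable prime at which the trace dual is too large would have a
  uniformizer whose inverse is integral.

  The Cohen--Seidenberg statements are then those for prime ideals in dimension one.

  Throughout, finite modules are handled by a chain condition on sequences (\<open>noeth_set\<close>), and
  dual bases are replaced by Galois coordinates: pairs \<open>(a\<^sub>j, b\<^sub>j)\<close> for which
  \<open>\<Sum> a\<^sub>j \<sigma>(b\<^sub>j)\<close> is one at the identity and zero at the other automorphisms.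
  They give \<open>x = \<Sum> a\<^sub>j Tr (b\<^sub>j x)\<close>, which shows at once that the trace is nonzero and
  nondegenerate, that \<open>S\<close> is Noetherian over \<open>R\<close>, and, after passing to \<open>p\<close>-th powers, the identity for
  \<open>\<psi>\<close> and \<open>\<phi>\<close>.
\<close>

section \<open>Submodules, ideals and integral elements over a subring of a field\<close>

locale subring_of_field = field L for L (structure) +
  fixes R :: "'a set"
  assumes subring: "subring R L"
begin

lemma R_carrier: "x \<in> R \<Longrightarrow> x \<in> carrier L"
  using subringE(1)[OF subring] by blast

lemma R_closed [simp]:
  "\<zero> \<in> R" "\<one> \<in> R"
  "x \<in> R \<Longrightarrow> y \<in> R \<Longrightarrow> x \<oplus> y \<in> R"
  "x \<in> R \<Longrightarrow> y \<in> R \<Longrightarrow> x \<otimes> y \<in> R"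
  "x \<in> R \<Longrightarrow> \<ominus> x \<in> R"
  "x \<in> R \<Longrightarrow> y \<in> R \<Longrightarrow> x \<ominus> y \<in> R"
  using subringE[OF subring] by (auto simp: a_minus_def)

lemma R_pow [simp]: "x \<in> R \<Longrightarrow> x [^] (n::nat) \<in> R"
  by (induction n) auto

text \<open>
  The \<open>R\<close>-submodules of \<open>L\<close>. They serve both as ideals, when contained in \<open>R\<close>, and as
  fractional ideals and modules of coefficients.
\<close>

definition submod :: "'a set \<Rightarrow> bool" where
  "submod M \<longleftrightarrow> M \<subseteq> carrier L \<and> \<zero> \<in> M \<and> (\<forall>x\<in>M. \<forall>y\<in>M. x \<oplus> y \<in> M) \<and>
     (\<forall>r\<in>R. \<forall>x\<in>M. r \<otimes> x \<in> M)"

lemma submodI: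
  assumes "M \<subseteq> carrier L" "\<zero> \<in> M" "\<And>x y. x \<in> M \<Longrightarrow> y \<in> M \<Longrightarrow> x \<oplus> y \<in> M"
    "\<And>r x. r \<in> R \<Longrightarrow> x \<in> M \<Longrightarrow> r \<otimes> x \<in> M"
  shows "submod M"
  using assms by (auto simp: submod_def)

lemma submodD:
  assumes "submod M"
  shows "x \<in> M \<Longrightarrow> x \<in> carrier L" "\<zero> \<in> M" "x \<in> M \<Longrightarrow> y \<in> M \<Longrightarrow> x \<oplus> y \<in> M"
    "r \<in> R \<Longrightarrow> x \<in> M \<Longrightarrow> r \<otimes> x \<in> M" "x \<in> M \<Longrightarrow> r \<in> R \<Longrightarrow> x \<otimes> r \<in> M"
    "x \<in> M \<Longrightarrow> \<ominus> x \<in> M" "x \<in> M \<Longrightarrow> y \<in> M \<Longrightarrow> x \<ominus> y \<in> M"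
proof -
  show A: "x \<in> M \<Longrightarrow> x \<in> carrier L" "\<zero> \<in> M" "x \<in> M \<Longrightarrow> y \<in> M \<Longrightarrow> x \<oplus> y \<in> M"
    "r \<in> R \<Longrightarrow> x \<in> M \<Longrightarrow> r \<otimes> x \<in> M" for x y r
    using assms by (auto simp: submod_def)
  show "x \<in> M \<Longrightarrow> r \<in> R \<Longrightarrow> x \<otimes> r \<in> M" using A(1,4) m_comm R_carrier by metis
  show B: "x \<in> M \<Longrightarrow> \<ominus> x \<in> M" for x
    using A(4)[of "\<ominus> \<one>" x] A(1)[of x] by (simp add: l_minus)
  show "x \<in> M \<Longrightarrow> y \<in> M \<Longrightarrow> x \<ominus> y \<in> M" using A(3) B by (simp add: a_minus_def)
qed

lemma submod_finsum:
  assumes "submod M" "\<And>i. i \<in> I \<Longrightarrow> f i \<in> M"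
  shows "(\<Oplus>i\<in>I. f i) \<in> M"
proof (cases "finite I")
  case True
  then show ?thesis using assms(2)
  proof (induction I)
    case (insert i I)
    then show ?case using submodD[OF assms(1)] by (subst finsum_insert) auto
  qed (use submodD[OF assms(1)] in auto)
qed (use submodD[OF assms(1)] in auto)

lemma submod_R: "submod R"
  by (rule submodI) (auto simp: R_carrier)

lemma ideal_iff: "ideal I (L\<lparr>carrier := R\<rparr>) \<longleftrightarrow> submod I \<and> I \<subseteq> R"
proof
  interpret A: ring "L\<lparr>carrier := R\<rparr>" by (rule subring_is_ring[OF subring])
  assume "ideal I (L\<lparr>carrier := R\<rparr>)"
  then interpret J: ideal I "L\<lparr>carrier := R\<rparr>" .
  show "submod I \<and> I \<subseteq> R"
    using J.a_subset J.a_closed J.I_l_closed J.zero_closed R_carrier by (auto intro!: submodI)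
next
  interpret A: ring "L\<lparr>carrier := R\<rparr>" by (rule subring_is_ring[OF subring])
  assume I: "submod I \<and> I \<subseteq> R"
  note D = submodD[OF conjunct1[OF I]]
  have "subgroup I (add_monoid (L\<lparr>carrier := R\<rparr>))"
  proof (rule A.add.subgroupI)
    show "I \<subseteq> carrier (L\<lparr>carrier := R\<rparr>)" "I \<noteq> {}" using I D by auto
    show "\<ominus>\<^bsub>L\<lparr>carrier := R\<rparr>\<^esub> a \<in> I" if "a \<in> I" for a
    proof -
      have "a \<in> R" using that I by auto
      moreover have "\<ominus> a \<oplus>\<^bsub>L\<lparr>carrier := R\<rparr>\<^esub> a = \<zero>\<^bsub>L\<lparr>carrier := R\<rparr>\<^esub>"
        using that D(1) by (simp add: l_neg)
      ultimately have "\<ominus>\<^bsub>L\<lparr>carrier := R\<rparr>\<^esub> a = \<ominus> a"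
        using A.minus_equality by simp
      then show ?thesis using D(6) that by simp
    qed
  qed (use I D in auto)
  then show "ideal I (L\<lparr>carrier := R\<rparr>)"
    using I D by (intro idealI subring_is_ring subring) auto
qed

definition prime_in :: "'a set \<Rightarrow> bool" where
  "prime_in P \<longleftrightarrow> submod P \<and> P \<subseteq> R \<and> \<one> \<notin> P \<and> (\<forall>a\<in>R. \<forall>b\<in>R. a \<otimes> b \<in> P \<longrightarrow> a \<in> P \<or> b \<in> P)"

lemma cring_R: "cring (L\<lparr>carrier := R\<rparr>)"
  using subcring_iff[of R] subcringI'[OF subring] R_carrier by blast

lemma primeideal_iff: "primeideal P (L\<lparr>carrier := R\<rparr>) \<longleftrightarrow> prime_in P"
proof
  assume "primeideal P (L\<lparr>carrier := R\<rparr>)"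
  then interpret Q: primeideal P "L\<lparr>carrier := R\<rparr>" .
  have I: "submod P \<and> P \<subseteq> R" using ideal_iff Q.is_ideal by blast
  moreover have "\<one> \<notin> P"
  proof
    assume one: "\<one> \<in> P"
    have "r \<in> P" if "r \<in> R" for r
      using submodD(4)[of P r \<one>] I one that R_carrier by simp
    then show False using Q.I_notcarr I by auto
  qed
  ultimately show "prime_in P" using Q.I_prime by (auto simp: prime_in_def)
next
  assume P: "prime_in P"
  show "primeideal P (L\<lparr>carrier := R\<rparr>)"
    by (rule primeidealI) (use P cring_R ideal_iff in \<open>auto simp: prime_in_def\<close>)
qed

lemma prime_inD:
  assumes "prime_in P"
  shows "submod P" "P \<subseteq> R" "\<one> \<notin> P" "a \<in> R \<Longrightarrow> b \<in> R \<Longrightarrow> a \<otimes> b \<in> P \<Longrightarrow> a \<in> P \<or> b \<in> P"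
  using assms by (auto simp: prime_in_def)

lemma prime_in_pow:
  assumes "prime_in P" "a \<in> R" "a [^] (n::nat) \<in> P"
  shows "a \<in> P"
  using assms(3)
proof (induction n)
  case (Suc n)
  then show ?case using prime_inD(4)[OF assms(1), of "a [^] n" a] assms(2) by auto
qed (use prime_inD[OF assms(1)] in auto)

text \<open>
  The \<open>R\<close>-submodule generated by \<open>U\<close>. The inductive form gives the usual closure properties by
  induction and makes explicit coefficient families unnecessary; it also covers infinite \<open>U\<close>.
\<close>

inductive_set rspan :: "'a set \<Rightarrow> 'a set" for U :: "'a set" where
  rspan_zero: "\<zero> \<in> rspan U"
| rspan_add: "r \<in> R \<Longrightarrow> x \<in> U \<Longrightarrow> y \<in> rspan U \<Longrightarrow> r \<otimes> x \<oplus> y \<in> rspan U"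

lemma rspan_carrier: "y \<in> rspan U \<Longrightarrow> U \<subseteq> carrier L \<Longrightarrow> y \<in> carrier L"
  by (induction rule: rspan.induct) (auto simp: R_carrier)

lemma rspan_least: "y \<in> rspan U \<Longrightarrow> submod M \<Longrightarrow> U \<subseteq> M \<Longrightarrow> y \<in> M"
  by (induction rule: rspan.induct) (auto simp: submodD)

lemma rspan_submod:
  assumes "U \<subseteq> carrier L"
  shows "submod (rspan U)"
proof (rule submodI)
  show "x \<oplus> y \<in> rspan U" if "x \<in> rspan U" "y \<in> rspan U" for x y
    using that
  proof (induction rule: rspan.induct)
    case rspan_zero
    then show ?case using rspan_carrier assms by simp
  next
    case (rspan_add r x z)
    have "(r \<otimes> x \<oplus> z) \<oplus> y = r \<otimes> x \<oplus> (z \<oplus> y)"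
      using rspan_add assms rspan_carrier R_carrier by (intro a_assoc) auto
    then show ?case using rspan_add by (auto intro: rspan.rspan_add)
  qed
  show "s \<otimes> x \<in> rspan U" if "s \<in> R" "x \<in> rspan U" for x s
    using that(2,1)
  proof (induction rule: rspan.induct)
    case rspan_zero
    then show ?case using R_carrier by (auto intro: rspan.rspan_zero)
  next
    case (rspan_add r x z)
    have "s \<otimes> (r \<otimes> x \<oplus> z) = (s \<otimes> r) \<otimes> x \<oplus> s \<otimes> z"
      using rspan_add assms rspan_carrier R_carrier by (subst r_distr) (auto simp: m_assoc)
    then show ?case using rspan_add by (auto intro: rspan.rspan_add)
  qed
qed (use assms rspan_carrier in \<open>auto intro: rspan.intros\<close>)

lemma rspan_gen:
  assumes "x \<in> U" "U \<subseteq> carrier L"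
  shows "x \<in> rspan U"
  using rspan.rspan_add[of \<one> x U \<zero>] rspan.rspan_zero assms by auto

lemma rspan_mono: "y \<in> rspan U \<Longrightarrow> U \<subseteq> Y \<Longrightarrow> y \<in> rspan Y"
  by (induction rule: rspan.induct) (auto intro: rspan.intros)

lemma rspan_insert:
  assumes "y \<in> rspan (insert m U)" "m \<in> carrier L" "U \<subseteq> carrier L"
  shows "\<exists>a\<in>R. y \<ominus> a \<otimes> m \<in> rspan U"
  using assms
proof (induction rule: rspan.induct)
  case rspan_zero
  then show ?case by (intro bexI[of _ \<zero>]) (auto simp: a_minus_def intro: rspan.intros)
next
  case (rspan_add r x z)
  then obtain a where a: "a \<in> R" "z \<ominus> a \<otimes> m \<in> rspan U" by auto
  have z: "z \<in> carrier L" using rspan_add rspan_carrier[of z "insert m U"] by auto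
  note c = a(1)[THEN R_carrier] z rspan_add(1)[THEN R_carrier] rspan_add.prems
  show ?case
  proof (cases "x = m")
    case True
    have "(r \<otimes> m \<oplus> z) \<ominus> (r \<oplus> a) \<otimes> m = z \<ominus> a \<otimes> m"
      using c by algebra
    then show ?thesis using True a rspan_add by (intro bexI[of _ "r \<oplus> a"]) auto
  next
    case False
    then have x: "x \<in> U" using rspan_add by auto
    then have "x \<in> carrier L" using rspan_add by auto
    then have "(r \<otimes> x \<oplus> z) \<ominus> a \<otimes> m = r \<otimes> x \<oplus> (z \<ominus> a \<otimes> m)"
      using c by algebra
    then show ?thesis using x a rspan_add by (intro bexI[of _ a]) (auto intro: rspan.rspan_add)
  qed
qed

lemma rspan_scale:
  assumes "y \<in> rspan U" "U \<subseteq> carrier L" "c \<in> carrier L"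
  shows "c \<otimes> y \<in> rspan ((\<otimes>) c ` U)"
  using assms
proof (induction rule: rspan.induct)
  case (rspan_add r x z)
  then have "c \<otimes> (r \<otimes> x \<oplus> z) = r \<otimes> (c \<otimes> x) \<oplus> c \<otimes> z"
    using rspan_carrier[of z U] R_carrier[of r] by (subst r_distr) (auto simp: m_lcomm)
  then show ?case using rspan_add by (auto intro: rspan.rspan_add)
qed (auto intro: rspan.intros)

lemma rspan_eval:
  assumes "x \<in> carrier L" "y \<in> rspan {x [^] i | i::nat. i < k}"
  shows "\<exists>f. length f = k \<and> set f \<subseteq> R \<and> y = eval f x"
  using assms(2)
proof (induction k arbitrary: y)
  case 0
  then have "y \<in> rspan {}" by simp
  then show ?case by (induction rule: rspan.induct) auto
next
  case (Suc k)
  have "{x [^] i | i::nat. i < Suc k} = insert (x [^] k) {x [^] i | i::nat. i < k}"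
    by (auto simp: less_Suc_eq)
  then obtain a where a: "a \<in> R" "y \<ominus> a \<otimes> x [^] k \<in> rspan {x [^] i | i::nat. i < k}"
    using rspan_insert[of y "x [^] k" "{x [^] i | i::nat. i < k}"] Suc.prems assms(1) by auto
  then obtain f where f: "length f = k" "set f \<subseteq> R" "y \<ominus> a \<otimes> x [^] k = eval f x"
    using Suc.IH by blast
  have "y \<in> carrier L" using Suc.prems rspan_carrier assms(1) by blast
  then have "y = a \<otimes> x [^] k \<oplus> (y \<ominus> a \<otimes> x [^] k)"
    using a(1)[THEN R_carrier] nat_pow_closed[OF assms(1), of k] by algebra
  then have "y = eval (a # f) x" using f by simp
  then show ?case using f a by (intro exI[of _ "a # f"]) auto
qed

lemma eval_rspan:
  assumes "x \<in> carrier L" "set f \<subseteq> R"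
  shows "eval f x \<in> rspan {x [^] i | i::nat. i < length f}"
  using assms(2)
proof (induction f)
  case (Cons a f)
  have "eval f x \<in> rspan {x [^] i | i::nat. i < length (a # f)}"
    using Cons by (intro rspan_mono[OF Cons.IH]) auto
  then show ?case using Cons by (auto intro!: rspan.rspan_add)
qed (auto intro: rspan.intros)

lemma carrier_univ_poly: "f \<in> carrier (univ_poly L R) \<longleftrightarrow> f = [] \<or> (set f \<subseteq> R \<and> hd f \<noteq> \<zero>)"
  by (simp add: univ_poly_def polynomial_def)

text \<open>
  An equation of integral dependence of degree \<open>k\<close> expresses the power \<open>x\<^sup>k\<close> through the lower
  powers. In this form integrality follows from finiteness properties of modules without
  handling polynomials.
\<close>

lemma integral_over_iff:
  assumes x: "x \<in> carrier L"
  shows "integral_over L R x \<longleftrightarrow> (\<exists>k::nat. x [^] k \<in> rspan {x [^] i | i::nat. i < k})"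
proof
  assume "integral_over L R x"
  then obtain f where f: "set f \<subseteq> R" "f \<noteq> []" "hd f = \<one>" "eval f x = \<zero>"
    by (auto simp: integral_over_def carrier_univ_poly)
  then obtain g where g: "f = \<one> # g" by (cases f) auto
  define U where "U = {x [^] i | i::nat. i < length g}"
  have U: "U \<subseteq> carrier L" using x by (auto simp: U_def)
  have e: "eval g x \<in> rspan U" unfolding U_def using eval_rspan[OF x] f g by simp
  have "x [^] length g \<oplus> eval g x = \<zero>" using f g x by simp
  then have "x [^] length g = \<ominus> eval g x"
    using x e rspan_carrier[OF e U] minus_equality a_comm by (metis minus_minus nat_pow_closed)
  then have "x [^] length g \<in> rspan U" using submodD(6)[OF rspan_submod[OF U] e] by simp
  then show "\<exists>k::nat. x [^] k \<in> rspan {x [^] i | i::nat. i < k}" unfolding U_def by blast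
next
  assume "\<exists>k::nat. x [^] k \<in> rspan {x [^] i | i::nat. i < k}"
  then obtain k :: nat where k: "x [^] k \<in> rspan {x [^] i | i::nat. i < k}" by blast
  have U: "{x [^] i | i::nat. i < k} \<subseteq> carrier L" using x by auto
  obtain f where f: "length f = k" "set f \<subseteq> R" "\<ominus> (x [^] k) = eval f x"
    using rspan_eval[OF x submodD(6)[OF rspan_submod[OF U] k]] by blast
  have "eval (\<one> # f) x = \<zero>" using x f by (simp add: f(3)[symmetric] r_neg)
  then show "integral_over L R x" using f unfolding integral_over_def
    by (intro bexI[of _ "\<one> # f"]) (auto simp: carrier_univ_poly)
qed

end

section \<open>Chain conditions and the integral closure\<close>

lemma (in subring_of_field) rspan_hom:
  assumes h: "h \<in> ring_hom L L" "\<And>r. r \<in> R \<Longrightarrow> h r = r"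
    and y: "y \<in> rspan U" and U: "U \<subseteq> carrier L"
  shows "h y \<in> rspan (h ` U)"
  using y
proof (induction rule: rspan.induct)
  case rspan_zero
  then show ?case using h(2)[of \<zero>] by (auto intro: rspan.rspan_zero)
next
  case (rspan_add r x z)
  have "h (r \<otimes> x \<oplus> z) = r \<otimes> h x \<oplus> h z"
    using rspan_add U rspan_carrier[of z U] R_carrier[of r] h(2)[of r]
    by (subst ring_hom_add[OF h(1)]) (auto simp: ring_hom_mult[OF h(1)])
  then show ?case using rspan_add by (auto intro: rspan.rspan_add)
qed

lemma (in subring_of_field) integral_over_hom:
  assumes h: "h \<in> ring_hom L L" "\<And>r. r \<in> R \<Longrightarrow> h r = r"
    and x: "x \<in> carrier L" "integral_over L R x"
  shows "integral_over L R (h x)"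
proof -
  have hp: "h (x [^] i) = h x [^] i" for i :: nat
    by (induction i) (use ring_hom_one[OF h(1)] ring_hom_mult[OF h(1)] x(1) in auto)
  obtain k :: nat where k: "x [^] k \<in> rspan {x [^] i | i::nat. i < k}"
    using x integral_over_iff by blast
  have "h (x [^] k) \<in> rspan (h ` {x [^] i | i::nat. i < k})"
    by (rule rspan_hom[OF h k]) (use x in auto)
  also have "h ` {x [^] i | i::nat. i < k} = {h x [^] i | i::nat. i < k}"
    by (force simp: hp[symmetric])
  finally show ?thesis using hp ring_hom_closed[OF h(1) x(1)] integral_over_iff by auto
qed

text \<open>
  A chain condition for the \<open>R\<close>-submodules contained in \<open>A\<close>: no sequence in \<open>A\<close> generates a
  strictly growing chain of modules. In contrast to finite generation it passes to arbitrary
  subsets \<open>A\<close>. It yields maximal members of families of submodules and, applied to a sequence of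
  powers, equations of integral dependence.
\<close>

definition (in subring_of_field) noeth_set :: "'a set \<Rightarrow> bool" where
  "noeth_set A \<longleftrightarrow> A \<subseteq> carrier L \<and>
     (\<forall>v::nat \<Rightarrow> 'a. (\<forall>k. v k \<in> A) \<longrightarrow> (\<exists>k. v k \<in> rspan (v ` {..<k})))"

lemma (in subring_of_field) noeth_set_maximal:
  assumes A: "noeth_set A" and F: "F \<noteq> {}" "\<And>M. M \<in> F \<Longrightarrow> submod M \<and> M \<subseteq> A"
  shows "\<exists>M\<in>F. \<forall>N\<in>F. M \<subseteq> N \<longrightarrow> N = M"
proof (rule ccontr)
  assume "\<not> ?thesis"
  then have "\<forall>M. \<exists>N. M \<in> F \<longrightarrow> N \<in> F \<and> M \<subset> N" by blast
  then obtain g where g: "\<And>M. M \<in> F \<Longrightarrow> g M \<in> F \<and> M \<subset> g M" by metis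
  obtain M0 where M0: "M0 \<in> F" using F by blast
  define f where "f n = (g ^^ n) M0" for n
  have f: "f n \<in> F" for n by (induction n) (auto simp: f_def M0 g)
  have step: "f n \<subset> f (Suc n)" for n using g[OF f[of n]] by (simp add: f_def)
  have mono: "f i \<subseteq> f j" if "i \<le> j" for i j
    using that by (rule lift_Suc_mono_le[rotated]) (use step in blast)
  have "\<forall>n. \<exists>x. x \<in> f (Suc n) - f n" using step by blast
  then obtain v where v: "\<And>n. v n \<in> f (Suc n) - f n" by metis
  have "v k \<in> A" for k using v[of k] F(2)[OF f[of "Suc k"]] by blast
  then obtain k where "v k \<in> rspan (v ` {..<k})" using A unfolding noeth_set_def by blast
  moreover have "v ` {..<k} \<subseteq> f k"
  proof (rule image_subsetI)
    fix i assume "i \<in> {..<k}"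
    then show "v i \<in> f k" using v[of i] mono[of "Suc i" k] by auto
  qed
  ultimately have "v k \<in> f k" using rspan_least F(2)[OF f] by blast
  then show False using v by blast
qed

lemma (in subring_of_field) noeth_set_subset: "noeth_set A \<Longrightarrow> B \<subseteq> A \<Longrightarrow> noeth_set B"
  unfolding noeth_set_def by blast

lemma (in subring_of_field) noeth_set_scale:
  assumes A: "noeth_set A" and d: "d \<in> carrier L" "d \<noteq> \<zero>"
    and B: "B \<subseteq> carrier L" "\<And>x. x \<in> B \<Longrightarrow> d \<otimes> x \<in> A"
  shows "noeth_set B"
  unfolding noeth_set_def
proof (intro conjI allI impI B(1))
  fix v :: "nat \<Rightarrow> 'a" assume v: "\<forall>k. v k \<in> B"
  then have "\<forall>k. d \<otimes> v k \<in> A" using B by auto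
  then obtain k where "d \<otimes> v k \<in> rspan ((\<lambda>k. d \<otimes> v k) ` {..<k})"
    using A unfolding noeth_set_def by (auto dest: spec[of _ "\<lambda>k. d \<otimes> v k"])
  then have "inv d \<otimes> (d \<otimes> v k) \<in> rspan ((\<otimes>) (inv d) ` ((\<lambda>k. d \<otimes> v k) ` {..<k}))"
    by (rule rspan_scale) (use d B v in \<open>auto simp: field_Units\<close>)
  moreover have "inv d \<otimes> (d \<otimes> v i) = v i" for i
  proof -
    have "v i \<in> carrier L" using v B(1) by blast
    then show ?thesis using d by (subst m_assoc[symmetric]) (auto simp: field_Units)
  qed
  ultimately show "\<exists>k. v k \<in> rspan (v ` {..<k})" by (auto simp: image_image)
qed

locale noeth_subring = subring_of_field +
  assumes noeth: "noetherian_ring (L\<lparr>carrier := R\<rparr>)"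
begin

text \<open>
  The Hilbert basis argument for finitely generated modules. Splitting off one generator \<open>m\<close>, the
  coefficients at \<open>m\<close> of combinations of \<open>v\<^sub>0, \<dots>, v\<^sub>k\<^sub>-\<^sub>1\<close> (modulo the other generators) form an
  increasing chain of ideals of \<open>R\<close>. Once it is stationary, \<open>m\<close> can be eliminated from all later
  vectors, and induction on the number of generators applies.
\<close>

lemma noeth_set_rspan:
  assumes "finite U" "U \<subseteq> carrier L"
  shows "noeth_set (rspan U)"
proof -
  have "\<exists>k. v k \<in> rspan (v ` {..<k})" if "\<And>k. v k \<in> rspan U" for v :: "nat \<Rightarrow> 'a"
    using assms that
  proof (induction U arbitrary: v)
    case empty
    then have "v 0 \<in> {\<zero>}" using rspan_least[of "v 0" "{}" "{\<zero>}"]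
      by (auto simp: submod_def R_carrier)
    then show ?case by (intro exI[of _ 0]) (auto intro: rspan.intros)
  next
    case (insert m U)
    have m: "m \<in> carrier L" and U: "U \<subseteq> carrier L" using insert by auto
    have vc: "v k \<in> carrier L" for k
      using insert.prems by (auto intro: rspan_carrier[of _ "insert m U"])
    have sv: "submod (rspan (v ` A))" for A using vc by (intro rspan_submod) auto
    note sU = rspan_submod[OF U]
    \<comment> \<open>The ideal of leading coefficients of the first \<open>k\<close> vectors.\<close>
    define I where "I k = {a\<in>R. \<exists>u\<in>rspan (v ` {..<k}). u \<ominus> a \<otimes> m \<in> rspan U}" for k
    have I_mono: "I i \<subseteq> I j" if "i \<le> j" for i j
      using that rspan_mono[of _ "v ` {..<i}" "v ` {..<j}"] unfolding I_def by fastforce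
    have I_sub: "submod (I k)" for k
    proof (rule submodI)
      show "\<zero> \<in> I k" unfolding I_def using m
        by (auto intro!: bexI[of _ \<zero>] rspan.rspan_zero simp: a_minus_def)
      show "x \<oplus> y \<in> I k" if xy: "x \<in> I k" "y \<in> I k" for x y
      proof -
        obtain a b where ab: "a \<in> rspan (v ` {..<k})" "a \<ominus> x \<otimes> m \<in> rspan U" "x \<in> R"
          "b \<in> rspan (v ` {..<k})" "b \<ominus> y \<otimes> m \<in> rspan U" "y \<in> R"
          using xy by (auto simp: I_def)
        have "a \<in> carrier L" "b \<in> carrier L" using ab submodD(1)[OF sv] by auto
        then have "(a \<ominus> x \<otimes> m) \<oplus> (b \<ominus> y \<otimes> m) = (a \<oplus> b) \<ominus> (x \<oplus> y) \<otimes> m"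
          using m ab(3,6)[THEN R_carrier] by algebra
        then show ?thesis using ab submodD(3)[OF sv] submodD(3)[OF sU ab(2,5)]
          by (auto simp: I_def)
      qed
      show "r \<otimes> x \<in> I k" if xy: "r \<in> R" "x \<in> I k" for r x
      proof -
        obtain a where ab: "a \<in> rspan (v ` {..<k})" "a \<ominus> x \<otimes> m \<in> rspan U" "x \<in> R"
          using xy by (auto simp: I_def)
        have "a \<in> carrier L" using ab submodD(1)[OF sv] by auto
        then have "r \<otimes> (a \<ominus> x \<otimes> m) = (r \<otimes> a) \<ominus> (r \<otimes> x) \<otimes> m"
          using m ab(3)[THEN R_carrier] xy(1)[THEN R_carrier] by algebra
        then show ?thesis using ab xy submodD(4)[OF sv] submodD(4)[OF sU xy(1) ab(2)]
          by (auto simp: I_def)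
      qed
    qed (auto simp: I_def R_carrier)
    have "\<Union>(range I) \<in> range I"
    proof (rule noetherian_ring.ideal_chain_is_trivial[OF noeth])
      show "subset.chain {I. ideal I (L\<lparr>carrier := R\<rparr>)} (range I)"
      proof (unfold subset_chain_def, intro conjI ballI subsetI)
        fix J assume "J \<in> range I"
        then obtain i where "J = I i" by blast
        moreover have "I i \<subseteq> R" by (auto simp: I_def)
        ultimately show "J \<in> {I. ideal I (L\<lparr>carrier := R\<rparr>)}" using I_sub ideal_iff by blast
      next
        fix J J' assume "J \<in> range I" "J' \<in> range I"
        then obtain i j where "J = I i" "J' = I j" by blast
        then show "J \<subseteq> J' \<or> J' \<subseteq> J" using I_mono[of i j] I_mono[of j i] nat_le_linear[of i j] by blast
      qed
    qed auto
    then obtain m0 where m0: "\<And>k. I k \<subseteq> I m0" by blast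
    have "\<forall>k. \<exists>u\<in>rspan (v ` {..<m0}). v k \<ominus> u \<in> rspan U"
    proof
      fix k
      obtain a where a: "a \<in> R" "v k \<ominus> a \<otimes> m \<in> rspan U"
        using rspan_insert[OF insert.prems(2) m U] by blast
      have "v k \<in> rspan (v ` {..<Suc k})" by (rule rspan_gen) (use vc in auto)
      then have "a \<in> I (Suc k)" using a by (auto simp: I_def)
      then have "a \<in> I m0" using m0 by blast
      then obtain u where u: "u \<in> rspan (v ` {..<m0})" "u \<ominus> a \<otimes> m \<in> rspan U"
        by (auto simp: I_def)
      have uc: "u \<in> carrier L" using submodD(1)[OF sv u(1)] .
      have "(v k \<ominus> a \<otimes> m) \<ominus> (u \<ominus> a \<otimes> m) = v k \<ominus> u"
        using uc vc[of k] m a(1)[THEN R_carrier] by algebra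
      then show "\<exists>u\<in>rspan (v ` {..<m0}). v k \<ominus> u \<in> rspan U"
        using submodD(7)[OF sU a(2) u(2)] u(1) by auto
    qed
    then obtain u where u: "\<And>k. u k \<in> rspan (v ` {..<m0})" "\<And>k. v k \<ominus> u k \<in> rspan U"
      by metis
    \<comment> \<open>The vectors from index \<open>m0\<close> on, with the generator \<open>m\<close> eliminated.\<close>
    define w where "w k = v (m0 + k) \<ominus> u (m0 + k)" for k
    have "w k \<in> rspan U" for k unfolding w_def by (rule u(2))
    then obtain k where k: "w k \<in> rspan (w ` {..<k})" using insert.IH[of w] U by blast
    have *: "u i \<in> rspan (v ` {..<m0 + k})" for i by (rule rspan_mono[OF u(1)]) auto
    have "w ` {..<k} \<subseteq> rspan (v ` {..<m0 + k})"
      unfolding w_def using vc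
      by (intro image_subsetI submodD(7)[OF sv] * rspan_gen) auto
    then have "w k \<in> rspan (v ` {..<m0 + k})" using rspan_least[OF k sv] by blast
    then have "w k \<oplus> u (m0 + k) \<in> rspan (v ` {..<m0 + k})" using * submodD(3)[OF sv] by blast
    moreover have "w k \<oplus> u (m0 + k) = v (m0 + k)"
      unfolding w_def using vc[of "m0 + k"] submodD(1)[OF sv u(1)] by algebra
    ultimately show ?case by auto
  qed
  then show ?thesis using rspan_carrier assms unfolding noeth_set_def by blast
qed

lemma noeth_set_R: "noeth_set R"
proof (rule noeth_set_subset)
  show "noeth_set (rspan {\<one>})" by (rule noeth_set_rspan) auto
  show "R \<subseteq> rspan {\<one>}"
  proof
    fix x assume "x \<in> R"
    then have "x \<otimes> \<one> \<in> rspan {\<one>}" using submodD(4)[OF rspan_submod, of "{\<one>}" x \<one>] rspan_gen by auto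
    then show "x \<in> rspan {\<one>}" using \<open>x \<in> R\<close> R_carrier by simp
  qed
qed

text \<open>
  An almost integral element is integral: only one fixed denominator \<open>c\<close> for all powers of \<open>x\<close> is
  needed, as \<open>A\<close> forces some power to depend on the earlier ones.
\<close>

lemma integral_overI:
  assumes x: "x \<in> carrier L" and A: "noeth_set A" and c: "c \<in> carrier L" "c \<noteq> \<zero>"
    and xc: "\<And>k::nat. c \<otimes> x [^] k \<in> A"
  shows "integral_over L R x"
proof -
  have "noeth_set {x [^] k | k::nat. True}"
    by (rule noeth_set_scale[OF A c]) (use x xc in auto)
  then obtain k where "x [^] k \<in> rspan ((\<lambda>k. x [^] k) ` {..<k::nat})"
    unfolding noeth_set_def by (auto dest!: spec[of _ "\<lambda>k. x [^] k"])
  moreover have "(\<lambda>k. x [^] k) ` {..<k} = {x [^] i | i::nat. i < k}" by auto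
  ultimately show ?thesis using integral_over_iff[OF x] by auto
qed

lemma integral_over_R: "x \<in> R \<Longrightarrow> integral_over L R x"
  by (rule integral_overI[OF _ noeth_set_R, of x \<one>]) (auto simp: R_carrier)

lemma integral_over_span:
  assumes "t \<in> carrier L" "finite U" "U \<subseteq> carrier L" "\<one> \<in> U"
    "\<And>z. z \<in> rspan U \<Longrightarrow> t \<otimes> z \<in> rspan U"
  shows "integral_over L R t"
proof (rule integral_overI[OF _ noeth_set_rspan, of t U \<one>])
  fix k :: nat
  have "t [^] k \<in> rspan U"
  proof (induction k)
    case 0
    then show ?case using assms rspan_gen by auto
  next
    case (Suc k)
    then show ?case using assms(5)[OF Suc] m_comm[of t "t [^] k"] assms(1) by simp
  qed
  then show "\<one> \<otimes> t [^] k \<in> rspan U" using assms(1) by simp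
qed (use assms in auto)

text \<open>
  The products \<open>x\<^sup>i y\<^sup>j\<close> of bounded degrees generate a finite module stable under
  multiplication by \<open>x\<close> and \<open>y\<close>, hence by their sum and product.
\<close>

lemma integral_over_add_mult:
  assumes x: "x \<in> carrier L" "integral_over L R x" and y: "y \<in> carrier L" "integral_over L R y"
  shows "integral_over L R (x \<oplus> y) \<and> integral_over L R (x \<otimes> y)"
proof -
  have 1: "\<exists>n>0. t [^] n \<in> rspan {t [^] i | i::nat. i < n}"
    if t: "t \<in> carrier L" "integral_over L R t" for t
  proof -
    obtain n :: nat where n: "t [^] n \<in> rspan {t [^] i | i::nat. i < n}"
      using integral_over_iff[OF t(1)] t(2) by blast
    have "n \<noteq> 0"
    proof
      assume "n = 0"
      then have "\<one> \<in> rspan {}" using n[unfolded \<open>n = 0\<close>] by simp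
      then have "\<one> \<in> {\<zero>}" by (rule rspan_least) (auto simp: submod_def R_carrier)
      then show False by simp
    qed
    then show ?thesis using n by (intro exI[of _ n]) simp
  qed
  obtain n :: nat where n: "n > 0" "x [^] n \<in> rspan {x [^] i | i::nat. i < n}"
    using 1[OF x] by blast
  obtain m :: nat where m: "m > 0" "y [^] m \<in> rspan {y [^] i | i::nat. i < m}"
    using 1[OF y] by blast
  define U where "U = (\<lambda>(i, j). x [^] i \<otimes> y [^] j) ` ({..<n} \<times> {..<m})"
  have U: "finite U" "U \<subseteq> carrier L" "\<one> \<in> U"
  proof -
    show "finite U" "U \<subseteq> carrier L" using x(1) y(1) by (auto simp: U_def)
    show "\<one> \<in> U" unfolding U_def
      by (rule image_eqI[of _ _ "(0, 0)"]) (use x(1) y(1) n(1) m(1) in auto)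
  qed
  note s = rspan_submod[OF U(2)]
  have gen: "x [^] i \<otimes> y [^] j \<in> rspan U" if "i < n" "j < m" for i j
    by (rule rspan_gen[OF _ U(2)]) (use that in \<open>auto simp: U_def\<close>)
  have "x \<otimes> u \<in> rspan U \<and> y \<otimes> u \<in> rspan U" if u: "u \<in> U" for u
  proof -
    obtain i j where ij: "i < n" "j < m" "u = x [^] i \<otimes> y [^] j" using u by (auto simp: U_def)
    have "x \<otimes> u = x [^] Suc i \<otimes> y [^] j" "y \<otimes> u = x [^] i \<otimes> y [^] Suc j"
      using x(1) y(1) by (auto simp: ij m_ac)
    moreover have "x [^] Suc i \<otimes> y [^] j \<in> rspan U"
    proof (cases "Suc i < n")
      case True
      then show ?thesis using gen[of "Suc i" j] ij by blast
    next
      case False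
      then have n': "n = Suc i" using ij by simp
      have "y [^] j \<otimes> x [^] Suc i \<in> rspan ((\<otimes>) (y [^] j) ` {x [^] i | i::nat. i < n})"
        using n(2) unfolding n' by (rule rspan_scale) (use x(1) y(1) in auto)
      moreover have "(\<otimes>) (y [^] j) ` {x [^] i | i::nat. i < n} \<subseteq> rspan U"
      proof (rule image_subsetI)
        fix z assume "z \<in> {x [^] i | i::nat. i < n}"
        then obtain l where "l < n" "z = x [^] l" by blast
        then show "y [^] j \<otimes> z \<in> rspan U"
          using gen[of l j] ij x(1) y(1) by (simp add: m_comm)
      qed
      ultimately have "y [^] j \<otimes> x [^] Suc i \<in> rspan U" using rspan_least[OF _ s] by blast
      then show ?thesis using x(1) y(1) m_comm[of "y [^] j" "x [^] Suc i"] by simp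
    qed
    moreover have "x [^] i \<otimes> y [^] Suc j \<in> rspan U"
    proof (cases "Suc j < m")
      case True
      then show ?thesis using gen[of i "Suc j"] ij by blast
    next
      case False
      then have m': "m = Suc j" using ij by simp
      have "x [^] i \<otimes> y [^] Suc j \<in> rspan ((\<otimes>) (x [^] i) ` {y [^] i | i::nat. i < m})"
        using m(2) unfolding m' by (rule rspan_scale) (use x(1) y(1) in auto)
      moreover have "(\<otimes>) (x [^] i) ` {y [^] i | i::nat. i < m} \<subseteq> rspan U"
      proof (rule image_subsetI)
        fix z assume "z \<in> {y [^] i | i::nat. i < m}"
        then obtain l where "l < m" "z = y [^] l" by blast
        then show "x [^] i \<otimes> z \<in> rspan U" using gen[of i l] ij by simp
      qed
      ultimately show ?thesis using rspan_least[OF _ s] by blast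
    qed
    ultimately show ?thesis by simp
  qed
  then have *: "x \<otimes> z \<in> rspan U" "y \<otimes> z \<in> rspan U" if "z \<in> rspan U" for z
    using rspan_least[OF rspan_scale[OF that U(2) x(1)] s]
      rspan_least[OF rspan_scale[OF that U(2) y(1)] s] by (auto simp: image_subset_iff)
  have "(x \<oplus> y) \<otimes> z \<in> rspan U" "(x \<otimes> y) \<otimes> z \<in> rspan U" if "z \<in> rspan U" for z
    using *[OF that] *(1)[OF *(2)[OF that]] submodD(3)[OF s] submodD(1)[OF s that] x(1) y(1)
    by (auto simp: l_distr m_assoc)
  then show ?thesis using integral_over_span[OF _ U] x(1) y(1) by (meson a_closed m_closed)
qed

lemma integral_closure_subring: "subring (integral_closure L R (carrier L)) L"
proof (rule subringI)
  show "\<ominus> h \<in> integral_closure L R (carrier L)"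
    if "h \<in> integral_closure L R (carrier L)" for h
  proof -
    have h: "h \<in> carrier L" "integral_over L R h" using that by (auto simp: integral_closure_def)
    have "integral_over L R (\<ominus> \<one> \<otimes> h)"
      using integral_over_add_mult[OF _ integral_over_R[of "\<ominus> \<one>"] h] by simp
    then show ?thesis using h by (simp add: integral_closure_def l_minus)
  qed
  show "\<one> \<in> integral_closure L R (carrier L)" using integral_over_R by (simp add: integral_closure_def)
  fix h h' assume "h \<in> integral_closure L R (carrier L)" "h' \<in> integral_closure L R (carrier L)"
  then show "h \<oplus> h' \<in> integral_closure L R (carrier L)" "h \<otimes> h' \<in> integral_closure L R (carrier L)"
    using integral_over_add_mult[of h h'] unfolding integral_closure_def by blast+
qed (auto simp: integral_closure_def)

end

section \<open>Galois coordinates and the trace\<close>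

lemma (in abelian_monoid) finsum_swap:
  assumes "finite A" "finite B" "\<And>i j. i \<in> A \<Longrightarrow> j \<in> B \<Longrightarrow> f i j \<in> carrier G"
  shows "(\<Oplus>i\<in>A. \<Oplus>j\<in>B. f i j) = (\<Oplus>j\<in>B. \<Oplus>i\<in>A. f i j)"
  using assms(1,3)
proof (induction A)
  case (insert a A)
  have "(\<Oplus>i\<in>insert a A. \<Oplus>j\<in>B. f i j) = (\<Oplus>j\<in>B. f a j) \<oplus> (\<Oplus>i\<in>A. \<Oplus>j\<in>B. f i j)"
    by (subst finsum_insert) (use insert in \<open>auto intro!: finsum_closed\<close>)
  also have "\<dots> = (\<Oplus>j\<in>B. f a j) \<oplus> (\<Oplus>j\<in>B. \<Oplus>i\<in>A. f i j)" using insert by simp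
  also have "\<dots> = (\<Oplus>j\<in>B. f a j \<oplus> (\<Oplus>i\<in>A. f i j))"
    by (subst finsum_addf) (use insert in \<open>auto intro!: finsum_closed\<close>)
  also have "\<dots> = (\<Oplus>j\<in>B. \<Oplus>i\<in>insert a A. f i j)"
    by (rule finsum_cong', simp, force intro!: finsum_closed simp: insert)
      (subst finsum_insert, use insert in auto)
  finally show ?case .
qed (simp add: finsum_zero)

lemma (in abelian_monoid) finsum_nat_add:
  assumes "\<And>i. f i \<in> carrier G"
  shows "(\<Oplus>i\<in>{..<n + m::nat}. f i) = (\<Oplus>i\<in>{..<n}. f i) \<oplus> (\<Oplus>i\<in>{..<m}. f (n + i))"
  by (induction m) (use assms in \<open>auto simp: lessThan_Suc Pi_def a_ac\<close>)

lemma (in cring) ring_hom_finsum: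
  assumes "h \<in> ring_hom R R" "finite A" "\<And>i. i \<in> A \<Longrightarrow> f i \<in> carrier R"
  shows "h (\<Oplus>i\<in>A. f i) = (\<Oplus>i\<in>A. h (f i))"
proof -
  interpret ring_hom_cring R R h by unfold_locales (rule assms)
  show ?thesis using assms by (auto simp: o_def)
qed

text \<open>
  A form of Dedekind's independence of homomorphisms: \<open>\<tau>\<close> can be isolated from finitely many
  others by an element \<open>\<Sum> a\<^sub>j \<otimes> b\<^sub>j\<close> of the tensor square. For a single \<open>\<rho>\<close> with
  \<open>\<rho> c \<noteq> \<tau> c\<close> the element \<open>(1 \<otimes> c - \<rho> c \<otimes> 1) / (\<tau> c - \<rho> c)\<close> has the values one at
  \<open>\<tau>\<close> and zero at \<open>\<rho>\<close>; for several homomorphisms such elements are multiplied, and each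
  factor doubles the number of pairs.
\<close>

lemma (in field) separating_pairs:
  assumes A: "finite A" and \<tau>: "\<tau> \<in> ring_hom R R"
    and sep: "\<And>\<sigma>. \<sigma> \<in> A \<Longrightarrow> \<sigma> \<in> ring_hom R R \<and> (\<exists>b\<in>carrier R. \<sigma> b \<noteq> \<tau> b)"
  shows "\<exists>(n::nat) a b. (\<forall>j. a j \<in> carrier R \<and> b j \<in> carrier R) \<and>
           (\<Oplus>j\<in>{..<n}. a j \<otimes> \<tau> (b j)) = \<one> \<and>
           (\<forall>\<sigma>\<in>A. (\<Oplus>j\<in>{..<n}. a j \<otimes> \<sigma> (b j)) = \<zero>)"
  using A sep
proof (induction A)
  case empty
  have "(\<Oplus>j\<in>{..<1::nat}. \<one> \<otimes> \<tau> \<one>) = \<one>" using ring_hom_one[OF \<tau>] by (simp add: lessThan_Suc)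
  then show ?case by (intro exI[of _ 1] exI[of _ "\<lambda>_. \<one>"]) auto
next
  case (insert \<rho> A)
  obtain n :: nat and a b where ab: "\<And>j. a j \<in> carrier R" "\<And>j. b j \<in> carrier R"
    "(\<Oplus>j\<in>{..<n}. a j \<otimes> \<tau> (b j)) = \<one>"
    "\<And>\<sigma>. \<sigma> \<in> A \<Longrightarrow> (\<Oplus>j\<in>{..<n}. a j \<otimes> \<sigma> (b j)) = \<zero>"
    using insert.IH insert.prems by auto blast
  obtain c where c: "c \<in> carrier R" "\<rho> c \<noteq> \<tau> c" and \<rho>: "\<rho> \<in> ring_hom R R" using insert by blast
  note cl = ring_hom_closed[OF \<tau>] ring_hom_closed[OF \<rho>]
  define e where "e = inv (\<tau> c \<ominus> \<rho> c)"
  have ne: "\<tau> c \<ominus> \<rho> c \<noteq> \<zero>" using c cl by auto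
  have e: "e \<in> carrier R" "e \<otimes> (\<tau> c \<ominus> \<rho> c) = \<one>" using ne c cl by (auto simp: e_def field_Units)
  define a' where "a' j = (if j < n then e \<otimes> a j else \<ominus> (e \<otimes> \<rho> c) \<otimes> a (j - n))" for j
  define b' where "b' j = (if j < n then c \<otimes> b j else b (j - n))" for j
  have cl': "a' j \<in> carrier R" "b' j \<in> carrier R" for j
    using e c ab cl by (auto simp: a'_def b'_def)
  have *: "(\<Oplus>j\<in>{..<n + n}. a' j \<otimes> \<sigma> (b' j)) =
      (e \<otimes> (\<sigma> c \<ominus> \<rho> c)) \<otimes> (\<Oplus>j\<in>{..<n}. a j \<otimes> \<sigma> (b j))" if \<sigma>: "\<sigma> \<in> ring_hom R R" for \<sigma>
  proof -
    note cs = ring_hom_closed[OF \<sigma>]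
    define s where "s = (\<Oplus>j\<in>{..<n}. a j \<otimes> \<sigma> (b j))"
    have s: "s \<in> carrier R" unfolding s_def using ab cs by (intro finsum_closed) auto
    have 1: "(\<Oplus>j\<in>{..<n}. a' j \<otimes> \<sigma> (b' j)) = (e \<otimes> \<sigma> c) \<otimes> s"
      unfolding s_def using ab cs c e
      by (subst finsum_rdistr)
        (auto simp: a'_def b'_def ring_hom_mult[OF \<sigma>] m_ac Pi_def intro!: finsum_cong')
    have 2: "(\<Oplus>j\<in>{..<n}. a' (n + j) \<otimes> \<sigma> (b' (n + j))) = \<ominus> (e \<otimes> \<rho> c) \<otimes> s"
      unfolding s_def using ab cs c e cl
      by (subst finsum_rdistr)
        (auto simp: a'_def b'_def m_assoc Pi_def intro!: finsum_cong')
    have "(\<Oplus>j\<in>{..<n + n}. a' j \<otimes> \<sigma> (b' j)) = (e \<otimes> \<sigma> c) \<otimes> s \<oplus> \<ominus> (e \<otimes> \<rho> c) \<otimes> s"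
      using cl' cs by (subst finsum_nat_add) (auto simp: 1 2)
    also have "\<dots> = (e \<otimes> (\<sigma> c \<ominus> \<rho> c)) \<otimes> s"
      using s e(1) cs[OF c(1)] cl(2)[OF c(1)] by algebra
    finally show ?thesis unfolding s_def .
  qed
  show ?case
  proof (rule exI[of _ "n + n"], rule exI[of _ a'], rule exI[of _ b'], intro conjI allI ballI)
    show "(\<Oplus>j\<in>{..<n + n}. a' j \<otimes> \<tau> (b' j)) = \<one>"
      using *[OF \<tau>] ab(3) e c by simp
    fix \<sigma> assume \<sigma>: "\<sigma> \<in> insert \<rho> A"
    then have "\<sigma> \<in> ring_hom R R" using insert.prems by blast
    note cs = ring_hom_closed[OF this] and s = *[OF this]
    show "(\<Oplus>j\<in>{..<n + n}. a' j \<otimes> \<sigma> (b' j)) = \<zero>"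
    proof (cases "\<sigma> = \<rho>")
      case True
      have "\<rho> c \<ominus> \<rho> c = \<zero>" using cl c by (simp add: r_neg a_minus_def)
      moreover have "(\<Oplus>j\<in>{..<n}. a j \<otimes> \<sigma> (b j)) \<in> carrier R"
        using ab cs by (intro finsum_closed) auto
      ultimately show ?thesis using s True e by simp
    next
      case False
      then show ?thesis using \<sigma> s ab(4) cs[OF c(1)] cl c e by simp
    qed
  qed (use cl' in auto)
qed

lemma (in ring) combine_finsum:
  assumes "length Ks = length Us" "set Ks \<subseteq> carrier R" "set Us \<subseteq> carrier R"
  shows "combine Ks Us = (\<Oplus>i\<in>{..<length Us}. Ks ! i \<otimes> Us ! i)"
  using assms
proof (induction Ks Us rule: list_induct2)
  case (Cons k Ks u Us)
  have "(\<Oplus>i\<in>{..<length (u # Us)}. (k # Ks) ! i \<otimes> (u # Us) ! i) =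
      (\<Oplus>i\<in>insert 0 (Suc ` {..<length Us}). (k # Ks) ! i \<otimes> (u # Us) ! i)"
    by (simp only: list.size add_Suc_right add_0_right lessThan_Suc_eq_insert_0)
  also have "\<dots> = k \<otimes> u \<oplus> (\<Oplus>i\<in>{..<length Us}. Ks ! i \<otimes> Us ! i)"
  proof (subst finsum_insert)
    have "(\<Oplus>i\<in>Suc ` {..<length Us}. (k # Ks) ! i \<otimes> (u # Us) ! i) =
        (\<Oplus>i\<in>{..<length Us}. (k # Ks) ! Suc i \<otimes> (u # Us) ! Suc i)"
      by (rule finsum_reindex) (use Cons in \<open>auto simp: subset_iff\<close>)
    then show "(k # Ks) ! 0 \<otimes> (u # Us) ! 0 \<oplus>
        (\<Oplus>i\<in>Suc ` {..<length Us}. (k # Ks) ! i \<otimes> (u # Us) ! i) =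
        k \<otimes> u \<oplus> (\<Oplus>i\<in>{..<length Us}. Ks ! i \<otimes> Us ! i)" by simp
  qed (use Cons in \<open>auto simp: subset_iff\<close>)
  finally show ?case using Cons by simp
qed simp

locale galois_ext = field L for L (structure) +
  fixes K :: "'a set"
  assumes galois: "finite_galois_extension L K"
begin

lemma subfield_K: "subfield K L"
  using galois by (simp add: finite_galois_extension_def)

sublocale K: noeth_subring L K
proof -
  interpret F: field "L\<lparr>carrier := K\<rparr>" by (rule subfield_iff(2)[OF subfield_K])
  show "noeth_subring L K"
    using F.noetherian_ring_axioms subfieldE(1)[OF subfield_K]
    by (intro noeth_subring.intro subring_of_field.intro subring_of_field_axioms.intro
        noeth_subring_axioms.intro field_axioms)
qed

text \<open>
  Members of \<open>galois_group L K\<close> are arbitrary outside the carrier of \<open>L\<close>, so infinitely many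
  functions may represent one automorphism. Restriction selects one representative of each and
  makes the group a finite set over which sums can be taken.
\<close>

definition Gal :: "('a \<Rightarrow> 'a) set" where
  "Gal = (\<lambda>g. restrict g (carrier L)) ` galois_group L K"

lemma in_Gal_iff: "g \<in> Gal \<longleftrightarrow> g \<in> galois_group L K \<and> g \<in> extensional (carrier L)"
proof
  assume "g \<in> Gal"
  then obtain \<tau> where \<tau>: "\<tau> \<in> galois_group L K" "g = restrict \<tau> (carrier L)" by (auto simp: Gal_def)
  have "restrict \<tau> (carrier L) \<in> ring_iso L L"
    by (rule ring_iso_restrict[of \<tau>]) (use \<tau> in \<open>auto simp: galois_group_def\<close>)
  then show "g \<in> galois_group L K \<and> g \<in> extensional (carrier L)"
    using \<tau> K.R_carrier by (auto simp: galois_group_def)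
next
  assume "g \<in> galois_group L K \<and> g \<in> extensional (carrier L)"
  then show "g \<in> Gal" unfolding Gal_def by (metis extensional_restrict imageI)
qed

lemma Gal_hom: "g \<in> Gal \<Longrightarrow> g \<in> ring_hom L L"
  by (auto simp: in_Gal_iff galois_group_def ring_iso_def)

lemma Gal_closed [simp]: "g \<in> Gal \<Longrightarrow> x \<in> carrier L \<Longrightarrow> g x \<in> carrier L"
  using Gal_hom ring_hom_closed by metis

lemma Gal_fix: "g \<in> Gal \<Longrightarrow> x \<in> K \<Longrightarrow> g x = x"
  by (auto simp: in_Gal_iff galois_group_def)

lemma Gal_eqI: "g \<in> Gal \<Longrightarrow> \<tau> \<in> Gal \<Longrightarrow> (\<And>x. x \<in> carrier L \<Longrightarrow> g x = \<tau> x) \<Longrightarrow> g = \<tau>"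
  by (rule extensionalityI[of _ "carrier L"]) (auto simp: in_Gal_iff)

lemma Gal_one: "restrict id (carrier L) \<in> Gal"
  using ring_iso_set_refl[of L] unfolding Gal_def by (intro imageI) (auto simp: galois_group_def id_def)

lemma Gal_comp: "g \<in> Gal \<Longrightarrow> \<tau> \<in> Gal \<Longrightarrow> compose (carrier L) g \<tau> \<in> Gal"
proof -
  assume "g \<in> Gal" "\<tau> \<in> Gal"
  then have "g \<circ> \<tau> \<in> galois_group L K"
    using ring_iso_set_trans[of \<tau> L L g L] by (auto simp: in_Gal_iff galois_group_def)
  then have "restrict (g \<circ> \<tau>) (carrier L) \<in> Gal" unfolding Gal_def by (rule imageI)
  then show ?thesis by (simp add: compose_def o_def restrict_def)
qed

lemma Gal_inverse:
  assumes "g \<in> Gal"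
  obtains \<tau> where "\<tau> \<in> Gal" "\<And>x. x \<in> carrier L \<Longrightarrow> g (\<tau> x) = x"
proof -
  have g: "g \<in> ring_iso L L" using assms by (auto simp: in_Gal_iff galois_group_def)
  define \<tau> where "\<tau> = inv_into (carrier L) g"
  have \<tau>: "\<tau> \<in> ring_iso L L" unfolding \<tau>_def by (rule ring_iso_set_sym[OF ring_axioms g])
  have b: "bij_betw g (carrier L) (carrier L)" using g by (auto simp: ring_iso_def)
  have "\<tau> x = x" if "x \<in> K" for x
    using that Gal_fix[OF assms that] K.R_carrier[OF that] b bij_betw_inv_into_left
    unfolding \<tau>_def by fastforce
  then have "restrict \<tau> (carrier L) \<in> Gal" using \<tau> by (auto simp: Gal_def galois_group_def)
  moreover have "g (\<tau> x) = x" if "x \<in> carrier L" for x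
    using b that bij_betw_inv_into_right unfolding \<tau>_def by fastforce
  ultimately show ?thesis using that[of "restrict \<tau> (carrier L)"] by auto
qed

lemma fixed_field: "x \<in> carrier L \<Longrightarrow> (\<And>g. g \<in> Gal \<Longrightarrow> g x = x) \<Longrightarrow> x \<in> K"
  using galois unfolding finite_galois_extension_def Gal_def by force

lemma basis_exists: "\<exists>Us. is_basis L K Us"
proof -
  obtain n where "dimension n K (carrier L)"
    using galois by (auto simp: finite_galois_extension_def finite_dimension_def)
  then obtain Us where "independent K Us" "Span K Us = carrier L"
    using exists_base[OF subfield_K] by blast
  then show ?thesis unfolding is_basis_def by blast
qed

context
  fixes Us :: "'a list"
  assumes Us: "is_basis L K Us"
begin

lemma basis_carrier: "set Us \<subseteq> carrier L"
  using Us independent_in_carrier by (auto simp: is_basis_def)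

lemma coordinates_unique:
  assumes "x \<in> carrier L"
  shows "\<exists>!Ks. set Ks \<subseteq> K \<and> length Ks = length Us \<and> x = combine Ks Us"
  using unique_decomposition[OF subfield_K, of Us x] Us assms by (auto simp: is_basis_def)

lemma coordinates:
  assumes x: "x \<in> carrier L"
  shows "set (coordinates L K Us x) \<subseteq> K" "length (coordinates L K Us x) = length Us"
    "combine (coordinates L K Us x) Us = x"
proof -
  have "\<exists>!Ks. length Ks = length Us \<and> set Ks \<subseteq> K \<and> combine Ks Us = x"
    using coordinates_unique[OF x] by metis
  from theI'[OF this] show "set (coordinates L K Us x) \<subseteq> K" "length (coordinates L K Us x) = length Us"
    "combine (coordinates L K Us x) Us = x" unfolding coordinates_def by blast+
qed

lemma coordinates_eqI:
  assumes "set Ks \<subseteq> K" "length Ks = length Us" "x \<in> carrier L" "combine Ks Us = x"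
  shows "coordinates L K Us x = Ks"
  using coordinates_unique[of x] coordinates[of x] assms by metis

lemma coordinates_nth: "x \<in> carrier L \<Longrightarrow> i < length Us \<Longrightarrow> coordinates L K Us x ! i \<in> K"
  using coordinates[of x] nth_mem by fastforce

lemma coordinates_sum:
  "x \<in> carrier L \<Longrightarrow> (\<Oplus>i\<in>{..<length Us}. coordinates L K Us x ! i \<otimes> Us ! i) = x"
  using combine_finsum[of "coordinates L K Us x" Us] coordinates[of x] basis_carrier K.R_carrier
  by (metis subset_iff)

lemma coordinates_add:
  assumes "x \<in> carrier L" "y \<in> carrier L" "i < length Us"
  shows "coordinates L K Us (x \<oplus> y) ! i = coordinates L K Us x ! i \<oplus> coordinates L K Us y ! i"
proof -
  let ?c = "coordinates L K Us"
  have "?c (x \<oplus> y) = map2 (\<oplus>) (?c x) (?c y)"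
  proof (rule coordinates_eqI)
    show "combine (map2 (\<oplus>) (?c x) (?c y)) Us = x \<oplus> y"
      using combine_add[of "?c x" Us "?c y"] coordinates[OF assms(1)] coordinates[OF assms(2)]
        basis_carrier K.R_carrier by (metis subset_iff)
    show "set (map2 (\<oplus>) (?c x) (?c y)) \<subseteq> K"
    proof
      fix z assume "z \<in> set (map2 (\<oplus>) (?c x) (?c y))"
      then obtain u v where uv: "(u, v) \<in> set (zip (?c x) (?c y))" "z = u \<oplus> v" by auto
      show "z \<in> K"
        using set_zip_leftD[OF uv(1)] set_zip_rightD[OF uv(1)] coordinates(1)[OF assms(1)]
          coordinates(1)[OF assms(2)] uv(2) K.R_closed(3)[of u v] by blast
    qed
  qed (use assms coordinates in auto)
  then show ?thesis using assms coordinates by simp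
qed

lemma coordinates_smult:
  assumes "k \<in> K" "x \<in> carrier L" "i < length Us"
  shows "coordinates L K Us (k \<otimes> x) ! i = k \<otimes> coordinates L K Us x ! i"
proof -
  let ?c = "coordinates L K Us"
  have "?c (k \<otimes> x) = map ((\<otimes>) k) (?c x)"
  proof (rule coordinates_eqI)
    show "combine (map ((\<otimes>) k) (?c x)) Us = k \<otimes> x"
      using combine_r_distr[of "?c x" Us k] coordinates[OF assms(2)]
        basis_carrier K.R_carrier assms(1) by (metis subset_iff)
    show "set (map ((\<otimes>) k) (?c x)) \<subseteq> K"
      using coordinates(1)[OF assms(2)] assms(1) K.R_closed(4)[of k] by auto
  qed (use assms coordinates K.R_carrier in auto)
  then show ?thesis using assms coordinates by simp
qed

lemma coordinates_finsum:
  assumes "finite A" "\<And>j. j \<in> A \<Longrightarrow> f j \<in> carrier L" "i < length Us"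
  shows "coordinates L K Us (\<Oplus>j\<in>A. f j) ! i = (\<Oplus>j\<in>A. coordinates L K Us (f j) ! i)"
  using assms(1,2)
proof (induction A)
  case empty
  then show ?case using coordinates_smult[of \<zero> \<zero> i] assms(3) coordinates_nth[of \<zero> i] K.R_carrier by simp
next
  case (insert j A)
  then show ?case using coordinates_add[of "f j" "\<Oplus>j\<in>A. f j" i] assms(3) coordinates_nth K.R_carrier
    by (auto simp: Pi_def)
qed

lemma carrier_rspan_basis: "x \<in> carrier L \<Longrightarrow> x \<in> K.rspan (set Us)"
proof -
  assume x: "x \<in> carrier L"
  have s: "K.submod (K.rspan (set Us))" using basis_carrier by (rule K.rspan_submod)
  have "(\<Oplus>i\<in>{..<length Us}. coordinates L K Us x ! i \<otimes> Us ! i) \<in> K.rspan (set Us)"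
    by (intro K.submod_finsum s K.submodD(4)[OF s] K.rspan_gen coordinates_nth x nth_mem basis_carrier) auto
  then show ?thesis using coordinates_sum[OF x] by simp
qed

end

lemma integral_over_K:
  assumes x: "x \<in> carrier L"
  shows "integral_over L K x"
proof -
  obtain Us where Us: "is_basis L K Us" using basis_exists by blast
  show ?thesis
    by (rule K.integral_overI[OF x K.noeth_set_rspan[of "set Us"], of \<one>])
      (use basis_carrier[OF Us] carrier_rspan_basis[OF Us] x in auto)
qed

lemma eval_hom:
  assumes "g \<in> Gal" "set f \<subseteq> K" "x \<in> carrier L"
  shows "g (eval f x) = eval f (g x)"
  using assms(2)
proof (induction f)
  case Nil
  then show ?case using Gal_fix[OF assms(1), of \<zero>] by simp
next
  case (Cons a f)
  have p: "g (x [^] n) = g x [^] n" for n :: nat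
    by (induction n) (use ring_hom_one[OF Gal_hom[OF assms(1)]] ring_hom_mult[OF Gal_hom[OF assms(1)]] assms(3) in auto)
  have e: "eval f x \<in> carrier L" using Cons K.R_carrier assms by (intro eval_in_carrier) auto
  have a: "a \<in> carrier L" "g a = a" using Cons K.R_carrier Gal_fix[OF assms(1)] by auto
  have "g (a \<otimes> x [^] length f \<oplus> eval f x) = a \<otimes> g x [^] length f \<oplus> eval f (g x)"
    using e a assms(3) p Cons
    by (subst ring_hom_add[OF Gal_hom[OF assms(1)]]) (auto simp: ring_hom_mult[OF Gal_hom[OF assms(1)]])
  then show ?case by simp
qed

text \<open>
  An automorphism is determined by its values on a basis, and it maps every basis element to a
  root of a fixed polynomial over \<open>K\<close>.
\<close>

lemma finite_Gal: "finite Gal"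
proof -
  obtain Us where Us: "is_basis L K Us" using basis_exists by blast
  have "\<exists>f. f \<in> carrier (poly_ring L) \<and> f \<noteq> [] \<and> set f \<subseteq> K \<and> eval f u = \<zero>"
    if u: "u \<in> carrier L" for u
  proof -
    obtain f where f: "set f \<subseteq> K" "f \<noteq> []" "hd f = \<one>" "eval f u = \<zero>"
      using integral_over_K[OF u] by (auto simp: integral_over_def K.carrier_univ_poly)
    then have "f \<in> carrier (poly_ring L)"
      using subfieldE(3)[OF subfield_K] by (auto simp: univ_poly_def polynomial_def)
    then show ?thesis using f by blast
  qed
  then obtain f where f: "\<And>u. u \<in> carrier L \<Longrightarrow> f u \<in> carrier (poly_ring L) \<and> f u \<noteq> [] \<and> set (f u) \<subseteq> K \<and> eval (f u) u = \<zero>"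
    by metis
  define r where "r u = {x. is_root (f u) x}" for u
  have fin: "finite (r u)" if "u \<in> carrier L" for u
    unfolding r_def using finite_number_of_roots f[OF that] by blast
  have "g u \<in> r u" if "g \<in> Gal" "u \<in> carrier L" for g u
    using that f[OF that(2)] eval_hom[OF that(1), of "f u" u] Gal_fix[OF that(1), of \<zero>]
    by (auto simp: r_def is_root_def)
  then have "(\<lambda>g. restrict g (set Us)) ` Gal \<subseteq> PiE (set Us) r"
    using basis_carrier[OF Us] by auto
  moreover have "finite (PiE (set Us) r)" using fin basis_carrier[OF Us] by (intro finite_PiE) auto
  ultimately have "finite ((\<lambda>g. restrict g (set Us)) ` Gal)" using finite_subset by blast
  moreover have "inj_on (\<lambda>g. restrict g (set Us)) Gal"
  proof (rule inj_onI)
    fix g \<tau> assume st: "g \<in> Gal" "\<tau> \<in> Gal" "restrict g (set Us) = restrict \<tau> (set Us)"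
    have fx: "g x = x" "\<tau> x = x" if "x \<in> K" for x
      using Gal_fix st that by auto
    have "K.submod {x \<in> carrier L. g x = \<tau> x}"
      using st fx[of \<zero>] fx by (intro K.submodI)
        (auto simp: ring_hom_mult[OF Gal_hom] ring_hom_add[OF Gal_hom] K.R_carrier)
    moreover have "set Us \<subseteq> {x \<in> carrier L. g x = \<tau> x}"
    proof
      fix u assume "u \<in> set Us"
      then show "u \<in> {x \<in> carrier L. g x = \<tau> x}"
        using basis_carrier[OF Us] fun_cong[OF st(3), of u] by auto
    qed
    ultimately have "g x = \<tau> x" if "x \<in> carrier L" for x
      using K.rspan_least[OF carrier_rspan_basis[OF Us that]] by blast
    then show "g = \<tau>" using Gal_eqI st by blast
  qed
  ultimately show ?thesis by (rule finite_imageD)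
qed

lemma Gal_compose_inj:
  assumes "\<tau> \<in> Gal"
  shows "inj_on (compose (carrier L) \<tau>) Gal"
proof (rule inj_onI)
  fix \<rho> g assume h: "\<rho> \<in> Gal" "g \<in> Gal" "compose (carrier L) \<tau> \<rho> = compose (carrier L) \<tau> g"
  have "inj_on \<tau> (carrier L)"
    using assms by (auto simp: in_Gal_iff galois_group_def ring_iso_def bij_betw_def)
  moreover have "\<tau> (\<rho> x) = \<tau> (g x)" if "x \<in> carrier L" for x
    using fun_cong[OF h(3), of x] that by (simp add: compose_def)
  ultimately show "\<rho> = g" using h by (intro Gal_eqI) (auto simp: inj_on_def)
qed

lemma Gal_reindex:
  assumes "\<tau> \<in> Gal" "\<And>g. g \<in> Gal \<Longrightarrow> f g \<in> carrier L"
  shows "(\<Oplus>g\<in>Gal. f (compose (carrier L) \<tau> g)) = (\<Oplus>g\<in>Gal. f g)"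
proof -
  note inj = Gal_compose_inj[OF assms(1)]
  have "compose (carrier L) \<tau> ` Gal = Gal"
    by (rule endo_inj_surj[OF finite_Gal _ inj]) (use Gal_comp assms in auto)
  then show ?thesis using finsum_reindex[of f "compose (carrier L) \<tau>" Gal] inj assms by auto
qed

text \<open>
  The sum of the conjugates; \<open>field_trace_eq\<close> below identifies it with the trace of the
  multiplication map.
\<close>

definition Tr :: "'a \<Rightarrow> 'a" where "Tr x = (\<Oplus>g\<in>Gal. g x)"

lemma Tr_closed [simp]: "x \<in> carrier L \<Longrightarrow> Tr x \<in> carrier L"
  unfolding Tr_def by (intro finsum_closed) auto

lemma Tr_add: "x \<in> carrier L \<Longrightarrow> y \<in> carrier L \<Longrightarrow> Tr (x \<oplus> y) = Tr x \<oplus> Tr y"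
proof -
  assume xy: "x \<in> carrier L" "y \<in> carrier L"
  have "Tr (x \<oplus> y) = (\<Oplus>g\<in>Gal. g x \<oplus> g y)"
    unfolding Tr_def using xy by (intro finsum_cong') (auto simp: ring_hom_add[OF Gal_hom])
  also have "\<dots> = Tr x \<oplus> Tr y"
    unfolding Tr_def using xy by (intro finsum_addf) auto
  finally show ?thesis .
qed

lemma Tr_smult:
  assumes k: "k \<in> K" and x: "x \<in> carrier L"
  shows "Tr (k \<otimes> x) = k \<otimes> Tr x"
proof -
  have "Tr (k \<otimes> x) = (\<Oplus>g\<in>Gal. k \<otimes> g x)"
    unfolding Tr_def
  proof (rule finsum_cong')
    fix g assume g: "g \<in> Gal"
    show "g (k \<otimes> x) = k \<otimes> g x"
      using ring_hom_mult[OF Gal_hom[OF g] K.R_carrier[OF k] x] Gal_fix[OF g k] by simp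
  qed (use K.R_carrier[OF k] x in auto)
  also have "\<dots> = k \<otimes> Tr x"
    unfolding Tr_def using K.R_carrier[OF k] x by (intro finsum_rdistr[symmetric] finite_Gal) auto
  finally show ?thesis .
qed

lemma Tr_smult2: "k \<in> K \<Longrightarrow> x \<in> carrier L \<Longrightarrow> Tr (x \<otimes> k) = Tr x \<otimes> k"
  using Tr_smult m_comm K.R_carrier by (metis Tr_closed)

lemma Tr_zero: "Tr \<zero> = \<zero>"
  using Tr_smult[of \<zero> \<zero>] K.R_carrier by simp

lemma Tr_finsum:
  assumes "finite A" "\<And>j. j \<in> A \<Longrightarrow> f j \<in> carrier L"
  shows "Tr (\<Oplus>j\<in>A. f j) = (\<Oplus>j\<in>A. Tr (f j))"
  using assms by (induction A) (auto simp: Tr_zero Tr_add Pi_def)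

lemma Gal_Tr: "\<tau> \<in> Gal \<Longrightarrow> x \<in> carrier L \<Longrightarrow> \<tau> (Tr x) = Tr x"
proof -
  assume \<tau>: "\<tau> \<in> Gal" and x: "x \<in> carrier L"
  have "\<tau> (Tr x) = (\<Oplus>g\<in>Gal. \<tau> (g x))"
    unfolding Tr_def using \<tau> x finite_Gal by (intro ring_hom_finsum Gal_hom) auto
  also have "\<dots> = (\<Oplus>g\<in>Gal. (compose (carrier L) \<tau> g) x)"
    using \<tau> x by (intro finsum_cong') (auto simp: compose_def)
  also have "\<dots> = Tr x" unfolding Tr_def using Gal_reindex[OF \<tau>, of "\<lambda>g. g x"] x by simp
  finally show ?thesis .
qed

lemma Tr_Gal:
  assumes g: "g \<in> Gal" and z: "z \<in> carrier L"
  shows "Tr (g z) = Tr z"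
proof -
  obtain h where h: "h \<in> Gal" "\<And>x. x \<in> carrier L \<Longrightarrow> g (h x) = x" by (rule Gal_inverse[OF g]) blast
  have inj: "inj_on (\<lambda>k. compose (carrier L) k g) Gal"
  proof (rule inj_onI)
    fix k l assume kl: "k \<in> Gal" "l \<in> Gal" "compose (carrier L) k g = compose (carrier L) l g"
    show "k = l"
    proof (rule Gal_eqI[OF kl(1,2)])
      fix x assume x: "x \<in> carrier L"
      then show "k x = l x" using fun_cong[OF kl(3), of "h x"] h by (simp add: compose_def)
    qed
  qed
  have "(\<lambda>k. compose (carrier L) k g) ` Gal = Gal"
    by (rule endo_inj_surj[OF finite_Gal _ inj]) (use Gal_comp g in auto)
  then have "Tr z = (\<Oplus>k\<in>Gal. compose (carrier L) k g z)"
    unfolding Tr_def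
    using inj finsum_reindex[of "\<lambda>k. k z" "\<lambda>k. compose (carrier L) k g" Gal] z by auto
  also have "\<dots> = Tr (g z)" unfolding Tr_def using z g
    by (intro finsum_cong') (auto simp: compose_def)
  finally show ?thesis by simp
qed

lemma Tr_in_K: "x \<in> carrier L \<Longrightarrow> Tr x \<in> K"
  by (rule fixed_field) (auto simp: Gal_Tr)

text \<open>
  The Galois coordinate systems of Chase, Harrison and Rosenberg: the idempotent of the diagonal
  in \<open>L \<otimes> L\<close>. By \<open>trace_expansion\<close> the pairs \<open>(a\<^sub>j, Tr (b\<^sub>j \<sqdot>))\<close> are a generating
  system together with coordinate functions. They do the work of a basis and its dual basis, so
  that the degree of \<open>L\<close> over \<open>K\<close> never has to be compared with the order of the group.
\<close>

lemma galois_coordinates: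
  "\<exists>(n::nat) a b. (\<forall>j. a j \<in> carrier L \<and> b j \<in> carrier L) \<and>
    (\<Oplus>j\<in>{..<n}. a j \<otimes> b j) = \<one> \<and>
    (\<forall>g\<in>Gal. g \<noteq> restrict id (carrier L) \<longrightarrow> (\<Oplus>j\<in>{..<n}. a j \<otimes> g (b j)) = \<zero>)"
proof -
  let ?e = "restrict id (carrier L)"
  have "\<exists>(n::nat) a b. (\<forall>j. a j \<in> carrier L \<and> b j \<in> carrier L) \<and>
           (\<Oplus>j\<in>{..<n}. a j \<otimes> ?e (b j)) = \<one> \<and>
           (\<forall>g\<in>Gal - {?e}. (\<Oplus>j\<in>{..<n}. a j \<otimes> g (b j)) = \<zero>)"
  proof (rule separating_pairs)
    show "g \<in> ring_hom L L \<and> (\<exists>b\<in>carrier L. g b \<noteq> ?e b)" if "g \<in> Gal - {?e}" for g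
      using that Gal_eqI[OF _ Gal_one, of g] Gal_hom by auto
    show "?e \<in> ring_hom L L" by (rule Gal_hom[OF Gal_one])
    show "finite (Gal - {?e})" using finite_Gal by blast
  qed
  then obtain n :: nat and a b where ab: "\<And>j. a j \<in> carrier L \<and> b j \<in> carrier L"
    "(\<Oplus>j\<in>{..<n}. a j \<otimes> ?e (b j)) = \<one>"
    "\<And>g. g \<in> Gal - {?e} \<Longrightarrow> (\<Oplus>j\<in>{..<n}. a j \<otimes> g (b j)) = \<zero>" by blast
  have eq: "(\<Oplus>j\<in>{..<n}. a j \<otimes> b j) = (\<Oplus>j\<in>{..<n}. a j \<otimes> ?e (b j))"
    using ab by (intro finsum_cong') auto
  have "\<forall>g\<in>Gal. g \<noteq> ?e \<longrightarrow> (\<Oplus>j\<in>{..<n}. a j \<otimes> g (b j)) = \<zero>" using ab(3) by blast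
  then show ?thesis using ab(1) trans[OF eq ab(2)] by blast
qed

text \<open>
  Exchanging the two sums, only the summand of the identity automorphism survives.
  The factor \<open>d\<close> is kept because over \<open>R\<close> the coordinate system exists only up to a denominator.
\<close>

lemma trace_expansion:
  assumes ab: "\<And>j. a j \<in> carrier L" "\<And>j. b j \<in> carrier L"
    "(\<Oplus>j\<in>{..<n::nat}. a j \<otimes> b j) = d"
    "\<And>g. g \<in> Gal \<Longrightarrow> g \<noteq> restrict id (carrier L) \<Longrightarrow> (\<Oplus>j\<in>{..<n}. a j \<otimes> g (b j)) = \<zero>"
    and x: "x \<in> carrier L"
  shows "(\<Oplus>j\<in>{..<n}. a j \<otimes> Tr (b j \<otimes> x)) = d \<otimes> x"
proof -
  let ?e = "restrict id (carrier L)"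
  have "(\<Oplus>j\<in>{..<n}. a j \<otimes> Tr (b j \<otimes> x)) = (\<Oplus>j\<in>{..<n}. \<Oplus>g\<in>Gal. (a j \<otimes> g (b j)) \<otimes> g x)"
  proof (rule finsum_cong')
    fix j
    show "a j \<otimes> Tr (b j \<otimes> x) = (\<Oplus>g\<in>Gal. (a j \<otimes> g (b j)) \<otimes> g x)"
      unfolding Tr_def using ab x finite_Gal
      by (subst finsum_rdistr) (auto intro!: finsum_cong' simp: ring_hom_mult[OF Gal_hom] m_assoc)
  qed (use ab x in \<open>auto intro!: finsum_closed\<close>)
  also have "\<dots> = (\<Oplus>g\<in>Gal. \<Oplus>j\<in>{..<n}. (a j \<otimes> g (b j)) \<otimes> g x)"
    using ab x finite_Gal by (intro finsum_swap) auto
  also have "\<dots> = (\<Oplus>g\<in>Gal. (\<Oplus>j\<in>{..<n}. a j \<otimes> g (b j)) \<otimes> g x)"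
    using ab x by (intro finsum_cong' finsum_ldistr[symmetric]) (auto intro!: finsum_closed)
  also have "\<dots> = (\<Oplus>g\<in>insert ?e (Gal - {?e}). (\<Oplus>j\<in>{..<n}. a j \<otimes> g (b j)) \<otimes> g x)"
    using Gal_one by (simp add: insert_absorb)
  also have "\<dots> = (\<Oplus>j\<in>{..<n}. a j \<otimes> ?e (b j)) \<otimes> ?e x \<oplus>
      (\<Oplus>g\<in>Gal - {?e}. (\<Oplus>j\<in>{..<n}. a j \<otimes> g (b j)) \<otimes> g x)"
    using ab(1,2) x finite_Gal by (intro finsum_insert) (auto intro!: finsum_closed)
  also have "(\<Oplus>g\<in>Gal - {?e}. (\<Oplus>j\<in>{..<n}. a j \<otimes> g (b j)) \<otimes> g x) = (\<Oplus>g\<in>Gal - {?e}. \<zero>)"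
    using ab x by (intro finsum_cong') auto
  also have "\<dots> = \<zero>" by (rule finsum_zero)
  also have "(\<Oplus>j\<in>{..<n}. a j \<otimes> ?e (b j)) = d"
    unfolding ab(3)[symmetric] using ab by (intro finsum_cong') auto
  finally have "(\<Oplus>j\<in>{..<n}. a j \<otimes> Tr (b j \<otimes> x)) = d \<otimes> ?e x \<oplus> \<zero>" .
  moreover have "d \<in> carrier L" unfolding ab(3)[symmetric] using ab by (intro finsum_closed) auto
  ultimately show ?thesis using x by simp
qed

text \<open>
  The trace of an endomorphism can be computed with any finite family of vectors and coordinate
  functions that reproduces every vector. Comparing the chosen basis with the Galois
  coordinates \<open>(a\<^sub>j, b\<^sub>j)\<close> turns the trace of multiplication by \<open>x\<close> into
  \<open>\<Sum> Tr (b\<^sub>j x a\<^sub>j) = Tr (x \<Sum> a\<^sub>j b\<^sub>j) = Tr x\<close>.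
\<close>

lemma field_trace_eq:
  assumes x: "x \<in> carrier L"
  shows "field_trace L K x = Tr x"
proof -
  define Us where "Us = (SOME Us. is_basis L K Us)"
  have Us: "is_basis L K Us" unfolding Us_def using basis_exists by (rule someI_ex)
  note bc = basis_carrier[OF Us]
  let ?c = "\<lambda>y i. coordinates L K Us y ! i"
  have U: "Us ! i \<in> carrier L" if "i < length Us" for i using bc that by auto
  have cK: "?c y i \<in> K" "?c y i \<in> carrier L" if "y \<in> carrier L" "i < length Us" for y i
    using coordinates_nth[OF Us that] K.R_carrier by auto
  obtain n :: nat and a b where ab': "\<forall>j. a j \<in> carrier L \<and> b j \<in> carrier L"
    "(\<Oplus>j\<in>{..<n}. a j \<otimes> b j) = \<one>"
    "\<forall>g\<in>Gal. g \<noteq> restrict id (carrier L) \<longrightarrow> (\<Oplus>j\<in>{..<n}. a j \<otimes> g (b j)) = \<zero>"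
    using galois_coordinates by blast
  then have ab: "\<And>j. a j \<in> carrier L" "\<And>j. b j \<in> carrier L"
    "(\<Oplus>j\<in>{..<n}. a j \<otimes> b j) = \<one>"
    "\<And>g. g \<in> Gal \<Longrightarrow> g \<noteq> restrict id (carrier L) \<Longrightarrow> (\<Oplus>j\<in>{..<n}. a j \<otimes> g (b j)) = \<zero>"
    by blast+
  have ex: "y = (\<Oplus>j\<in>{..<n}. a j \<otimes> Tr (b j \<otimes> y))" if "y \<in> carrier L" for y
    using trace_expansion[OF ab that] that by simp
  have Tc: "Tr (b j \<otimes> y) \<in> K" "Tr (b j \<otimes> y) \<in> carrier L" if "y \<in> carrier L" for j y
    using Tr_in_K that ab by auto
  have "field_trace L K x = (\<Oplus>i\<in>{..<length Us}. ?c (x \<otimes> Us ! i) i)"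
    unfolding field_trace_def Let_def Us_def ..
  also have "\<dots> = (\<Oplus>i\<in>{..<length Us}. \<Oplus>j\<in>{..<n}. Tr (b j \<otimes> (Us ! i \<otimes> ?c (x \<otimes> a j) i)))"
  proof (rule finsum_cong')
    fix i assume i: "i \<in> {..<length Us}"
    have "x \<otimes> Us ! i = x \<otimes> (\<Oplus>j\<in>{..<n}. a j \<otimes> Tr (b j \<otimes> Us ! i))" using ex[of "Us ! i"] U i by simp
    also have "\<dots> = (\<Oplus>j\<in>{..<n}. x \<otimes> (a j \<otimes> Tr (b j \<otimes> Us ! i)))"
      using ab x Tc U i by (intro finsum_rdistr) auto
    finally have "?c (x \<otimes> Us ! i) i = ?c (\<Oplus>j\<in>{..<n}. x \<otimes> (a j \<otimes> Tr (b j \<otimes> Us ! i))) i" by simp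
    also have "\<dots> = (\<Oplus>j\<in>{..<n}. ?c (x \<otimes> (a j \<otimes> Tr (b j \<otimes> Us ! i))) i)"
      using ab x Tc U i by (intro coordinates_finsum[OF Us]) auto
    also have "\<dots> = (\<Oplus>j\<in>{..<n}. Tr (b j \<otimes> (Us ! i \<otimes> ?c (x \<otimes> a j) i)))"
    proof (rule finsum_cong')
      fix j
      have "x \<otimes> (a j \<otimes> Tr (b j \<otimes> Us ! i)) = Tr (b j \<otimes> Us ! i) \<otimes> (x \<otimes> a j)"
        using ab(1)[of j] x Tc[of "Us ! i" j] U i by (simp add: m_ac)
      then have "?c (x \<otimes> (a j \<otimes> Tr (b j \<otimes> Us ! i))) i = Tr (b j \<otimes> Us ! i) \<otimes> ?c (x \<otimes> a j) i"
        using coordinates_smult[OF Us Tc(1), of "Us ! i" "x \<otimes> a j" i j] ab x U i by simp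
      also have "\<dots> = Tr ((b j \<otimes> Us ! i) \<otimes> ?c (x \<otimes> a j) i)"
        using Tr_smult2[OF cK(1)] ab x U i by simp
      finally show "?c (x \<otimes> (a j \<otimes> Tr (b j \<otimes> Us ! i))) i = Tr (b j \<otimes> (Us ! i \<otimes> ?c (x \<otimes> a j) i))"
        using ab x U i cK by (simp add: m_assoc)
    qed (use ab x U i cK in auto)
    finally show "?c (x \<otimes> Us ! i) i = (\<Oplus>j\<in>{..<n}. Tr (b j \<otimes> (Us ! i \<otimes> ?c (x \<otimes> a j) i)))" .
  qed (use ab x U cK in \<open>auto intro!: finsum_closed\<close>)
  also have "\<dots> = (\<Oplus>j\<in>{..<n}. \<Oplus>i\<in>{..<length Us}. Tr (b j \<otimes> (Us ! i \<otimes> ?c (x \<otimes> a j) i)))"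
    using ab x U cK by (intro finsum_swap) auto
  also have "\<dots> = (\<Oplus>j\<in>{..<n}. Tr (b j \<otimes> (x \<otimes> a j)))"
  proof (rule finsum_cong')
    fix j
    have y: "x \<otimes> a j \<in> carrier L" using x ab by simp
    have "(\<Oplus>i\<in>{..<length Us}. Tr (b j \<otimes> (Us ! i \<otimes> ?c (x \<otimes> a j) i))) =
        Tr (\<Oplus>i\<in>{..<length Us}. b j \<otimes> (Us ! i \<otimes> ?c (x \<otimes> a j) i))"
      using ab x U cK by (intro Tr_finsum[symmetric]) auto
    also have "(\<Oplus>i\<in>{..<length Us}. b j \<otimes> (Us ! i \<otimes> ?c (x \<otimes> a j) i)) =
        b j \<otimes> (\<Oplus>i\<in>{..<length Us}. Us ! i \<otimes> ?c (x \<otimes> a j) i)"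
      using ab x U cK by (intro finsum_rdistr[symmetric]) auto
    also have "(\<Oplus>i\<in>{..<length Us}. Us ! i \<otimes> ?c (x \<otimes> a j) i) = (\<Oplus>i\<in>{..<length Us}. ?c (x \<otimes> a j) i \<otimes> Us ! i)"
      using cK[OF y] U by (intro finsum_cong') (auto simp: m_comm)
    also have "\<dots> = x \<otimes> a j" by (rule coordinates_sum[OF Us y])
    finally show "(\<Oplus>i\<in>{..<length Us}. Tr (b j \<otimes> (Us ! i \<otimes> ?c (x \<otimes> a j) i))) = Tr (b j \<otimes> (x \<otimes> a j))" .
  qed (use ab x in auto)
  also have "\<dots> = Tr (\<Oplus>j\<in>{..<n}. b j \<otimes> (x \<otimes> a j))"
    using ab x by (intro Tr_finsum[symmetric]) auto
  also have "(\<Oplus>j\<in>{..<n}. b j \<otimes> (x \<otimes> a j)) = (\<Oplus>j\<in>{..<n}. x \<otimes> (a j \<otimes> b j))"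
    using ab x by (intro finsum_cong') (auto simp: m_ac)
  also have "\<dots> = x \<otimes> (\<Oplus>j\<in>{..<n}. a j \<otimes> b j)"
    using ab x by (intro finsum_rdistr[symmetric]) auto
  finally show ?thesis using ab(3) x by simp
qed

end

section \<open>Additivity of the Frobenius\<close>

lemma (in cring) binomial_finsum:
  assumes x: "x \<in> carrier R" and y: "y \<in> carrier R"
  shows "(x \<oplus> y) [^] (n::nat) = (\<Oplus>k\<in>{..n}. add_pow R (n choose k) (x [^] k \<otimes> y [^] (n - k)))"
proof (induction n)
  case 0
  then show ?case using x y by simp
next
  case (Suc n)
  define t where "t n k = add_pow R (n choose k) (x [^] k \<otimes> y [^] (n - k))" for n k :: nat
  have t: "t n k \<in> carrier R" for n k using x y by (simp add: t_def)
  have step: "t (Suc n) (Suc k) = x \<otimes> t n k \<oplus> y \<otimes> t n (Suc k)" if "k \<le> n" for k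
  proof -
    have "y \<otimes> t n (Suc k) = add_pow R (n choose Suc k) (x [^] Suc k \<otimes> y [^] (n - k))"
    proof (cases "k < n")
      case True
      then have "n - k = Suc (n - Suc k)" by simp
      then show ?thesis using x y by (simp add: t_def add_pow_rdistr m_ac)
    next
      case False
      then show ?thesis using y by (simp add: t_def binomial_eq_0)
    qed
    moreover have "x \<otimes> t n k = add_pow R (n choose k) (x [^] Suc k \<otimes> y [^] (n - k))"
      using x y by (simp add: t_def add_pow_rdistr m_ac)
    moreover have "t (Suc n) (Suc k) = add_pow R ((n choose k) + (n choose Suc k)) (x [^] Suc k \<otimes> y [^] (n - k))"
      by (simp add: t_def)
    ultimately show ?thesis
      using x y by (simp add: add.nat_pow_mult[symmetric])
  qed
  have "(\<Oplus>k\<in>{..Suc n}. t (Suc n) k) = (\<Oplus>k\<in>{..n}. t (Suc n) (Suc k)) \<oplus> t (Suc n) 0"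
    using t by (intro finsum_Suc2) auto
  also have "(\<Oplus>k\<in>{..n}. t (Suc n) (Suc k)) = (\<Oplus>k\<in>{..n}. x \<otimes> t n k \<oplus> y \<otimes> t n (Suc k))"
    using t step x y by (intro finsum_cong') auto
  also have "\<dots> = x \<otimes> (\<Oplus>k\<in>{..n}. t n k) \<oplus> y \<otimes> (\<Oplus>k\<in>{..n}. t n (Suc k))"
    using t x y by (simp add: finsum_rdistr finsum_addf Pi_def)
  also have "t (Suc n) 0 = y \<otimes> t n 0" using x y by (simp add: t_def m_ac)
  also have "x \<otimes> (\<Oplus>k\<in>{..n}. t n k) \<oplus> y \<otimes> (\<Oplus>k\<in>{..n}. t n (Suc k)) \<oplus> y \<otimes> t n 0 =
      x \<otimes> (\<Oplus>k\<in>{..n}. t n k) \<oplus> y \<otimes> ((\<Oplus>k\<in>{..n}. t n (Suc k)) \<oplus> t n 0)"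
    using t x y by (simp add: r_distr a_assoc Pi_def)
  also have "(\<Oplus>k\<in>{..n}. t n (Suc k)) \<oplus> t n 0 = (\<Oplus>k\<in>{..Suc n}. t n k)"
    using t by (intro finsum_Suc2[symmetric]) auto
  also have "\<dots> = t n (Suc n) \<oplus> (\<Oplus>k\<in>{..n}. t n k)"
    using t by (intro finsum_Suc) auto
  also have "t n (Suc n) = \<zero>" by (simp add: t_def binomial_eq_0)
  also have "x \<otimes> (\<Oplus>k\<in>{..n}. t n k) \<oplus> y \<otimes> (\<zero> \<oplus> (\<Oplus>k\<in>{..n}. t n k)) = (x \<oplus> y) \<otimes> (\<Oplus>k\<in>{..n}. t n k)"
    using t x y by (simp add: l_distr Pi_def)
  also have "(\<Oplus>k\<in>{..n}. t n k) = (x \<oplus> y) [^] n" using Suc by (simp add: t_def)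
  finally show ?case using x y by (simp add: t_def m_comm)
qed

lemma (in cring) frobenius_add:
  assumes p: "Factorial_Ring.prime p" "add_pow R p \<one> = \<zero>" and x: "x \<in> carrier R" and y: "y \<in> carrier R"
  shows "(x \<oplus> y) [^] (p::nat) = x [^] p \<oplus> y [^] p"
proof -
  have zero: "add_pow R (p choose k) z = \<zero>" if k: "0 < k" "k < p" "z \<in> carrier R" for k z
  proof -
    have "p dvd (p choose k)" using dvd_choose_prime[of k p] k p by auto
    then obtain m where m: "p choose k = p * m" by blast
    have "add_pow R p z = \<zero>" using add_pow_ldistr[of \<one> z p] p k by simp
    then show ?thesis using k by (simp add: m add.nat_pow_pow[symmetric])
  qed
  obtain q where q: "p = Suc (Suc q)" using prime_ge_2_nat[OF p(1)] by (metis add_2_eq_Suc le_Suc_ex)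
  define t where "t k = add_pow R (p choose k) (x [^] k \<otimes> y [^] (p - k))" for k :: nat
  have t: "t k \<in> carrier R" for k using x y by (simp add: t_def)
  have tz: "t (Suc i) = \<zero>" if "i \<le> q" for i
    unfolding t_def by (rule zero) (use that q x y in auto)
  have "(x \<oplus> y) [^] p = (\<Oplus>k\<in>{..Suc (Suc q)}. t k)"
    using binomial_finsum[OF x y, of p] by (simp add: t_def q)
  also have "\<dots> = t (Suc (Suc q)) \<oplus> ((\<Oplus>k\<in>{..q}. t (Suc k)) \<oplus> t 0)"
  proof -
    have A: "t \<in> B \<rightarrow> carrier R" for B using t by auto
    show ?thesis by (simp only: finsum_Suc[of t "Suc q", OF A] finsum_Suc2[of t q, OF A])
  qed
  also have "(\<Oplus>k\<in>{..q}. t (Suc k)) = (\<Oplus>k\<in>{..q}. \<zero>)"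
    using tz by (intro finsum_cong') auto
  also have "\<dots> = \<zero>" by (rule finsum_zero)
  finally show ?thesis using x y by (simp add: t_def q[symmetric])
qed

lemma (in cring) frobenius_finsum:
  assumes p: "Factorial_Ring.prime p" "add_pow R p \<one> = \<zero>"
    and "finite A" "\<And>i. i \<in> A \<Longrightarrow> f i \<in> carrier R"
  shows "(\<Oplus>i\<in>A. f i) [^] (p::nat) = (\<Oplus>i\<in>A. f i [^] p)"
  using assms(3,4)
proof (induction A)
  case empty
  then show ?case using prime_gt_0_nat[OF p(1)] by (simp add: nat_pow_zero)
next
  case (insert i A)
  then show ?case by (simp add: frobenius_add[OF p] Pi_def)
qed

section \<open>Denominator ideals in dimension one\<close>

lemma (in subring_of_field) prime_zero: "prime_in {\<zero>}"
  using R_carrier integral by (auto simp: prime_in_def submod_def)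

text \<open>
  The case \<open>S = R\<close> is included on purpose: it provides elements outside \<open>R\<close> with a prescribed
  ideal of denominators.
\<close>

locale dim_one_ext = R: noeth_subring L R + S: subring_of_field L S
  for L (structure) and R S +
  assumes R_S: "R \<subseteq> S" and noeth_S: "R.noeth_set S"
    and dim_one: "R.prime_in P \<Longrightarrow> P \<noteq> {\<zero>} \<Longrightarrow> R.prime_in P' \<Longrightarrow> P \<subseteq> P' \<Longrightarrow> P' = P"
begin

lemma S_submod: "S.submod M \<Longrightarrow> R.submod M"
  using R_S by (auto simp: S.submod_def R.submod_def)

lemma contraction_prime: "S.prime_in Q \<Longrightarrow> R.prime_in (Q \<inter> R)"
  using R_S unfolding R.prime_in_def S.prime_in_def S.submod_def R.submod_def
  by (auto simp: subset_iff)

definition denominators :: "'a \<Rightarrow> 'a set" where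
  "denominators c = {x \<in> S. c \<otimes> x \<in> S}"

lemma denominators_submod: "c \<in> carrier L \<Longrightarrow> S.submod (denominators c)"
  by (rule S.submodI) (auto simp: denominators_def S.R_carrier R.r_distr R.m_lcomm)

text \<open>
  A maximal member among the denominator ideals is prime, as for associated primes. Restricting
  the family to ideals whose contraction lies in \<open>P\<close> keeps the argument intact and forces the
  contraction of the maximal one to be \<open>P\<close>, since it contains \<open>a \<noteq> 0\<close> and \<open>R\<close> has dimension one.
  The start of the family is \<open>c = 1/a\<close>, whose denominator ideal is \<open>a S\<close>. Besides a prime
  over \<open>P\<close> this produces an element \<open>c\<close> outside \<open>S\<close> that the prime multiplies into \<open>S\<close>.
\<close>

lemma associated_prime:
  assumes P: "R.prime_in P" and a: "a \<in> P" "a \<noteq> \<zero>"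
    and aS: "\<And>z. z \<in> R \<Longrightarrow> inv a \<otimes> z \<in> S \<Longrightarrow> z \<in> P"
  shows "\<exists>c\<in>carrier L. c \<notin> S \<and> c \<otimes> a \<in> S \<and> S.prime_in (denominators c) \<and> denominators c \<inter> R = P"
proof -
  note PD = R.prime_inD[OF P]
  have aR: "a \<in> R" "a \<in> carrier L" "a \<in> S" using a PD R.R_carrier R_S by auto
  define C where "C = {c \<in> carrier L. c \<otimes> a \<in> S \<and> denominators c \<inter> R \<subseteq> P}"
  have "inv a \<in> C" using aR a aS R_S by (auto simp: C_def denominators_def R.field_Units)
  have "\<exists>M\<in>denominators ` C. \<forall>N\<in>denominators ` C. M \<subseteq> N \<longrightarrow> N = M"
  proof (rule R.noeth_set_maximal[OF noeth_S])
    show "denominators ` C \<noteq> {}" using \<open>inv a \<in> C\<close> by blast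
    show "R.submod M \<and> M \<subseteq> S" if "M \<in> denominators ` C" for M
      using that denominators_submod S_submod by (auto simp: C_def denominators_def)
  qed
  then obtain c where c: "c \<in> C"
    and max: "\<And>c'. c' \<in> C \<Longrightarrow> denominators c \<subseteq> denominators c' \<Longrightarrow> denominators c' = denominators c"
    by blast
  have cL: "c \<in> carrier L" "c \<otimes> a \<in> S" "denominators c \<inter> R \<subseteq> P" using c by (auto simp: C_def)
  have one: "\<one> \<notin> denominators c" using cL PD(3) by auto
  have prime: "S.prime_in (denominators c)"
    unfolding S.prime_in_def
  proof (intro conjI ballI impI denominators_submod cL one)
    fix x y assume xy: "x \<in> S" "y \<in> S" "x \<otimes> y \<in> denominators c"
    note xyL = xy(1,2)[THEN S.R_carrier]
    show "x \<in> denominators c \<or> y \<in> denominators c"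
    proof (rule disjCI)
      assume y: "y \<notin> denominators c"
      have cx: "c \<otimes> x \<in> carrier L" "(c \<otimes> x) \<otimes> a \<in> S"
        using cL xy xyL S.R_closed(4)[of "c \<otimes> a" x] aR by (auto simp: R.m_ac)
      have sub: "denominators c \<subseteq> denominators (c \<otimes> x)"
      proof
        fix z assume z: "z \<in> denominators c"
        then have "c \<otimes> z \<in> S" by (simp add: denominators_def)
        then have "(c \<otimes> z) \<otimes> x \<in> S" by (rule S.R_closed(4)[OF _ xy(1)])
        then show "z \<in> denominators (c \<otimes> x)"
          using z cL xyL S.R_carrier by (auto simp: denominators_def R.m_ac)
      qed
      have "y \<in> denominators (c \<otimes> x)" using xy cL xyL by (auto simp: denominators_def R.m_assoc)
      then have "c \<otimes> x \<notin> C" using max[OF _ sub] y by blast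
      then obtain u where u: "u \<in> R" "u \<notin> P" "u \<in> denominators (c \<otimes> x)"
        using cx by (auto simp: C_def)
      have uL: "u \<in> carrier L" "u \<in> S" using u R.R_carrier R_S by auto
      have cu: "c \<otimes> u \<in> carrier L" "(c \<otimes> u) \<otimes> a \<in> S"
        using cL uL S.R_closed(4)[of "c \<otimes> a" u] aR by (auto simp: R.m_ac)
      have sub': "denominators c \<subseteq> denominators (c \<otimes> u)"
      proof
        fix z assume z: "z \<in> denominators c"
        then have "c \<otimes> z \<in> S" by (simp add: denominators_def)
        then have "(c \<otimes> z) \<otimes> u \<in> S" by (rule S.R_closed(4)[OF _ uL(2)])
        then show "z \<in> denominators (c \<otimes> u)"
          using z cL uL S.R_carrier by (auto simp: denominators_def R.m_ac)
      qed
      have "denominators (c \<otimes> u) \<inter> R \<subseteq> P"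
      proof
        fix z assume z: "z \<in> denominators (c \<otimes> u) \<inter> R"
        then have "u \<otimes> z \<in> denominators c \<inter> R"
          using u uL cL R.R_carrier R_S by (auto simp: denominators_def R.m_assoc)
        then show "z \<in> P" using cL(3) PD(4)[of u z] u z by auto
      qed
      then have "c \<otimes> u \<in> C" using cu by (auto simp: C_def)
      then have "denominators (c \<otimes> u) = denominators c" using max sub' by blast
      moreover have "x \<in> denominators (c \<otimes> u)"
        using u cL xyL uL xy by (auto simp: denominators_def R.m_ac)
      ultimately show "x \<in> denominators c" by blast
    qed
  qed (auto simp: denominators_def)
  have "a \<in> denominators c \<inter> R" using aR cL by (auto simp: denominators_def)
  then have "denominators c \<inter> R \<noteq> {\<zero>}" using a by blast
  then have "denominators c \<inter> R = P"
    using dim_one[OF contraction_prime[OF prime] _ P cL(3)] by simp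
  moreover have "c \<notin> S" using one cL by (auto simp: denominators_def)
  ultimately show ?thesis using cL prime by blast
qed

end

section \<open>A Dedekind domain with a Frobenius splitting and its normalization\<close>

locale frob_setup = galois_ext L K for L (structure) and K +
  fixes R S :: "'a set" and p :: nat and \<phi> \<psi> :: "'a \<Rightarrow> 'a"
  assumes prime_p: "Factorial_Ring.prime p"
    and frac: "is_fraction_field L R K"
    and ded: "dedekind_domain L K R"
    and char_p: "has_characteristic (L\<lparr>carrier := R\<rparr>) p"
    and split: "frobenius_splitting p (L\<lparr>carrier := R\<rparr>) \<phi>"
    and S_def: "S = integral_closure L R (carrier L)"
    and psi: "\<psi> \<in> linear_maps (L\<lparr>carrier := S\<rparr>)
               (frobenius_pushforward p (L\<lparr>carrier := S\<rparr>)) (self_module (L\<lparr>carrier := S\<rparr>))"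
    and psi_R: "\<And>r. r \<in> R \<Longrightarrow> \<psi> r = \<phi> r"
begin

sublocale R: noeth_subring L R
  by (intro noeth_subring.intro subring_of_field.intro subring_of_field_axioms.intro
      noeth_subring_axioms.intro field_axioms)
    (use frac ded in \<open>auto simp: is_fraction_field_def dedekind_domain_def noetherian_domain_def\<close>)

sublocale S: subring_of_field L S
  unfolding S_def by (intro subring_of_field.intro subring_of_field_axioms.intro field_axioms
      R.integral_closure_subring)

lemma R_S: "R \<subseteq> S"
  using R.R_carrier R.integral_over_R by (auto simp: S_def integral_closure_def)

lemma S_iff: "x \<in> S \<longleftrightarrow> x \<in> carrier L \<and> integral_over L R x"
  by (simp add: S_def integral_closure_def)

lemma R_K: "R \<subseteq> K"
proof
  fix r assume r: "r \<in> R"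
  then have "r = r \<otimes> inv \<one>" using R.R_carrier by simp
  moreover have "\<one> \<in> R - {\<zero>}" by simp
  ultimately show "r \<in> K" using frac r unfolding is_fraction_field_def by blast
qed

lemma K_fraction:
  assumes "y \<in> K"
  obtains d where "d \<in> R" "d \<noteq> \<zero>" "d \<otimes> y \<in> R"
proof -
  obtain a b where ab: "a \<in> R" "b \<in> R" "b \<noteq> \<zero>" "y = a \<otimes> inv b"
    using assms frac by (auto simp: is_fraction_field_def)
  have "b \<otimes> y = a"
    using ab R.R_carrier[OF ab(1)] R.R_carrier[OF ab(2)] by (simp add: field_Units m_lcomm)
  then show ?thesis using that[of b] ab by simp
qed

lemma S_Int_K: "x \<in> S \<Longrightarrow> x \<in> K \<Longrightarrow> x \<in> R"
  using ded unfolding dedekind_domain_def integral_closure_def S_iff by blast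

lemma Gal_S: "g \<in> Gal \<Longrightarrow> x \<in> S \<Longrightarrow> g x \<in> S"
  using R.integral_over_hom[OF Gal_hom, of g x] Gal_fix R_K by (auto simp: S_iff)

lemma Tr_S: "x \<in> S \<Longrightarrow> Tr x \<in> R"
proof (rule S_Int_K)
  assume x: "x \<in> S"
  show "Tr x \<in> S" unfolding Tr_def by (rule S.submod_finsum[OF S.submod_R]) (rule Gal_S[OF _ x])
  show "Tr x \<in> K" by (rule Tr_in_K[OF S.R_carrier[OF x]])
qed

lemma clear_span:
  assumes "y \<in> K.rspan U" "U \<subseteq> carrier L"
  shows "\<exists>d\<in>R - {\<zero>}. d \<otimes> y \<in> R.rspan U"
  using assms
proof (induction rule: K.rspan.induct)
  case rspan_zero
  then show ?case by (intro bexI[of _ \<one>]) (auto intro: R.rspan.rspan_zero)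
next
  case (rspan_add r x z)
  obtain d where d: "d \<in> R" "d \<noteq> \<zero>" "d \<otimes> z \<in> R.rspan U" using rspan_add by blast
  obtain e where e: "e \<in> R" "e \<noteq> \<zero>" "e \<otimes> r \<in> R" using K_fraction[OF rspan_add(1)] by blast
  have cl: "d \<in> carrier L" "e \<in> carrier L" "r \<in> carrier L" "x \<in> carrier L" "z \<in> carrier L"
    using d e rspan_add R.R_carrier K.R_carrier K.rspan_carrier by auto
  have "(d \<otimes> e) \<otimes> (r \<otimes> x \<oplus> z) = (d \<otimes> (e \<otimes> r)) \<otimes> x \<oplus> e \<otimes> (d \<otimes> z)"
    using cl by algebra
  moreover have "\<dots> \<in> R.rspan U"
    using d e rspan_add.hyps rspan_add.prems R.submodD(4)[OF R.rspan_submod]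
    by (intro R.rspan.rspan_add) auto
  moreover have "d \<otimes> e \<noteq> \<zero>" using d e cl integral by blast
  ultimately show ?case using d e by (intro bexI[of _ "d \<otimes> e"]) auto
qed

text \<open>
  Multiplying an algebraic equation by a power of the common denominator of its coefficients.
\<close>

lemma clear_denominator:
  assumes x: "x \<in> carrier L"
  shows "\<exists>d\<in>R - {\<zero>}. d \<otimes> x \<in> S"
proof -
  obtain n :: nat where "x [^] n \<in> K.rspan {x [^] i | i::nat. i < n}"
    using integral_over_K[OF x] K.integral_over_iff[OF x] by blast
  moreover have U: "{x [^] i | i::nat. i < n} \<subseteq> carrier L" using x by auto
  ultimately obtain d where d: "d \<in> R" "d \<noteq> \<zero>" "d \<otimes> x [^] n \<in> R.rspan {x [^] i | i::nat. i < n}"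
    using clear_span by blast
  have dL: "d \<in> carrier L" using d R.R_carrier by blast
  have "n \<noteq> 0"
  proof
    assume n: "n = 0"
    have "d \<in> R.rspan {}" using d(3) dL unfolding n by simp
    then have "d \<in> {\<zero>}" by (rule R.rspan_least) (auto simp: R.submod_def R.R_carrier)
    then show False using d by simp
  qed
  then obtain m where m: "n = Suc m" by (cases n) auto
  define W where "W = {(d \<otimes> x) [^] i | i::nat. i < n}"
  have W: "W \<subseteq> carrier L" using dL x by (auto simp: W_def)
  have "d [^] m \<otimes> (d \<otimes> x [^] n) \<in> R.rspan ((\<otimes>) (d [^] m) ` {x [^] i | i::nat. i < n})"
    by (rule R.rspan_scale[OF d(3) U]) (use dL in simp)
  moreover have "(\<otimes>) (d [^] m) ` {x [^] i | i::nat. i < n} \<subseteq> R.rspan W"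
  proof (rule image_subsetI)
    fix z assume "z \<in> {x [^] i | i::nat. i < n}"
    then obtain i :: nat where i: "i < n" "z = x [^] i" by blast
    have "d [^] m = d [^] (m - i) \<otimes> d [^] i" using i m dL by (simp add: nat_pow_mult)
    then have "d [^] m \<otimes> z = d [^] (m - i) \<otimes> (d \<otimes> x) [^] i"
      using dL x i by (simp add: nat_pow_distrib m_assoc)
    moreover have "(d \<otimes> x) [^] i \<in> R.rspan W" by (rule R.rspan_gen[OF _ W]) (use i in \<open>auto simp: W_def\<close>)
    ultimately show "d [^] m \<otimes> z \<in> R.rspan W"
      using R.submodD(4)[OF R.rspan_submod[OF W]] R.R_pow[OF d(1)] by simp
  qed
  ultimately have "d [^] m \<otimes> (d \<otimes> x [^] n) \<in> R.rspan W"
    using R.rspan_least R.rspan_submod[OF W] by blast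
  moreover have "d [^] m \<otimes> (d \<otimes> x [^] n) = (d \<otimes> x) [^] n"
    using dL x by (simp add: m nat_pow_distrib m_ac)
  ultimately have "integral_over L R (d \<otimes> x)"
    using R.integral_over_iff[of "d \<otimes> x"] dL x unfolding W_def by auto
  then show ?thesis using d dL x by (auto simp: S_iff)
qed

lemma clear_denominators:
  assumes "\<And>j. b j \<in> carrier L"
  shows "\<exists>d\<in>R - {\<zero>}. \<forall>j<n::nat. d \<otimes> b j \<in> S"
proof (induction n)
  case 0
  then show ?case by (intro bexI[of _ \<one>]) auto
next
  case (Suc n)
  obtain d where d: "d \<in> R" "d \<noteq> \<zero>" "\<And>j. j < n \<Longrightarrow> d \<otimes> b j \<in> S" using Suc by blast
  obtain e where e: "e \<in> R" "e \<noteq> \<zero>" "e \<otimes> b n \<in> S" using clear_denominator[OF assms] by blast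
  note cl = d(1)[THEN R.R_carrier] e(1)[THEN R.R_carrier]
  have deS: "d \<in> S" "e \<in> S" using d e R_S by auto
  have "d \<otimes> e \<noteq> \<zero>" using d e cl integral by blast
  moreover have "(d \<otimes> e) \<otimes> b j \<in> S" if "j < Suc n" for j
  proof (cases "j = n")
    case True
    then show ?thesis using S.R_closed(4)[OF deS(1) e(3)] cl assms by (simp add: m_assoc)
  next
    case False
    then have "d \<otimes> b j \<in> S" using d that by simp
    from S.R_closed(4)[OF deS(2) this] show ?thesis using cl assms by (simp add: m_ac)
  qed
  ultimately show ?case using d e by (intro bexI[of _ "d \<otimes> e"]) auto
qed

lemma integral_coordinates:
  "\<exists>(n::nat) a b d. d \<in> R \<and> d \<noteq> \<zero> \<and> (\<forall>j. a j \<in> S \<and> b j \<in> S) \<and>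
    (\<Oplus>j\<in>{..<n}. a j \<otimes> b j) = d \<and>
    (\<forall>g\<in>Gal. g \<noteq> restrict id (carrier L) \<longrightarrow> (\<Oplus>j\<in>{..<n}. a j \<otimes> g (b j)) = \<zero>)"
proof -
  obtain n :: nat and a b where ab: "\<And>j. a j \<in> carrier L \<and> b j \<in> carrier L"
    "(\<Oplus>j\<in>{..<n}. a j \<otimes> b j) = \<one>"
    "\<And>g. g \<in> Gal \<Longrightarrow> g \<noteq> restrict id (carrier L) \<Longrightarrow> (\<Oplus>j\<in>{..<n}. a j \<otimes> g (b j)) = \<zero>"
    using galois_coordinates by blast
  have abc: "a j \<in> carrier L" "b j \<in> carrier L" for j using ab(1) by auto
  obtain d where d: "d \<in> R" "d \<noteq> \<zero>" "\<And>j. j < n \<Longrightarrow> d \<otimes> a j \<in> S"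
    using clear_denominators[of a n] abc by blast
  obtain e where e: "e \<in> R" "e \<noteq> \<zero>" "\<And>j. j < n \<Longrightarrow> e \<otimes> b j \<in> S"
    using clear_denominators[of b n] abc by blast
  note cl = d(1)[THEN R.R_carrier] e(1)[THEN R.R_carrier]
  define a' where "a' j = (if j < n then d \<otimes> a j else \<zero>)" for j
  define b' where "b' j = (if j < n then e \<otimes> b j else \<zero>)" for j
  have 1: "(\<Oplus>j\<in>{..<n}. a' j \<otimes> b' j) = d \<otimes> e"
  proof -
    have "(\<Oplus>j\<in>{..<n}. a' j \<otimes> b' j) = (\<Oplus>j\<in>{..<n}. (d \<otimes> e) \<otimes> (a j \<otimes> b j))"
      using cl abc by (intro finsum_cong') (auto simp: a'_def b'_def m_ac)
    also have "\<dots> = (d \<otimes> e) \<otimes> (\<Oplus>j\<in>{..<n}. a j \<otimes> b j)"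
      using cl abc by (intro finsum_rdistr[symmetric]) auto
    finally show ?thesis using ab(2) cl by simp
  qed
  have 2: "(\<Oplus>j\<in>{..<n}. a' j \<otimes> g (b' j)) = \<zero>" if g: "g \<in> Gal" "g \<noteq> restrict id (carrier L)" for g
  proof -
    have ge: "g e = e" using Gal_fix[OF g(1)] e(1) R_K by blast
    have "(\<Oplus>j\<in>{..<n}. a' j \<otimes> g (b' j)) = (\<Oplus>j\<in>{..<n}. (d \<otimes> e) \<otimes> (a j \<otimes> g (b j)))"
      using cl abc g(1) by (intro finsum_cong') (auto simp: a'_def b'_def m_ac ge ring_hom_mult[OF Gal_hom])
    also have "\<dots> = (d \<otimes> e) \<otimes> (\<Oplus>j\<in>{..<n}. a j \<otimes> g (b j))"
      using cl abc g(1) by (intro finsum_rdistr[symmetric]) auto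
    finally show ?thesis using ab(3)[OF g] cl by simp
  qed
  have 3: "\<forall>j. a' j \<in> S \<and> b' j \<in> S" using d e by (auto simp: a'_def b'_def)
  have "d \<otimes> e \<noteq> \<zero>" using d e cl integral by blast
  then show ?thesis using d e 1 2 3 R.R_closed(4)[OF d(1) e(1)] by blast
qed

text \<open>
  Elements whose traces against finitely many \<open>b\<^sub>j\<close> lie in \<open>R\<close> form, up to the denominator \<open>d\<close>,
  a subset of one finitely generated \<open>R\<close>-module. This makes \<open>S\<close> Noetherian over \<open>R\<close>, and it is
  applied to elements outside \<open>S\<close> in the proof of \<open>centers_above_imp_onto\<close>.
\<close>

lemma trace_span:
  "\<exists>(n::nat) a b d. d \<in> R \<and> d \<noteq> \<zero> \<and> (\<forall>j. a j \<in> S \<and> b j \<in> S) \<and>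
    (\<forall>x\<in>carrier L. (\<forall>j<n. Tr (b j \<otimes> x) \<in> R) \<longrightarrow> d \<otimes> x \<in> R.rspan (a ` {..<n}))"
proof -
  obtain n :: nat and a b d where ab: "d \<in> R" "d \<noteq> \<zero>" "\<forall>j. a j \<in> S \<and> b j \<in> S"
    "(\<Oplus>j\<in>{..<n}. a j \<otimes> b j) = d"
    "\<forall>g\<in>Gal. g \<noteq> restrict id (carrier L) \<longrightarrow> (\<Oplus>j\<in>{..<n}. a j \<otimes> g (b j)) = \<zero>"
    using integral_coordinates by blast
  have abL: "a j \<in> carrier L" "b j \<in> carrier L" for j using ab(3) S.R_carrier by auto
  have "d \<otimes> x \<in> R.rspan (a ` {..<n})" if x: "x \<in> carrier L" "\<And>j. j < n \<Longrightarrow> Tr (b j \<otimes> x) \<in> R" for x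
  proof -
    have A: "a ` {..<n} \<subseteq> carrier L" using abL by auto
    have s: "R.submod (R.rspan (a ` {..<n}))" by (rule R.rspan_submod[OF A])
    have "(\<Oplus>j\<in>{..<n}. a j \<otimes> Tr (b j \<otimes> x)) \<in> R.rspan (a ` {..<n})"
    proof (rule R.submod_finsum[OF s])
      fix j assume j: "j \<in> {..<n}"
      then have "a j \<in> R.rspan (a ` {..<n})" using R.rspan_gen[OF _ A] by blast
      then show "a j \<otimes> Tr (b j \<otimes> x) \<in> R.rspan (a ` {..<n})" using R.submodD(5)[OF s] x(2) j by blast
    qed
    then show ?thesis
      using trace_expansion[OF abL ab(4) _ x(1)] ab(5) by simp
  qed
  then have "\<forall>x\<in>carrier L. (\<forall>j<n. Tr (b j \<otimes> x) \<in> R) \<longrightarrow> d \<otimes> x \<in> R.rspan (a ` {..<n})" by blast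
  with ab(1-3) show ?thesis
    by - (intro exI conjI, assumption+)
qed

lemma noeth_S: "R.noeth_set S"
proof -
  obtain n :: nat and a b d where ab: "d \<in> R" "d \<noteq> \<zero>" "\<forall>j. a j \<in> S \<and> b j \<in> S"
    "\<And>x. x \<in> carrier L \<Longrightarrow> (\<forall>j<n. Tr (b j \<otimes> x) \<in> R) \<Longrightarrow> d \<otimes> x \<in> R.rspan (a ` {..<n})"
    using trace_span by blast
  have bx: "Tr (b j \<otimes> x) \<in> R" if "x \<in> S" for x j
    by (rule Tr_S[OF S.R_closed(4)[OF _ that]]) (use ab(3) in blast)
  show ?thesis
  proof (rule R.noeth_set_scale)
    show "R.noeth_set (R.rspan (a ` {..<n}))"
      by (rule R.noeth_set_rspan) (use ab(3) S.R_carrier in auto)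
    show "d \<otimes> x \<in> R.rspan (a ` {..<n})" if "x \<in> S" for x
      using ab(4)[OF S.R_carrier[OF that]] bx[OF that] by blast
  qed (use ab(1,2) S.R_carrier R.R_carrier in auto)
qed

lemma dim_one:
  assumes P: "R.prime_in P" "P \<noteq> {\<zero>}" and P': "R.prime_in P'" "P \<subseteq> P'"
  shows "P' = P"
proof -
  have "maximalideal P (L\<lparr>carrier := R\<rparr>)"
    using ded P R.primeideal_iff by (auto simp: dedekind_domain_def)
  moreover have "ideal P' (L\<lparr>carrier := R\<rparr>)" using P'(1) R.ideal_iff by (auto simp: R.prime_in_def)
  ultimately have "P' = P \<or> P' = R"
    using maximalideal.I_maximal[of P "L\<lparr>carrier := R\<rparr>" P'] R.prime_inD(2)[OF P'(1)] P'(2) by auto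
  then show ?thesis using R.prime_inD(3)[OF P'(1)] by auto
qed

sublocale D: dim_one_ext L R S
  by (intro dim_one_ext.intro R.noeth_subring_axioms S.subring_of_field_axioms dim_one_ext_axioms.intro
      R_S noeth_S) (rule dim_one)

lemma char_zero: "add_pow L p \<one> = \<zero>"
proof -
  have "add_pow (L\<lparr>carrier := R\<rparr>) p \<one>\<^bsub>L\<lparr>carrier := R\<rparr>\<^esub> = \<zero>\<^bsub>L\<lparr>carrier := R\<rparr>\<^esub>"
    using char_p by (auto simp: has_characteristic_def)
  then show ?thesis by (simp add: add_pow_def nat_pow_def)
qed

lemma phi_linear:
  shows phi_closed: "x \<in> R \<Longrightarrow> \<phi> x \<in> R"
    and phi_add: "x \<in> R \<Longrightarrow> y \<in> R \<Longrightarrow> \<phi> (x \<oplus> y) = \<phi> x \<oplus> \<phi> y"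
    and phi_pow: "r \<in> R \<Longrightarrow> x \<in> R \<Longrightarrow> \<phi> (r [^] p \<otimes> x) = r \<otimes> \<phi> x"
    and phi_one: "\<phi> \<one> = \<one>"
  using split by (auto simp: frobenius_splitting_def linear_maps_def frobenius_pushforward_def
      self_module_def nat_pow_consistent[symmetric])

lemma psi_linear:
  shows psi_closed: "x \<in> S \<Longrightarrow> \<psi> x \<in> S"
    and psi_add: "x \<in> S \<Longrightarrow> y \<in> S \<Longrightarrow> \<psi> (x \<oplus> y) = \<psi> x \<oplus> \<psi> y"
    and psi_pow: "r \<in> S \<Longrightarrow> x \<in> S \<Longrightarrow> \<psi> (r [^] p \<otimes> x) = r \<otimes> \<psi> x"
  using psi by (auto simp: linear_maps_def frobenius_pushforward_def
      self_module_def nat_pow_consistent[symmetric])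

lemma phi_zero: "\<phi> \<zero> = \<zero>"
  using phi_pow[of \<zero> \<zero>] phi_closed[of \<zero>] R.R_carrier prime_gt_0_nat[OF prime_p] by (simp add: nat_pow_zero)

lemma psi_zero: "\<psi> \<zero> = \<zero>"
  using psi_R[of \<zero>] phi_zero by simp

lemma psi_one: "\<psi> \<one> = \<one>"
  using psi_R[of \<one>] phi_one by simp

lemma phi_finsum:
  assumes "finite A" "\<And>j. j \<in> A \<Longrightarrow> f j \<in> R"
  shows "\<phi> (\<Oplus>j\<in>A. f j) = (\<Oplus>j\<in>A. \<phi> (f j))"
  using assms
proof (induction A)
  case (insert j A)
  have "(\<Oplus>j\<in>A. f j) \<in> R" by (rule R.submod_finsum[OF R.submod_R]) (use insert in auto)
  then show ?case using insert R.R_carrier phi_closed by (simp add: Pi_def phi_add)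
qed (simp add: phi_zero)

lemma psi_finsum:
  assumes "finite A" "\<And>j. j \<in> A \<Longrightarrow> f j \<in> S"
  shows "\<psi> (\<Oplus>j\<in>A. f j) = (\<Oplus>j\<in>A. \<psi> (f j))"
  using assms
proof (induction A)
  case (insert j A)
  have "(\<Oplus>j\<in>A. f j) \<in> S" by (rule S.submod_finsum[OF S.submod_R]) (use insert in auto)
  then show ?case using insert S.R_carrier psi_closed by (simp add: Pi_def psi_add)
qed (simp add: psi_zero)

lemma Gal_pow: "g \<in> Gal \<Longrightarrow> x \<in> carrier L \<Longrightarrow> g (x [^] (n::nat)) = g x [^] n"
  by (induction n) (auto simp: ring_hom_one[OF Gal_hom] ring_hom_mult[OF Gal_hom])

lemma Tr_pow: "x \<in> carrier L \<Longrightarrow> Tr (x [^] p) = Tr x [^] p"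
  unfolding Tr_def
  by (subst frobenius_finsum[OF prime_p char_zero finite_Gal])
    (auto intro!: finsum_cong' simp: Gal_pow)

text \<open>
  The \<open>p\<close>-th powers of Galois coordinates are again Galois coordinates, because the Frobenius is
  additive. So every \<open>x\<close> is, up to a denominator, a sum of products of \<open>p\<close>-th powers
  \<open>a\<^sub>j\<^sup>p\<close> with elements of \<open>R\<close>, where \<open>\<psi>\<close> is determined by \<open>\<phi>\<close>:
  \<open>d \<psi> x = \<Sum> a\<^sub>j \<phi> (Tr (b\<^sub>j\<^sup>p x))\<close>. Taking traces and using
  \<open>(Tr a)\<^sup>p = Tr (a\<^sup>p)\<close> gives the claim.
\<close>

lemma trace_psi:
  assumes x: "x \<in> S"
  shows "Tr (\<psi> x) = \<phi> (Tr x)"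
proof -
  obtain n :: nat and a b d where ab: "d \<in> R" "d \<noteq> \<zero>" "\<forall>j. a j \<in> S \<and> b j \<in> S"
    "(\<Oplus>j\<in>{..<n}. a j \<otimes> b j) = d"
    "\<forall>g\<in>Gal. g \<noteq> restrict id (carrier L) \<longrightarrow> (\<Oplus>j\<in>{..<n}. a j \<otimes> g (b j)) = \<zero>"
    using integral_coordinates by blast
  have abS: "a j \<in> S" "b j \<in> S" for j using ab(3) by auto
  have abL: "a j \<in> carrier L" "b j \<in> carrier L" for j using abS S.R_carrier by auto
  have dL: "d \<in> carrier L" "d \<in> S" "d \<in> K" using ab(1) R.R_carrier R_S R_K by auto
  have xL: "x \<in> carrier L" using x S.R_carrier by auto
  define r where "r j = Tr (b j [^] p \<otimes> x)" for j
  have r: "r j \<in> R" for j unfolding r_def using abS x by (intro Tr_S S.R_closed(4) S.R_pow)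
  have rL: "r j \<in> carrier L" "r j \<in> S" "r j \<in> K" for j using r R.R_carrier R_S R_K by auto
  have phi_r: "\<phi> (r j) \<in> R" "\<phi> (r j) \<in> carrier L" "\<phi> (r j) \<in> K" for j
    using phi_closed[OF r] R.R_carrier R_K by auto
  have e1: "(\<Oplus>j\<in>{..<n}. a j [^] p \<otimes> b j [^] p) = d [^] p"
    unfolding ab(4)[symmetric] using abL
    by (subst frobenius_finsum[OF prime_p char_zero]) (auto intro!: finsum_cong' simp: nat_pow_distrib)
  have e2: "(\<Oplus>j\<in>{..<n}. a j [^] p \<otimes> g (b j [^] p)) = \<zero>" if g: "g \<in> Gal" "g \<noteq> restrict id (carrier L)" for g
  proof -
    have "(\<Oplus>j\<in>{..<n}. a j [^] p \<otimes> g (b j [^] p)) = (\<Oplus>j\<in>{..<n}. (a j \<otimes> g (b j)) [^] p)"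
      using abL g(1) by (intro finsum_cong') (auto simp: nat_pow_distrib Gal_pow)
    also have "\<dots> = (\<Oplus>j\<in>{..<n}. a j \<otimes> g (b j)) [^] p"
      using abL g(1) by (intro frobenius_finsum[OF prime_p char_zero, symmetric]) auto
    finally show ?thesis using ab(5) g prime_gt_0_nat[OF prime_p] by (simp add: nat_pow_zero)
  qed
  have ex: "d [^] p \<otimes> x = (\<Oplus>j\<in>{..<n}. a j [^] p \<otimes> r j)"
    unfolding r_def using abL xL e1 e2 by (intro trace_expansion[symmetric]) auto
  have "d \<otimes> \<psi> x = \<psi> (d [^] p \<otimes> x)" using psi_pow dL x by simp
  also have "\<dots> = (\<Oplus>j\<in>{..<n}. \<psi> (a j [^] p \<otimes> r j))"
    unfolding ex using abS rL by (intro psi_finsum) auto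
  also have "\<dots> = (\<Oplus>j\<in>{..<n}. a j \<otimes> \<phi> (r j))"
    using abS abL rL r phi_r by (intro finsum_cong') (auto simp: psi_pow psi_R)
  finally have "Tr (d \<otimes> \<psi> x) = Tr (\<Oplus>j\<in>{..<n}. a j \<otimes> \<phi> (r j))" by simp
  also have "\<dots> = (\<Oplus>j\<in>{..<n}. Tr (a j \<otimes> \<phi> (r j)))"
    using abL phi_r by (intro Tr_finsum) auto
  also have "\<dots> = (\<Oplus>j\<in>{..<n}. \<phi> (Tr (a j [^] p \<otimes> r j)))"
  proof (rule finsum_cong')
    fix j
    have t: "Tr (a j) \<in> R" using Tr_S abS by blast
    have "Tr (a j \<otimes> \<phi> (r j)) = Tr (a j) \<otimes> \<phi> (r j)" using Tr_smult2 phi_r abL by blast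
    also have "\<dots> = \<phi> (Tr (a j) [^] p \<otimes> r j)" using phi_pow[OF t r] by simp
    also have "Tr (a j) [^] p \<otimes> r j = Tr (a j [^] p \<otimes> r j)"
      using Tr_pow[OF abL(1)] Tr_smult2[OF rL(3)] abL by simp
    finally show "Tr (a j \<otimes> \<phi> (r j)) = \<phi> (Tr (a j [^] p \<otimes> r j))" .
    show "(\<lambda>j. \<phi> (Tr (a j [^] p \<otimes> r j))) \<in> {..<n} \<rightarrow> carrier L"
      using abS rL(2) by (auto intro!: R.R_carrier phi_closed Tr_S)
  qed simp
  also have "\<dots> = \<phi> (\<Oplus>j\<in>{..<n}. Tr (a j [^] p \<otimes> r j))"
    using abS rL(2) by (intro phi_finsum[symmetric] Tr_S) auto
  also have "(\<Oplus>j\<in>{..<n}. Tr (a j [^] p \<otimes> r j)) = Tr (d [^] p \<otimes> x)"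
    unfolding ex using abL rL by (intro Tr_finsum[symmetric]) auto
  also have "\<dots> = d [^] p \<otimes> Tr x" using Tr_smult[OF _ xL] R.R_pow[OF ab(1)] R_K by blast
  also have "\<phi> \<dots> = d \<otimes> \<phi> (Tr x)" using phi_pow ab(1) Tr_S[OF x] by blast
  also have "Tr (d \<otimes> \<psi> x) = d \<otimes> Tr (\<psi> x)"
    using Tr_smult[OF dL(3)] psi_closed[OF x] S.R_carrier by blast
  finally show ?thesis
    using m_lcancel[OF ab(2) dL(1), of "Tr (\<psi> x)" "\<phi> (Tr x)"] psi_closed[OF x] S.R_carrier
      R.R_carrier[OF phi_closed[OF Tr_S[OF x]]] Tr_closed by simp
qed

section \<open>Prime ideals of the normalization\<close>

lemma S_Int_K_mult:
  assumes "a \<in> R" "a \<noteq> \<zero>" "z \<in> R" "inv a \<otimes> z \<in> S"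
  shows "inv a \<otimes> z \<in> R"
proof (rule S_Int_K)
  show "inv a \<otimes> z \<in> K"
    using subfield_m_inv(1)[OF subfield_K, of a] assms R_K K.R_closed(4) by blast
qed (rule assms)

lemma mult_inv_cancel: "a \<in> carrier L \<Longrightarrow> a \<noteq> \<zero> \<Longrightarrow> z \<in> carrier L \<Longrightarrow> a \<otimes> (inv a \<otimes> z) = z"
  by (subst m_assoc[symmetric]) (auto simp: field_Units)

lemma prime_above:
  assumes P: "R.prime_in P" "P \<noteq> {\<zero>}"
  shows "\<exists>c\<in>carrier L. c \<notin> S \<and> S.prime_in (D.denominators c) \<and> D.denominators c \<inter> R = P"
proof -
  obtain a where a: "a \<in> P" "a \<noteq> \<zero>"
    using P R.submodD(2)[OF R.prime_inD(1)[OF P(1)]] by blast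
  have aR: "a \<in> R" "a \<in> carrier L" using a R.prime_inD(2)[OF P(1)] R.R_carrier by auto
  have "z \<in> P" if "z \<in> R" "inv a \<otimes> z \<in> S" for z
  proof -
    have "inv a \<otimes> z \<in> R" using S_Int_K_mult aR a that by blast
    then have "a \<otimes> (inv a \<otimes> z) \<in> P" using R.submodD(5)[OF R.prime_inD(1)[OF P(1)]] a by blast
    then show ?thesis using mult_inv_cancel[OF aR(2) a(2)] that R.R_carrier by simp
  qed
  then show ?thesis using D.associated_prime[OF P(1) a] by blast
qed

lemma lying_over_prime:
  assumes P: "R.prime_in P"
  shows "\<exists>Q. S.prime_in Q \<and> Q \<inter> R = P"
proof (cases "P = {\<zero>}")
  case True
  then show ?thesis using S.prime_zero by (intro exI[of _ "{\<zero>}"]) auto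
next
  case False
  then show ?thesis using prime_above[OF P] by blast
qed

lemma not_in_R_above:
  assumes P: "R.prime_in P" "P \<noteq> {\<zero>}"
  shows "\<exists>c\<in>K. c \<notin> R \<and> (\<forall>x\<in>P. c \<otimes> x \<in> R)"
proof -
  interpret DR: dim_one_ext L R R
    by (intro dim_one_ext.intro R.noeth_subring_axioms R.subring_of_field_axioms dim_one_ext_axioms.intro
      R.noeth_set_R subset_refl) (rule dim_one)
  obtain a where a: "a \<in> P" "a \<noteq> \<zero>"
    using P R.submodD(2)[OF R.prime_inD(1)[OF P(1)]] by blast
  have aR: "a \<in> R" "a \<in> carrier L" using a R.prime_inD(2)[OF P(1)] R.R_carrier by auto
  have "z \<in> P" if "z \<in> R" "inv a \<otimes> z \<in> R" for z
  proof -
    have "a \<otimes> (inv a \<otimes> z) \<in> P" using R.submodD(5)[OF R.prime_inD(1)[OF P(1)]] a that by blast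
    then show ?thesis using mult_inv_cancel[OF aR(2) a(2)] that R.R_carrier by simp
  qed
  then obtain c where c: "c \<in> carrier L" "c \<notin> R" "c \<otimes> a \<in> R" "DR.denominators c \<inter> R = P"
    using DR.associated_prime[OF P(1) a] by blast
  have "inv a \<otimes> (c \<otimes> a) \<in> K"
    using subfield_m_inv(1)[OF subfield_K, of a] a aR c R_K K.R_closed(4) by blast
  moreover have "inv a \<otimes> (c \<otimes> a) = c"
    using mult_inv_cancel[OF aR(2) a(2) c(1)] aR a c(1) by (simp add: m_ac field_Units)
  ultimately show ?thesis using c by (auto simp: DR.denominators_def)
qed

text \<open>
  A substitute for the valuation at \<open>P\<close>: the alternatives mean that \<open>y\<close> has positive value, or
  value at most zero. If both fail, the ideal of denominators of
  \<open>y\<close> and its multiple by \<open>y\<close> lie in \<open>P\<close>; then an element \<open>c\<close> with \<open>c P \<subseteq> R\<close> maps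
  the ideal of denominators into itself, so \<open>c\<close> is integral and lies in \<open>R\<close>.
\<close>

lemma valuation_dichotomy:
  assumes P: "R.prime_in P" "P \<noteq> {\<zero>}" and y: "y \<in> K"
  shows "(\<exists>w\<in>R - P. w \<otimes> y \<in> P) \<or> (\<exists>w\<in>R. w \<otimes> y \<in> R - P)"
proof (rule ccontr)
  assume neg: "\<not> ?thesis"
  obtain c where c: "c \<in> K" "c \<notin> R" "\<And>x. x \<in> P \<Longrightarrow> c \<otimes> x \<in> R"
    using not_in_R_above[OF P] by blast
  have cL: "c \<in> carrier L" "y \<in> carrier L" using c y K.R_carrier by auto
  define I where "I = {w \<in> R. w \<otimes> y \<in> R}"
  have I: "w \<in> P" "w \<otimes> y \<in> P" if "w \<in> I" for w using that neg by (auto simp: I_def)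
  obtain e where e: "e \<in> R" "e \<noteq> \<zero>" "e \<otimes> y \<in> R" by (rule K_fraction[OF y])
  have step: "c \<otimes> w \<in> I" if w: "w \<in> I" for w
  proof -
    have "w \<in> carrier L" using w R.R_carrier by (auto simp: I_def)
    then have "(c \<otimes> w) \<otimes> y = c \<otimes> (w \<otimes> y)" using cL by (simp add: m_assoc)
    then show ?thesis using c(3)[OF I(1)[OF w]] c(3)[OF I(2)[OF w]] by (simp add: I_def)
  qed
  have "integral_over L R c"
  proof (rule R.integral_overI[OF cL(1) R.noeth_set_R _ e(2)])
    show "e \<in> carrier L" using e R.R_carrier by blast
    show "e \<otimes> c [^] k \<in> R" for k :: nat
    proof -
      have "e \<otimes> c [^] k \<in> I"
      proof (induction k)
        case 0
        then show ?case using e R.R_carrier by (auto simp: I_def)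
      next
        case (Suc k)
        have "c \<otimes> (e \<otimes> c [^] k) \<in> I" by (rule step[OF Suc])
        then show ?case using cL e R.R_carrier by (simp add: m_ac)
      qed
      then show ?thesis by (simp add: I_def)
    qed
  qed
  then have "c \<in> S" using cL by (simp add: S_iff)
  then show False using S_Int_K c by blast
qed

lemma unit_mod_prime:
  assumes P: "R.prime_in P" "P \<noteq> {\<zero>}" and r: "r \<in> R" "r \<notin> P"
  shows "\<exists>r'\<in>R. \<exists>z\<in>P. r \<otimes> r' = \<one> \<oplus> z"
proof -
  note PD = R.prime_inD[OF P(1)]
  define M where "M = {r \<otimes> x \<oplus> y | x y. x \<in> R \<and> y \<in> P}"
  have rL: "r \<in> carrier L" using r R.R_carrier by blast
  have Pc: "y \<in> R" "y \<in> carrier L" if "y \<in> P" for y using that PD R.R_carrier by auto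
  have M: "R.submod M"
  proof (rule R.submodI)
    show "M \<subseteq> carrier L" using rL Pc R.R_carrier by (auto simp: M_def)
    have "\<zero> = r \<otimes> \<zero> \<oplus> \<zero>" using rL by simp
    then show "\<zero> \<in> M" unfolding M_def using R.submodD(2)[OF PD(1)] R.R_closed(1) by blast
    show "u \<oplus> v \<in> M" if uv: "u \<in> M" "v \<in> M" for u v
    proof -
      obtain x y x' y' where xy: "u = r \<otimes> x \<oplus> y" "v = r \<otimes> x' \<oplus> y'" "x \<in> R" "x' \<in> R" "y \<in> P" "y' \<in> P"
        using uv by (auto simp: M_def)
      have "u \<oplus> v = r \<otimes> (x \<oplus> x') \<oplus> (y \<oplus> y')"
        unfolding xy(1,2) using rL xy(3,4)[THEN R.R_carrier] xy(5,6)[THEN Pc(2)] by algebra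
      then show ?thesis unfolding M_def
        using R.R_closed(3)[OF xy(3,4)] R.submodD(3)[OF PD(1) xy(5,6)] by blast
    qed
    show "s \<otimes> u \<in> M" if su: "s \<in> R" "u \<in> M" for s u
    proof -
      obtain x y where xy: "u = r \<otimes> x \<oplus> y" "x \<in> R" "y \<in> P" using su by (auto simp: M_def)
      have "s \<otimes> u = r \<otimes> (s \<otimes> x) \<oplus> s \<otimes> y"
        unfolding xy(1) using rL xy(2)[THEN R.R_carrier] xy(3)[THEN Pc(2)] su(1)[THEN R.R_carrier] by algebra
      then show ?thesis unfolding M_def
        using R.R_closed(4)[OF su(1) xy(2)] R.submodD(4)[OF PD(1) su(1) xy(3)] by blast
    qed
  qed
  have "M \<subseteq> R" using r Pc by (auto simp: M_def)
  moreover have "P \<subseteq> M"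
  proof
    fix y assume y: "y \<in> P"
    then have "y = r \<otimes> \<zero> \<oplus> y" using rL Pc by simp
    then show "y \<in> M" unfolding M_def using y R.R_closed(1) by blast
  qed
  moreover have "r \<in> M"
  proof -
    have "r = r \<otimes> \<one> \<oplus> \<zero>" using rL by simp
    then show ?thesis unfolding M_def using R.submodD(2)[OF PD(1)] R.R_closed(2) by blast
  qed
  moreover have "maximalideal P (L\<lparr>carrier := R\<rparr>)"
    using ded P R.primeideal_iff by (auto simp: dedekind_domain_def)
  moreover have "ideal M (L\<lparr>carrier := R\<rparr>)" using M \<open>M \<subseteq> R\<close> R.ideal_iff by blast
  ultimately have "M = R" using maximalideal.I_maximal[of P "L\<lparr>carrier := R\<rparr>" M] r by auto
  then have "\<one> \<in> M" using R.R_closed(2) by simp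
  then obtain x y where xy: "\<one> = r \<otimes> x \<oplus> y" "x \<in> R" "y \<in> P" by (auto simp: M_def)
  then have "r \<otimes> x = \<one> \<oplus> \<ominus> y" using rL R.R_carrier Pc by (simp add: a_assoc r_neg)
  then show ?thesis using xy R.submodD(6)[OF PD(1)] by blast
qed

text \<open>
  Modulo \<open>P\<close> a polynomial that does not vanish is \<open>x\<^sup>m\<close> times one with nonzero constant
  term \<open>c\<close>. The induction is Horner's scheme, from the lowest coefficient upwards.
\<close>

lemma horner_mod_prime:
  assumes P: "R.prime_in P" and x: "x \<in> S" and f: "set f \<subseteq> R" "\<exists>a\<in>set f. a \<notin> P"
  shows "\<exists>(m::nat) c h. c \<in> R - P \<and> h \<in> S \<and>
    (\<forall>J. S.submod J \<and> P \<subseteq> J \<longrightarrow> eval f x \<ominus> x [^] m \<otimes> (c \<oplus> x \<otimes> h) \<in> J)"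
  using f
proof (induction f rule: rev_induct)
  case (snoc c0 f)
  have xL: "x \<in> carrier L" using x S.R_carrier by blast
  have fL: "set f \<subseteq> carrier L" "c0 \<in> carrier L" "c0 \<in> R" using snoc R.R_carrier by auto
  have ev: "eval (f @ [c0]) x = eval f x \<otimes> x \<oplus> c0" using eval_append_aux fL xL by simp
  have eS: "eval f x \<in> S"
  proof -
    have "S.submod S" by (rule S.submod_R)
    then have "R.submod S" by (rule D.S_submod)
    moreover have "{x [^] i | i::nat. i < length f} \<subseteq> S" using x by auto
    ultimately show ?thesis using R.rspan_least[OF R.eval_rspan[OF xL]] snoc.prems by auto
  qed
  have eL: "eval f x \<in> carrier L" using eS S.R_carrier by blast
  show ?case
  proof (cases "c0 \<in> P")
    case False
    have "eval (f @ [c0]) x \<ominus> x [^] (0::nat) \<otimes> (c0 \<oplus> x \<otimes> eval f x) = \<zero>"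
      unfolding ev using eL xL fL by (simp add: a_ac m_comm r_neg a_minus_def)
    then show ?thesis using False fL eS S.submodD(2)
      by (intro exI[of _ 0] exI[of _ c0] exI[of _ "eval f x"]) auto
  next
    case True
    then obtain m :: nat and c h where h: "c \<in> R - P" "h \<in> S"
      "\<And>J. S.submod J \<Longrightarrow> P \<subseteq> J \<Longrightarrow> eval f x \<ominus> x [^] m \<otimes> (c \<oplus> x \<otimes> h) \<in> J"
      using snoc by auto blast
    have "eval (f @ [c0]) x \<ominus> x [^] Suc m \<otimes> (c \<oplus> x \<otimes> h) \<in> J" if J: "S.submod J" "P \<subseteq> J" for J
    proof -
      have cl: "c \<in> carrier L" "h \<in> carrier L" using h R.R_carrier S.R_carrier by auto
      define z where "z = c \<oplus> x \<otimes> h"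
      have z: "z \<in> carrier L" "x [^] m \<in> carrier L" using cl xL by (auto simp: z_def)
      have "x \<otimes> (eval f x \<ominus> x [^] m \<otimes> z) \<oplus> c0 \<in> J"
        using S.submodD(3)[OF J(1) S.submodD(4)[OF J(1) x h(3)[OF J]]] True J z_def by blast
      moreover have "x \<otimes> (eval f x \<ominus> x [^] m \<otimes> z) \<oplus> c0 = (eval f x \<otimes> x \<oplus> c0) \<ominus> (x [^] m \<otimes> x) \<otimes> z"
        using z eL xL fL(2) by algebra
      ultimately show ?thesis unfolding ev z_def by simp
    qed
    then show ?thesis using h by blast
  qed
qed simp

text \<open>
  The elementwise replacement for localizing \<open>S/PS\<close>: the factor \<open>c + x h\<close> is a unit at
  every prime over \<open>P\<close> containing \<open>x\<close>, and multiplies a power of \<open>x\<close> into \<open>PS\<close>.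
  The ideal \<open>J\<close> stands for \<open>PS\<close> and for any larger ideal.
\<close>

lemma integral_mod_prime:
  assumes P: "R.prime_in P" and x: "x \<in> S"
  obtains m :: nat and c h where "c \<in> R" "c \<notin> P" "h \<in> S"
    "\<And>J. S.submod J \<Longrightarrow> P \<subseteq> J \<Longrightarrow> x [^] m \<otimes> (c \<oplus> x \<otimes> h) \<in> J"
proof -
  have xL: "x \<in> carrier L" using x S.R_carrier by blast
  obtain f where f: "set f \<subseteq> R" "f \<noteq> []" "hd f = \<one>" "eval f x = \<zero>"
    using x S_iff by (auto simp: integral_over_def R.carrier_univ_poly)
  have "hd f \<in> set f" by (rule hd_in_set[OF f(2)])
  then have "\<exists>a\<in>set f. a \<notin> P" using f(3) R.prime_inD(3)[OF P] by metis
  then obtain m :: nat and c h where h: "c \<in> R - P" "h \<in> S"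
      "\<forall>J. S.submod J \<and> P \<subseteq> J \<longrightarrow> eval f x \<ominus> x [^] m \<otimes> (c \<oplus> x \<otimes> h) \<in> J"
    using horner_mod_prime[OF P x f(1)] by blast
  have z: "x [^] m \<otimes> (c \<oplus> x \<otimes> h) \<in> carrier L"
    using h xL R.R_carrier S.R_carrier by auto
  have "x [^] m \<otimes> (c \<oplus> x \<otimes> h) \<in> J" if J: "S.submod J" "P \<subseteq> J" for J
  proof -
    have "\<zero> \<ominus> x [^] m \<otimes> (c \<oplus> x \<otimes> h) \<in> J" using h(3) J f(4) by metis
    then have "\<ominus> (\<zero> \<ominus> x [^] m \<otimes> (c \<oplus> x \<otimes> h)) \<in> J" by (rule S.submodD(6)[OF J(1)])
    then show ?thesis using z by (simp add: a_minus_def)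
  qed
  then show ?thesis using that[of c h m] h by blast
qed

lemma incomparable:
  assumes Q: "S.prime_in Q" "S.prime_in Q'" "Q \<subseteq> Q'" "Q \<inter> R = Q' \<inter> R"
  shows "Q = Q'"
proof (rule ccontr)
  assume "Q \<noteq> Q'"
  then obtain x where x: "x \<in> Q'" "x \<notin> Q" using Q by blast
  have xS: "x \<in> S" "x \<in> carrier L" using x S.prime_inD(2)[OF Q(2)] S.R_carrier by auto
  obtain m :: nat and c h where h: "c \<in> R" "c \<notin> Q \<inter> R" "h \<in> S"
    "\<And>J. S.submod J \<Longrightarrow> Q \<inter> R \<subseteq> J \<Longrightarrow> x [^] m \<otimes> (c \<oplus> x \<otimes> h) \<in> J"
    by (rule integral_mod_prime[OF D.contraction_prime[OF Q(1)] xS(1)]) blast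
  have cS: "c \<in> S" using h R_S by blast
  have "x [^] m \<otimes> (c \<oplus> x \<otimes> h) \<in> Q" using h(4) S.prime_inD(1)[OF Q(1)] by blast
  moreover have "x [^] m \<notin> Q" using S.prime_in_pow[OF Q(1) xS(1)] x by blast
  ultimately have "c \<oplus> x \<otimes> h \<in> Q"
    using S.prime_inD(4)[OF Q(1), of "x [^] m" "c \<oplus> x \<otimes> h"] xS cS h by simp
  then have "c \<oplus> x \<otimes> h \<in> Q'" using Q by blast
  moreover have "x \<otimes> h \<in> Q'" using S.submodD(5)[OF S.prime_inD(1)[OF Q(2)]] x h by blast
  ultimately have "(c \<oplus> x \<otimes> h) \<ominus> x \<otimes> h \<in> Q'" by (rule S.submodD(7)[OF S.prime_inD(1)[OF Q(2)]])
  moreover have "(c \<oplus> x \<otimes> h) \<ominus> x \<otimes> h = c"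
    using cS[THEN S.R_carrier] xS(2) h(3)[THEN S.R_carrier] by algebra
  ultimately show False using h Q by auto
qed

end

section \<open>Elementary symmetric functions\<close>

definition (in cring) elementary_sum :: "'i set \<Rightarrow> ('i \<Rightarrow> 'a) \<Rightarrow> nat \<Rightarrow> 'a" where
  "elementary_sum A f k = (\<Oplus>B\<in>{B. B \<subseteq> A \<and> card B = k}. \<Otimes>i\<in>B. f i)"

lemma (in cring) finprod_add_expansion:
  assumes "finite A" "x \<in> carrier R" "\<And>i. i \<in> A \<Longrightarrow> f i \<in> carrier R"
  shows "(\<Otimes>i\<in>A. x \<oplus> f i) = (\<Oplus>k\<in>{..card A}. x [^] (card A - k) \<otimes> elementary_sum A f k)"
proof -
  have "(\<Otimes>i\<in>A. x \<oplus> f i) = (\<Oplus>B\<in>Pow A. x [^] card (A - B) \<otimes> (\<Otimes>i\<in>B. f i))"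
    using assms(1,3)
  proof (induction A)
    case empty
    then show ?case by simp
  next
    case (insert a A)
    have fB: "(\<Otimes>i\<in>B. f i) \<in> carrier R" if "B \<subseteq> insert a A" for B
      using that insert.prems by (intro finprod_closed) auto
    let ?t = "\<lambda>B. x [^] card (insert a A - B) \<otimes> (\<Otimes>i\<in>B. f i)"
    let ?s = "\<lambda>B. x [^] card (A - B) \<otimes> (\<Otimes>i\<in>B. f i)"
    have t: "?t B \<in> carrier R" if "B \<subseteq> insert a A" for B using fB[OF that] assms(2) by simp
    have s: "?s B \<in> carrier R" if "B \<subseteq> A" for B using fB[of B] that assms(2) by auto
    have inj: "inj_on (insert a) (Pow A)" using insert.hyps by (auto simp: inj_on_def)
    have "(\<Oplus>B\<in>Pow (insert a A). ?t B) = (\<Oplus>B\<in>Pow A. ?t B) \<oplus> (\<Oplus>B\<in>insert a ` Pow A. ?t B)"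
      unfolding Pow_insert
    proof (rule finsum_Un_disjoint)
      show "?t \<in> Pow A \<rightarrow> carrier R" "?t \<in> insert a ` Pow A \<rightarrow> carrier R"
        by (rule Pi_I, rule t, blast)+
    qed (use insert.hyps in auto)
    also have "(\<Oplus>B\<in>insert a ` Pow A. ?t B) = (\<Oplus>B\<in>Pow A. ?t (insert a B))"
    proof (rule finsum_reindex[OF Pi_I inj])
      show "?t B \<in> carrier R" if "B \<in> insert a ` Pow A" for B
        by (rule t) (use that in blast)
    qed
    also have "(\<Oplus>B\<in>Pow A. ?t (insert a B)) = (\<Oplus>B\<in>Pow A. f a \<otimes> ?s B)"
    proof (rule finsum_cong')
      fix B assume B: "B \<in> Pow A"
      have "insert a A - insert a B = A - B" using insert.hyps B by auto
      moreover have "(\<Otimes>i\<in>insert a B. f i) = f a \<otimes> (\<Otimes>i\<in>B. f i)"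
        using insert B finite_subset[of B A] by (intro finprod_insert) auto
      ultimately show "?t (insert a B) = f a \<otimes> ?s B"
        using insert.prems[of a] fB[of B] B assms(2) subset_insertI2[of B A a] by (auto simp: m_ac)
    qed (use insert.prems s in auto)
    also have "(\<Oplus>B\<in>Pow A. ?t B) = (\<Oplus>B\<in>Pow A. x \<otimes> ?s B)"
    proof (rule finsum_cong')
      fix B assume B: "B \<in> Pow A"
      have "insert a A - B = insert a (A - B)" using insert.hyps B by auto
      then have "card (insert a A - B) = Suc (card (A - B))" using insert.hyps by simp
      then show "?t B = x \<otimes> ?s B" using fB[of B] B assms(2) subset_insertI2[of B A a] by (auto simp: m_ac)
    qed (use assms(2) s in auto)
    also have "(\<Oplus>B\<in>Pow A. x \<otimes> ?s B) = x \<otimes> (\<Oplus>B\<in>Pow A. ?s B)"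
      using assms(2) insert.hyps s by (intro finsum_rdistr[symmetric]) auto
    also have "(\<Oplus>B\<in>Pow A. f a \<otimes> ?s B) = f a \<otimes> (\<Oplus>B\<in>Pow A. ?s B)"
      using insert.prems insert.hyps s by (intro finsum_rdistr[symmetric]) auto
    also have "x \<otimes> (\<Oplus>B\<in>Pow A. ?s B) \<oplus> f a \<otimes> (\<Oplus>B\<in>Pow A. ?s B) = (x \<oplus> f a) \<otimes> (\<Oplus>B\<in>Pow A. ?s B)"
      using assms(2) insert.prems s by (intro l_distr[symmetric] finsum_closed) auto
    also have "(\<Oplus>B\<in>Pow A. ?s B) = (\<Otimes>i\<in>A. x \<oplus> f i)" using insert by simp
    also have "(x \<oplus> f a) \<otimes> \<dots> = (\<Otimes>i\<in>insert a A. x \<oplus> f i)"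
      using insert assms(2) by (intro finprod_insert[symmetric]) auto
    finally show ?case by simp
  qed
  also have "Pow A = (\<Union>k\<in>{..card A}. {B. B \<subseteq> A \<and> card B = k})"
    using assms(1) card_mono by auto
  also have "(\<Oplus>B\<in>(\<Union>k\<in>{..card A}. {B. B \<subseteq> A \<and> card B = k}). x [^] card (A - B) \<otimes> (\<Otimes>i\<in>B. f i)) =
     (\<Oplus>k\<in>{..card A}. \<Oplus>B\<in>{B. B \<subseteq> A \<and> card B = k}. x [^] card (A - B) \<otimes> (\<Otimes>i\<in>B. f i))"
    using assms by (intro add.finprod_UN_disjoint)
      (auto simp: pairwise_def disjnt_def intro!: m_closed finprod_closed)
  also have "\<dots> = (\<Oplus>k\<in>{..card A}. x [^] (card A - k) \<otimes> elementary_sum A f k)"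
  proof (rule finsum_cong')
    fix k assume "k \<in> {..card A}"
    have "(\<Oplus>B\<in>{B. B \<subseteq> A \<and> card B = k}. x [^] card (A - B) \<otimes> (\<Otimes>i\<in>B. f i)) =
        (\<Oplus>B\<in>{B. B \<subseteq> A \<and> card B = k}. x [^] (card A - k) \<otimes> (\<Otimes>i\<in>B. f i))"
      using assms by (intro finsum_cong')
        (auto simp: card_Diff_subset[OF finite_subset] intro!: m_closed finprod_closed)
    also have "\<dots> = x [^] (card A - k) \<otimes> elementary_sum A f k"
      unfolding elementary_sum_def using assms
      by (intro finsum_rdistr[symmetric]) (auto intro!: finprod_closed)
    finally show "(\<Oplus>B\<in>{B. B \<subseteq> A \<and> card B = k}. x [^] card (A - B) \<otimes> (\<Otimes>i\<in>B. f i)) =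
        x [^] (card A - k) \<otimes> elementary_sum A f k" .
  qed (use assms in \<open>auto simp: elementary_sum_def intro!: m_closed finprod_closed finsum_closed\<close>)
  finally show ?thesis .
qed

lemma (in cring) ring_hom_finprod:
  assumes "h \<in> ring_hom R R" "finite A" "\<And>i. i \<in> A \<Longrightarrow> f i \<in> carrier R"
  shows "h (\<Otimes>i\<in>A. f i) = (\<Otimes>i\<in>A. h (f i))"
  using assms(2,3)
proof (induction A)
  case empty
  then show ?case using ring_hom_one[OF assms(1)] by simp
next
  case (insert i A)
  then show ?case
    using ring_hom_mult[OF assms(1), of "f i" "\<Otimes>i\<in>A. f i"] ring_hom_closed[OF assms(1)]
    by (auto simp: Pi_def)
qed

text \<open>
  Composition with \<open>g\<close> permutes the subsets of a given size, hence the summands.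
\<close>

lemma (in galois_ext) elementary_sum_in_K:
  assumes f: "\<And>g. g \<in> Gal \<Longrightarrow> f g \<in> carrier L"
    and gf: "\<And>g h. g \<in> Gal \<Longrightarrow> h \<in> Gal \<Longrightarrow> g (f h) = f (compose (carrier L) g h)"
  shows "elementary_sum Gal f k \<in> K"
proof (rule fixed_field)
  let ?A = "{B. B \<subseteq> Gal \<and> card B = k}"
  have prodL: "(\<Otimes>i\<in>B. f i) \<in> carrier L" if "B \<subseteq> Gal" for B
    using that f by (intro finprod_closed) auto
  show "elementary_sum Gal f k \<in> carrier L"
    unfolding elementary_sum_def using prodL by (intro finsum_closed) auto
  have finA: "finite ?A" using finite_Gal by simp
  fix g assume g: "g \<in> Gal"
  let ?c = "compose (carrier L) g"
  note inj = Gal_compose_inj[OF g]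
  have cG: "?c ` Gal \<subseteq> Gal" using Gal_comp g by auto
  have fc: "f (?c h) \<in> carrier L" if "h \<in> Gal" for h
    by (rule f) (use cG that in blast)
  have injA: "inj_on ((`) ?c) ?A"
    by (rule inj_onI) (use inj in \<open>auto simp: inj_on_image_eq_iff\<close>)
  have img: "(`) ?c ` ?A = ?A"
  proof (rule endo_inj_surj[OF finA _ injA])
    show "(`) ?c ` ?A \<subseteq> ?A"
    proof (rule image_subsetI)
      fix B assume B: "B \<in> ?A"
      then have "card (?c ` B) = card B" using inj_on_subset[OF inj] by (intro card_image) auto
      then show "?c ` B \<in> ?A" using B cG by auto
    qed
  qed
  have "g (elementary_sum Gal f k) = (\<Oplus>B\<in>?A. g (\<Otimes>i\<in>B. f i))"
    unfolding elementary_sum_def using prodL finA by (intro ring_hom_finsum Gal_hom[OF g]) auto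
  also have "\<dots> = (\<Oplus>B\<in>?A. (\<Otimes>i\<in>?c ` B. f i))"
  proof (rule finsum_cong')
    fix B assume B: "B \<in> ?A"
    have "g (\<Otimes>i\<in>B. f i) = (\<Otimes>i\<in>B. g (f i))"
      using B f finite_subset[OF _ finite_Gal] by (intro ring_hom_finprod Gal_hom[OF g]) auto
    also have "\<dots> = (\<Otimes>i\<in>B. f (?c i))"
      using B gf[OF g] fc by (intro finprod_cong') auto
    also have "\<dots> = (\<Otimes>i\<in>?c ` B. f i)"
      using B fc inj_on_subset[OF inj] by (intro finprod_reindex[symmetric]) auto
    finally show "g (\<Otimes>i\<in>B. f i) = (\<Otimes>i\<in>?c ` B. f i)" .
  next
    show "(\<lambda>B. \<Otimes>i\<in>?c ` B. f i) \<in> ?A \<rightarrow> carrier L"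
      by (rule Pi_I, rule prodL) (use cG in blast)
  qed simp
  also have "\<dots> = (\<Oplus>B\<in>(`) ?c ` ?A. (\<Otimes>i\<in>B. f i))"
    using prodL injA img by (intro finsum_reindex[symmetric]) auto
  also have "\<dots> = elementary_sum Gal f k" unfolding img by (simp add: elementary_sum_def)
  finally show "g (elementary_sum Gal f k) = elementary_sum Gal f k" .
qed

section \<open>Centers of purity, tame ramification and the trace\<close>

context frob_setup
begin

abbreviation "CR \<equiv> centers_of_F_purity (L\<lparr>carrier := R\<rparr>) \<phi>"
abbreviation "CS \<equiv> centers_of_F_purity (L\<lparr>carrier := S\<rparr>) \<psi>"

lemma CR_iff: "P \<in> CR \<longleftrightarrow> R.prime_in P \<and> (\<forall>x\<in>P. \<phi> x \<in> P)"
proof -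
  have "\<not> \<phi> ` R \<subseteq> P" if "R.prime_in P"
  proof
    assume "\<phi> ` R \<subseteq> P"
    then have "\<phi> \<one> \<in> P" using R.R_closed(2) by blast
    then show False using phi_one R.prime_inD(3)[OF that] by simp
  qed
  then show ?thesis unfolding centers_of_F_purity_def R.primeideal_iff by auto
qed

lemma CS_iff: "Q \<in> CS \<longleftrightarrow> S.prime_in Q \<and> (\<forall>x\<in>Q. \<psi> x \<in> Q)"
proof -
  have "\<not> \<psi> ` S \<subseteq> Q" if "S.prime_in Q"
  proof
    assume "\<psi> ` S \<subseteq> Q"
    then have "\<psi> \<one> \<in> Q" using S.R_closed(2) by blast
    then show False using psi_one S.prime_inD(3)[OF that] by simp
  qed
  then show ?thesis unfolding centers_of_F_purity_def S.primeideal_iff by auto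
qed

lemma CS_contraction: "Q \<in> CS \<Longrightarrow> Q \<inter> R \<in> CR"
  using D.contraction_prime[of Q] psi_R phi_closed by (fastforce simp: CR_iff CS_iff)

abbreviation "ext P \<equiv> genideal (L\<lparr>carrier := S\<rparr>) P"
abbreviation "rad P \<equiv> radical_of_ideal (L\<lparr>carrier := S\<rparr>) (ext P)"

lemma ext_props:
  assumes P: "R.prime_in P"
  shows "S.submod (ext P)" "ext P \<subseteq> S" "P \<subseteq> ext P"
    and "\<And>J. S.submod J \<Longrightarrow> J \<subseteq> S \<Longrightarrow> P \<subseteq> J \<Longrightarrow> ext P \<subseteq> J"
proof -
  interpret A: ring "L\<lparr>carrier := S\<rparr>" by (rule subring_is_ring[OF S.subring])
  have PS: "P \<subseteq> carrier (L\<lparr>carrier := S\<rparr>)" using R.prime_inD(2)[OF P] R_S by auto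
  show "S.submod (ext P)" "ext P \<subseteq> S" using A.genideal_ideal[OF PS] S.ideal_iff by auto
  show "P \<subseteq> ext P" by (rule A.genideal_self[OF PS])
  show "ext P \<subseteq> J" if "S.submod J" "J \<subseteq> S" "P \<subseteq> J" for J
    by (rule A.genideal_minimal) (use that S.ideal_iff in auto)
qed

lemma rad_iff: "x \<in> rad P \<longleftrightarrow> x \<in> S \<and> (\<exists>n::nat. x [^] n \<in> ext P)"
  by (simp add: radical_of_ideal_def nat_pow_consistent[symmetric])

lemma rad_subset_prime:
  assumes P: "R.prime_in P" and Q: "S.prime_in Q" "P \<subseteq> Q"
  shows "rad P \<subseteq> Q"
proof
  fix x assume "x \<in> rad P"
  then obtain n :: nat where x: "x \<in> S" "x [^] n \<in> ext P" by (auto simp: rad_iff)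
  have "ext P \<subseteq> Q" using ext_props(4)[OF P] S.prime_inD[OF Q(1)] Q(2) by blast
  then show "x \<in> Q" using S.prime_in_pow[OF Q(1)] x by blast
qed

lemma one_notin_rad:
  assumes P: "R.prime_in P"
  shows "\<one> \<notin> rad P"
proof -
  obtain Q where Q: "S.prime_in Q" "Q \<inter> R = P" using lying_over_prime[OF P] by blast
  then show ?thesis using rad_subset_prime[OF P Q(1)] S.prime_inD(3)[OF Q(1)] by blast
qed

abbreviation "PTr P \<equiv> trace_ideal L K S P"

lemma PTr_eq: "PTr P = {s \<in> S. \<forall>t\<in>S. Tr (s \<otimes> t) \<in> P}"
  unfolding trace_ideal_def using S.R_carrier by (auto simp: field_trace_eq)

text \<open>
  All conjugates of an element of the radical of \<open>PS\<close> lie in a fixed prime over \<open>P\<close>, hence so do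
  its traces.
\<close>

lemma rad_subset_PTr:
  assumes P: "R.prime_in P"
  shows "rad P \<subseteq> PTr P"
proof
  fix s assume s: "s \<in> rad P"
  then have sS: "s \<in> S" by (simp add: rad_iff)
  obtain Q where Q: "S.prime_in Q" "Q \<inter> R = P" using lying_over_prime[OF P] by blast
  note QD = S.prime_inD[OF Q(1)]
  have gs: "g s \<in> Q" if g: "g \<in> Gal" for g
  proof -
    obtain n :: nat where n: "s [^] n \<in> ext P" using s by (auto simp: rad_iff)
    have "ext P \<subseteq> {x \<in> S. g x \<in> Q}"
    proof (rule ext_props(4)[OF P])
      show "S.submod {x \<in> S. g x \<in> Q}"
      proof (rule S.submodI)
        have "g \<zero> = \<zero>" using Gal_fix[OF g] K.R_closed(1) by blast
        then show "\<zero> \<in> {x \<in> S. g x \<in> Q}" using S.submodD(2)[OF QD(1)] by simp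
        show "x \<oplus> y \<in> {x \<in> S. g x \<in> Q}" if "x \<in> {x \<in> S. g x \<in> Q}" "y \<in> {x \<in> S. g x \<in> Q}" for x y
          using that S.submodD(3)[OF QD(1)] S.R_carrier by (auto simp: ring_hom_add[OF Gal_hom[OF g]])
        show "r \<otimes> x \<in> {x \<in> S. g x \<in> Q}" if "r \<in> S" "x \<in> {x \<in> S. g x \<in> Q}" for r x
          using that S.submodD(4)[OF QD(1)] S.R_carrier Gal_S[OF g]
          by (auto simp: ring_hom_mult[OF Gal_hom[OF g]])
      qed (use S.R_carrier in auto)
      show "P \<subseteq> {x \<in> S. g x \<in> Q}"
      proof
        fix x assume x: "x \<in> P"
        then have "x \<in> R" "x \<in> Q" using Q by auto
        then show "x \<in> {x \<in> S. g x \<in> Q}" using R_S R_K Gal_fix[OF g, of x] by auto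
      qed
    qed auto
    then have "g s [^] n \<in> Q" using n Gal_pow[OF g] sS S.R_carrier by auto
    then show "g s \<in> Q" using S.prime_in_pow[OF Q(1) Gal_S[OF g sS]] by blast
  qed
  have "Tr (s \<otimes> t) \<in> P" if t: "t \<in> S" for t
  proof -
    have "Tr (s \<otimes> t) \<in> Q"
      unfolding Tr_def
    proof (rule S.submod_finsum[OF QD(1)])
      fix g assume g: "g \<in> Gal"
      have "g (s \<otimes> t) = g s \<otimes> g t" using ring_hom_mult[OF Gal_hom[OF g]] sS t S.R_carrier by blast
      then show "g (s \<otimes> t) \<in> Q" using S.submodD(5)[OF QD(1) gs[OF g] Gal_S[OF g t]] by simp
    qed
    then show ?thesis using Tr_S[OF S.R_closed(4)[OF sS t]] Q by blast
  qed
  then show "s \<in> PTr P" using sS by (simp add: PTr_eq)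
qed

lemma PTr_submod:
  assumes P: "R.prime_in P"
  shows "S.submod (PTr P)" "PTr P \<subseteq> S"
proof -
  note PD = R.prime_inD[OF P]
  show "S.submod (PTr P)"
  proof (rule S.submodI)
    show "\<zero> \<in> PTr P" using R.submodD(2)[OF PD(1)] S.R_carrier by (auto simp: PTr_eq Tr_zero)
    show "x \<oplus> y \<in> PTr P" if "x \<in> PTr P" "y \<in> PTr P" for x y
      using that S.R_carrier R.submodD(3)[OF PD(1)] by (auto simp: PTr_eq l_distr Tr_add)
    show "r \<otimes> x \<in> PTr P" if rx: "r \<in> S" "x \<in> PTr P" for r x
    proof -
      have "(r \<otimes> x) \<otimes> t = x \<otimes> (r \<otimes> t)" if "t \<in> S" for t
        using that rx S.R_carrier by (simp add: PTr_eq m_ac)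
      then show ?thesis using rx by (auto simp: PTr_eq)
    qed
  qed (auto simp: PTr_eq S.R_carrier)
qed (auto simp: PTr_eq)

lemma Gal_PTr:
  assumes g: "g \<in> Gal" and s: "s \<in> PTr P"
  shows "g s \<in> PTr P"
proof -
  obtain h where h: "h \<in> Gal" "\<And>x. x \<in> carrier L \<Longrightarrow> g (h x) = x" by (rule Gal_inverse[OF g]) blast
  have sS: "s \<in> S" using s by (simp add: PTr_eq)
  have "Tr (g s \<otimes> t) \<in> P" if t: "t \<in> S" for t
  proof -
    have cl: "s \<in> carrier L" "t \<in> carrier L" "h t \<in> S" "h t \<in> carrier L"
      using sS t S.R_carrier Gal_S[OF h(1)] by auto
    have "g s \<otimes> t = g (s \<otimes> h t)" using ring_hom_mult[OF Gal_hom[OF g]] cl h(2) by simp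
    then have "Tr (g s \<otimes> t) = Tr (s \<otimes> h t)" using Tr_Gal[OF g, of "s \<otimes> h t"] cl by simp
    then show ?thesis using s cl by (simp add: PTr_eq)
  qed
  then show ?thesis using Gal_S[OF g sS] by (simp add: PTr_eq)
qed

text \<open>
  If some trace equals one, the Galois stable ideal \<open>PTr P\<close> meets \<open>R\<close> in \<open>P\<close> only. The non-leading
  coefficients of the characteristic polynomial of \<open>s \<in> PTr P\<close> are, up to sign, elementary
  symmetric functions of conjugates of \<open>s\<close>, so they lie in that intersection and
  \<open>s\<^sup>n \<in> PS\<close>.
\<close>

lemma PTr_subset_rad:
  assumes P: "R.prime_in P" and onto: "Tr ` S = R"
  shows "PTr P \<subseteq> rad P"
proof
  fix s assume s: "s \<in> PTr P"
  have sS: "s \<in> S" "s \<in> carrier L" using s S.R_carrier by (auto simp: PTr_eq)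
  note I = PTr_submod[OF P]
  have PTr_R: "r \<in> P" if r: "r \<in> PTr P" "r \<in> R" for r
  proof -
    obtain t where t: "t \<in> S" "Tr t = \<one>" using onto R.R_closed(2) by (metis imageE)
    have "Tr (r \<otimes> t) = r" using Tr_smult[of r t] t r R_K S.R_carrier R.R_carrier by auto
    then show ?thesis using r t by (auto simp: PTr_eq)
  qed
  define f where "f g = \<ominus> (g s)" for g :: "'a \<Rightarrow> 'a"
  have fI: "f g \<in> PTr P" "f g \<in> S" "f g \<in> carrier L" if "g \<in> Gal" for g
    using S.submodD(6)[OF I(1) Gal_PTr[OF that s]] I S.R_carrier by (auto simp: f_def)
  define e where "e k = elementary_sum Gal f k" for k
  have prodL: "(\<Otimes>i\<in>B. f i) \<in> carrier L" if "B \<subseteq> Gal" for B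
    using that fI by (intro finprod_closed) auto
  have eL: "e k \<in> carrier L" for k
    unfolding e_def elementary_sum_def using prodL by (intro finsum_closed) auto
  have gf: "g (f h) = f (compose (carrier L) g h)" if g: "g \<in> Gal" and h: "h \<in> Gal" for g h
  proof -
    interpret ring_hom_cring L L g by unfold_locales (rule Gal_hom[OF g])
    show ?thesis using h sS by (simp add: f_def compose_def)
  qed
  have e_K: "e k \<in> K" for k
    unfolding e_def by (rule elementary_sum_in_K[OF fI(3) gf])
  have prodS: "(\<Otimes>i\<in>B. f i) \<in> S" if "B \<subseteq> Gal" for B
    using finite_subset[OF that finite_Gal] that
  proof (induction B)
    case (insert g B)
    then have "(\<Otimes>i\<in>insert g B. f i) = f g \<otimes> (\<Otimes>i\<in>B. f i)"
      using fI by (intro finprod_insert) auto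
    then show ?case using S.R_closed(4)[of "f g" "\<Otimes>i\<in>B. f i"] fI insert by auto
  qed simp
  have e_P: "e k \<in> P" if k: "k \<noteq> 0" for k
  proof -
    have "e k \<in> PTr P"
      unfolding e_def elementary_sum_def
    proof (rule S.submod_finsum[OF I(1)])
      fix B assume B: "B \<in> {B. B \<subseteq> Gal \<and> card B = k}"
      then obtain g where g: "g \<in> B" using k by fastforce
      have fin: "finite B" using B finite_subset[OF _ finite_Gal] by auto
      have "(\<Otimes>i\<in>insert g (B - {g}). f i) = f g \<otimes> (\<Otimes>i\<in>B - {g}. f i)"
        using B fin fI g by (intro finprod_insert) auto
      moreover have "insert g (B - {g}) = B" using g by blast
      moreover have "f g \<in> PTr P" using fI B g by auto
      moreover have "(\<Otimes>i\<in>B - {g}. f i) \<in> S" using B by (intro prodS) auto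
      ultimately show "(\<Otimes>i\<in>B. f i) \<in> PTr P" using S.submodD(5)[OF I(1)] by simp
    qed
    then show ?thesis using PTr_R S_Int_K e_K I by blast
  qed
  define n where "n = card Gal"
  have zero: "(\<Otimes>g\<in>Gal. s \<oplus> f g) = \<zero>"
  proof -
    define u :: "'a \<Rightarrow> 'a" where "u = restrict id (carrier L)"
    have u: "u \<in> Gal" "u s = s" using Gal_one sS by (simp_all add: u_def)
    have c: "(\<Otimes>g\<in>Gal - {u}. s \<oplus> f g) \<in> carrier L" using fI sS by (intro finprod_closed) auto
    have "(\<Otimes>g\<in>insert u (Gal - {u}). s \<oplus> f g) = (s \<oplus> f u) \<otimes> (\<Otimes>g\<in>Gal - {u}. s \<oplus> f g)"
      using finite_Gal fI sS u(1) by (intro finprod_insert) auto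
    also have "s \<oplus> f u = \<zero>" using sS u(2) by (simp add: f_def r_neg)
    also have "insert u (Gal - {u}) = Gal" using u(1) by blast
    finally show ?thesis using c by simp
  qed
  have e0: "e 0 = \<one>"
  proof -
    have "{B. B \<subseteq> Gal \<and> card B = 0} = {{}}" using finite_subset[OF _ finite_Gal] by auto
    then show ?thesis by (simp add: e_def elementary_sum_def)
  qed
  have "\<zero> = (\<Oplus>k\<in>{..n}. s [^] (n - k) \<otimes> e k)"
    using finprod_add_expansion[of Gal s f] finite_Gal sS fI zero unfolding n_def e_def by simp
  also have "{..n} = insert 0 {1..n}" by auto
  also have "(\<Oplus>k\<in>insert 0 {1..n}. s [^] (n - k) \<otimes> e k) =
      s [^] (n - 0) \<otimes> e 0 \<oplus> (\<Oplus>k\<in>{1..n}. s [^] (n - k) \<otimes> e k)"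
    using sS eL by (intro finsum_insert) auto
  finally have eq: "s [^] n \<oplus> (\<Oplus>k\<in>{1..n}. s [^] (n - k) \<otimes> e k) = \<zero>" using e0 sS by simp
  have sum: "(\<Oplus>k\<in>{1..n}. s [^] (n - k) \<otimes> e k) \<in> ext P"
  proof (rule S.submod_finsum[OF ext_props(1)[OF P]])
    fix k assume "k \<in> {1..n}"
    then have "e k \<in> ext P" using e_P[of k] ext_props(3)[OF P] by auto
    then show "s [^] (n - k) \<otimes> e k \<in> ext P"
      using S.submodD(4)[OF ext_props(1)[OF P]] S.R_pow[OF sS(1)] by blast
  qed
  then have "s [^] n = \<ominus> (\<Oplus>k\<in>{1..n}. s [^] (n - k) \<otimes> e k)"
    using eq sS S.submodD(1)[OF ext_props(1)[OF P] sum]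
    by (metis a_comm minus_equality minus_minus nat_pow_closed)
  then have "s [^] n \<in> ext P" using S.submodD(6)[OF ext_props(1)[OF P] sum] by simp
  then show "s \<in> rad P" using sS by (auto simp: rad_iff)
qed

text \<open>
  By \<open>trace_psi\<close> the ideal \<open>Tr S\<close> is compatible with \<open>\<phi>\<close>. An ideal maximal among the proper
  compatible ideals containing it is automatically prime: for \<open>x\<close> outside \<open>M\<close> the quotient ideal
  \<open>(M : x)\<close> is compatible as well, because \<open>x \<phi> z = \<phi> (x\<^sup>p z)\<close>, so it equals \<open>M\<close>.
\<close>

lemma center_above_trace:
  assumes "Tr ` S \<noteq> R"
  shows "\<exists>P\<in>CR. Tr ` S \<subseteq> P"
proof -
  define F where "F = {M. R.submod M \<and> M \<subseteq> R \<and> Tr ` S \<subseteq> M \<and> \<phi> ` M \<subseteq> M \<and> \<one> \<notin> M}"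
  have sub: "R.submod (Tr ` S)"
  proof (rule R.submodI)
    show "Tr ` S \<subseteq> carrier L" using Tr_S R.R_carrier by auto
    show "\<zero> \<in> Tr ` S" using Tr_zero S.R_closed(1) by (metis imageI)
    show "x \<oplus> y \<in> Tr ` S" if xy: "x \<in> Tr ` S" "y \<in> Tr ` S" for x y
    proof -
      obtain s t where "s \<in> S" "t \<in> S" "x = Tr s" "y = Tr t" using xy by auto
      then show ?thesis using Tr_add[of s t] S.R_carrier S.R_closed(3)[of s t] by (metis imageI)
    qed
    show "r \<otimes> x \<in> Tr ` S" if rx: "r \<in> R" "x \<in> Tr ` S" for r x
    proof -
      obtain s where s: "s \<in> S" "x = Tr s" using rx by auto
      then have "r \<otimes> x = Tr (r \<otimes> s)" using Tr_smult[of r s] rx R_K S.R_carrier by auto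
      moreover have "r \<otimes> s \<in> S" using rx R_S s by auto
      ultimately show ?thesis by auto
    qed
  qed
  have "\<phi> ` Tr ` S \<subseteq> Tr ` S"
  proof (rule image_subsetI)
    fix x assume "x \<in> Tr ` S"
    then obtain s where s: "s \<in> S" "x = Tr s" by auto
    have "Tr (\<psi> s) \<in> Tr ` S" using psi_closed[OF s(1)] by (rule imageI)
    then show "\<phi> x \<in> Tr ` S" using trace_psi[OF s(1)] s(2) by simp
  qed
  moreover have "\<one> \<notin> Tr ` S"
  proof
    assume one: "\<one> \<in> Tr ` S"
    have "r \<in> Tr ` S" if "r \<in> R" for r using R.submodD(4)[OF sub that one] that R.R_carrier by simp
    then show False using assms Tr_S by blast
  qed
  ultimately have "Tr ` S \<in> F" using sub Tr_S by (auto simp: F_def)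
  then have "\<exists>M\<in>F. \<forall>N\<in>F. M \<subseteq> N \<longrightarrow> N = M"
    by (intro R.noeth_set_maximal[OF R.noeth_set_R]) (auto simp: F_def)
  then obtain M where M: "M \<in> F" and max: "\<And>N. N \<in> F \<Longrightarrow> M \<subseteq> N \<Longrightarrow> N = M" by blast
  have MD: "R.submod M" "M \<subseteq> R" "Tr ` S \<subseteq> M" "\<And>x. x \<in> M \<Longrightarrow> \<phi> x \<in> M" "\<one> \<notin> M"
    using M by (auto simp: F_def)
  have "R.prime_in M"
    unfolding R.prime_in_def
  proof (intro conjI ballI impI MD)
    fix x y assume xy: "x \<in> R" "y \<in> R" "x \<otimes> y \<in> M"
    have xL: "x \<in> carrier L" using xy R.R_carrier by blast
    show "x \<in> M \<or> y \<in> M"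
    proof (rule disjCI)
      assume y: "y \<notin> M"
      show "x \<in> M"
      proof (rule ccontr)
        assume x: "x \<notin> M"
        define N where "N = {z \<in> R. x \<otimes> z \<in> M}"
        have "R.submod N"
        proof (rule R.submodI)
          show "r \<otimes> z \<in> N" if rz: "r \<in> R" "z \<in> N" for r z
          proof -
            have "x \<otimes> (r \<otimes> z) = r \<otimes> (x \<otimes> z)" using xL rz R.R_carrier by (simp add: N_def m_ac)
            then show ?thesis using rz R.submodD(4)[OF MD(1)] by (simp add: N_def)
          qed
        qed (use xL R.R_carrier R.submodD[OF MD(1)] in \<open>auto simp: N_def r_distr\<close>)
        moreover have "M \<subseteq> N" using MD xy R.submodD(4)[OF MD(1)] by (auto simp: N_def)
        moreover have "\<phi> z \<in> N" if z: "z \<in> N" for z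
        proof -
          have zR: "z \<in> R" "x \<otimes> z \<in> M" "z \<in> carrier L" using z R.R_carrier by (auto simp: N_def)
          obtain q where q: "p = Suc q" using prime_gt_0_nat[OF prime_p] gr0_implies_Suc by blast
          have "x [^] p \<otimes> z = x [^] q \<otimes> (x \<otimes> z)" using xL zR by (simp add: q m_assoc)
          then have "x [^] p \<otimes> z \<in> M" using R.submodD(4)[OF MD(1) R.R_pow[OF xy(1)] zR(2)] by simp
          then have "x \<otimes> \<phi> z \<in> M" using MD(4) phi_pow[OF xy(1) zR(1)] by metis
          then show ?thesis using phi_closed zR by (simp add: N_def)
        qed
        moreover have "\<one> \<notin> N" using x xL by (simp add: N_def)
        ultimately have "N \<in> F" using MD(3) by (auto simp: F_def N_def)
        then have "N = M" using max \<open>M \<subseteq> N\<close> by blast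
        then show False using xy y by (auto simp: N_def)
      qed
    qed
  qed
  then have "M \<in> CR" unfolding CR_iff using MD(4) by simp
  then show ?thesis using MD(3) by (rule bexI[rotated])
qed

text \<open>
  If all traces lie in a center \<open>P\<close>, then \<open>PTr P\<close> is all of \<open>S\<close>, while the radical of \<open>PS\<close> is
  proper.
\<close>

lemma tame_at_centers_imp_onto:
  assumes "\<And>P. P \<in> CR \<Longrightarrow> PTr P = rad P"
  shows "Tr ` S = R"
proof (rule ccontr)
  assume "Tr ` S \<noteq> R"
  then obtain P where P: "P \<in> CR" "Tr ` S \<subseteq> P" using center_above_trace by blast
  then have "\<one> \<in> PTr P" using S.R_carrier by (auto simp: PTr_eq)
  then show False using assms[OF P(1)] one_notin_rad P by (auto simp: CR_iff)
qed

lemma PTr_psi: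
  assumes P: "P \<in> CR" and s: "s \<in> PTr P"
  shows "\<psi> s \<in> PTr P"
proof -
  have sS: "s \<in> S" using s by (simp add: PTr_eq)
  have "Tr (\<psi> s \<otimes> t) \<in> P" if t: "t \<in> S" for t
  proof -
    have "\<psi> s \<otimes> t = \<psi> (t [^] p \<otimes> s)"
      using psi_pow[OF t sS] m_comm[of t "\<psi> s"] S.R_carrier[OF t] S.R_carrier[OF psi_closed[OF sS]] by simp
    then have "Tr (\<psi> s \<otimes> t) = \<phi> (Tr (t [^] p \<otimes> s))"
      using trace_psi S.R_closed(4)[OF S.R_pow[OF t] sS] by simp
    moreover have "t [^] p \<otimes> s = s \<otimes> t [^] p" using t sS S.R_carrier by (simp add: m_comm)
    moreover have "Tr (s \<otimes> t [^] p) \<in> P" using s S.R_pow[OF t] by (simp add: PTr_eq)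
    ultimately show ?thesis using P by (simp add: CR_iff)
  qed
  then show ?thesis using psi_closed[OF sS] by (simp add: PTr_eq)
qed

text \<open>
  Tameness makes the radical of \<open>PS\<close> stable under \<open>\<psi>\<close>, and \<open>Q\<close> is minimal over it. For \<open>x \<in> Q\<close>
  the element \<open>a\<close> of \<open>integral_mod_prime\<close> is outside \<open>Q\<close> and \<open>x a\<close> is in the radical. Then
  \<open>a \<psi> x = \<psi> (a\<^sup>p x)\<close> lies in the radical, and \<open>\<psi> x \<in> Q\<close>.
\<close>

lemma tame_imp_center_above:
  assumes P: "P \<in> CR" and tame: "PTr P = rad P" and Q: "S.prime_in Q" "Q \<inter> R = P"
  shows "Q \<in> CS"
  unfolding CS_iff
proof (intro conjI ballI Q)
  fix x assume x: "x \<in> Q"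
  note QD = S.prime_inD[OF Q(1)]
  have Pp: "R.prime_in P" using P by (simp add: CR_iff)
  have xS: "x \<in> S" "x \<in> carrier L" using x QD S.R_carrier by auto
  obtain m :: nat and c h where h: "c \<in> R" "c \<notin> P" "h \<in> S"
    "\<And>J. S.submod J \<Longrightarrow> P \<subseteq> J \<Longrightarrow> x [^] m \<otimes> (c \<oplus> x \<otimes> h) \<in> J"
    by (rule integral_mod_prime[OF Pp xS(1)]) blast
  define a where "a = c \<oplus> x \<otimes> h"
  have cS: "c \<in> S" "c \<in> carrier L" "h \<in> carrier L" using h R_S R.R_carrier S.R_carrier by auto
  have aS: "a \<in> S" "a \<in> carrier L" using cS h xS by (auto simp: a_def)
  have aQ: "a \<notin> Q"
  proof
    assume "a \<in> Q"
    moreover have "x \<otimes> h \<in> Q" using S.submodD(5)[OF QD(1)] x h by blast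
    ultimately have "a \<ominus> x \<otimes> h \<in> Q" by (rule S.submodD(7)[OF QD(1)])
    moreover have "a \<ominus> x \<otimes> h = c" unfolding a_def using cS xS by algebra
    ultimately show False using h Q by auto
  qed
  have xa: "x [^] m \<otimes> a \<in> ext P" unfolding a_def using h(4) ext_props[OF Pp] by blast
  have radQ: "rad P \<subseteq> Q" using rad_subset_prime[OF Pp Q(1)] Q(2) by blast
  have "m \<noteq> 0"
  proof
    assume "m = 0"
    then have "a \<in> ext P" using xa aS by simp
    then have "a \<in> Q" using ext_props(4)[OF Pp QD(1,2)] Q by blast
    then show False using aQ by blast
  qed
  then obtain l where l: "m = Suc l" by (cases m) auto
  have "(x \<otimes> a) [^] m = a [^] l \<otimes> (x [^] m \<otimes> a)"
    using xS aS by (simp add: l nat_pow_distrib m_ac)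
  then have "(x \<otimes> a) [^] m \<in> ext P"
    using S.submodD(4)[OF ext_props(1)[OF Pp] S.R_pow[OF aS(1)] xa] by simp
  then have xaT: "x \<otimes> a \<in> PTr P" unfolding tame using xS aS by (auto simp: rad_iff)
  obtain q where q: "p = Suc q" using prime_gt_0_nat[OF prime_p] gr0_implies_Suc by blast
  have "a [^] p \<otimes> x = a [^] q \<otimes> (x \<otimes> a)" using xS aS by (simp add: q m_ac)
  then have "a [^] p \<otimes> x \<in> PTr P"
    using S.submodD(4)[OF PTr_submod(1)[OF Pp] S.R_pow[OF aS(1)] xaT] by simp
  then have "\<psi> (a [^] p \<otimes> x) \<in> Q" using PTr_psi[OF P] tame radQ by blast
  then have "a \<otimes> \<psi> x \<in> Q" using psi_pow[OF aS(1) xS(1)] by simp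
  then show "\<psi> x \<in> Q" using QD(4)[OF aS(1) psi_closed[OF xS(1)]] aQ by blast
qed

text \<open>
  Galois coordinates recover every element from its traces.
\<close>

lemma trace_nonzero: "\<exists>s\<in>S. Tr s \<noteq> \<zero>"
proof (rule ccontr)
  assume neg: "\<not> ?thesis"
  obtain n :: nat and a b d where ab: "d \<in> R" "d \<noteq> \<zero>" "\<forall>j. a j \<in> S \<and> b j \<in> S"
    "(\<Oplus>j\<in>{..<n}. a j \<otimes> b j) = d"
    "\<forall>g\<in>Gal. g \<noteq> restrict id (carrier L) \<longrightarrow> (\<Oplus>j\<in>{..<n}. a j \<otimes> g (b j)) = \<zero>"
    using integral_coordinates by blast
  have abL: "a j \<in> carrier L" "b j \<in> carrier L" for j using ab(3) S.R_carrier by auto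
  have "(\<Oplus>j\<in>{..<n}. a j \<otimes> Tr (b j \<otimes> \<one>)) = d \<otimes> \<one>"
    using trace_expansion[OF abL ab(4) _ one_closed] ab(5) by blast
  moreover have "(\<Oplus>j\<in>{..<n}. a j \<otimes> Tr (b j \<otimes> \<one>)) = (\<Oplus>j\<in>{..<n}. \<zero>)"
  proof (rule finsum_cong')
    fix j
    have "Tr (b j) = \<zero>" using neg ab(3) by blast
    then show "a j \<otimes> Tr (b j \<otimes> \<one>) = \<zero>" using abL by simp
  qed auto
  ultimately have "d = \<zero>" using finsum_zero R.R_carrier[OF ab(1)] by simp
  then show False using ab by simp
qed

text \<open>
  The set of \<open>y \<in> L\<close> with \<open>Tr (y S) \<subseteq> P\<close>, localized at \<open>P\<close>, contains \<open>S\<close> by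
  assumption, hence \<open>c Q\<close> for the denominator ideal \<open>Q\<close> of \<open>c\<close>. If \<open>\<psi>\<close> preserves \<open>Q\<close>,
  the set of such multipliers \<open>c\<close> of \<open>Q\<close> is closed under \<open>p\<close>-th powers. Indeed, if
  \<open>y = Tr (c\<^bsup>Np\<^esup> q)\<close> were not in \<open>P\<close> locally, some multiple of it would be congruent to one
  modulo \<open>P\<close>; applying \<open>\<phi>\<close> to this multiple gives an element outside \<open>P\<close>, but also
  \<open>Tr (c\<^sup>N \<psi> u)\<close> for some \<open>u \<in> Q\<close>, which is in \<open>P\<close> locally by induction.
\<close>

lemma frobenius_powers_trace:
  assumes P: "P \<in> CR" "P \<noteq> {\<zero>}" "Tr ` S \<subseteq> P"
    and c: "c \<in> carrier L" and Q: "S.prime_in (D.denominators c)" "D.denominators c \<inter> R = P"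
      "\<And>x. x \<in> D.denominators c \<Longrightarrow> \<psi> x \<in> D.denominators c"
    and q: "q \<in> D.denominators c"
  shows "\<exists>w\<in>R - P. w \<otimes> Tr (c [^] (p ^ k) \<otimes> q) \<in> P"
  using q
proof (induction k arbitrary: q)
  case 0
  have "c \<otimes> q \<in> S" using 0 by (simp add: D.denominators_def)
  then have "Tr (c \<otimes> q) \<in> P" "Tr (c \<otimes> q) \<in> carrier L" using P(3) S.R_carrier by auto
  moreover have "\<one> \<in> R - P" using R.prime_inD(3) P(1) by (simp add: CR_iff)
  ultimately show ?case using c by (intro bexI[of _ \<one>]) auto
next
  case (Suc k)
  have Pp: "R.prime_in P" using P(1) by (simp add: CR_iff)
  note PD = R.prime_inD[OF Pp]
  have qS: "q \<in> S" "q \<in> carrier L" using Suc.prems S.R_carrier by (auto simp: D.denominators_def)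
  define N where "N = p ^ k"
  have N: "p ^ Suc k = N * p" by (simp add: N_def)
  define y where "y = Tr (c [^] (N * p) \<otimes> q)"
  have y: "y \<in> K" "y \<in> carrier L" unfolding y_def using c qS by (auto intro!: Tr_in_K)
  have "(\<exists>w\<in>R - P. w \<otimes> y \<in> P) \<or> (\<exists>w\<in>R. w \<otimes> y \<in> R - P)"
    by (rule valuation_dichotomy[OF Pp P(2) y(1)])
  then show ?case
  proof
    assume "\<exists>w\<in>R - P. w \<otimes> y \<in> P"
    then show ?thesis by (simp only: N y_def)
  next
    assume "\<exists>w\<in>R. w \<otimes> y \<in> R - P"
    then obtain w where w: "w \<in> R" "w \<otimes> y \<in> R" "w \<otimes> y \<notin> P" by auto
    obtain r z where rz: "r \<in> R" "z \<in> P" "(w \<otimes> y) \<otimes> r = \<one> \<oplus> z"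
      using unit_mod_prime[OF Pp P(2) w(2,3)] by blast
    have zR: "z \<in> R" "z \<in> carrier L" using rz PD R.R_carrier by auto
    obtain a where a: "a \<in> P" "a \<noteq> \<zero>" using P(2) R.submodD(2)[OF PD(1)] by blast
    have aR: "a \<in> R" "a \<in> carrier L" "a \<in> S" using a PD R.R_carrier R_S by auto
    have aQ: "a \<in> D.denominators c" using a Q(2) by blast
    \<comment> \<open>\<open>\<psi>\<close> and \<open>\<phi>\<close> act on \<open>S\<close> and \<open>R\<close> only; the denominator \<open>a\<close> of \<open>c\<close> is carried along.\<close>
    define b where "b = c \<otimes> a"
    have b: "b \<in> S" "b \<in> carrier L" using aQ S.R_carrier by (auto simp: b_def D.denominators_def)
    define u where "u = q \<otimes> (w \<otimes> r)"
    have wr: "w \<otimes> r \<in> R" "w \<otimes> r \<in> S" "w \<otimes> r \<in> K" "w \<otimes> r \<in> carrier L"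
      using R.R_closed(4)[OF w(1) rz(1)] R_S R_K R.R_carrier by auto
    have uQ: "u \<in> D.denominators c"
      unfolding u_def using S.submodD(5)[OF S.prime_inD(1)[OF Q(1)] Suc.prems wr(2)] .
    then have uS: "u \<in> S" "u \<in> carrier L" using S.R_carrier by (auto simp: D.denominators_def)
    have aN: "a [^] N \<in> R" "a [^] N \<in> K" "a [^] N \<in> carrier L" "a [^] (N * p) \<in> R" "a [^] (N * p) \<in> K"
      using R.R_pow[OF aR(1)] R_K R.R_carrier by auto
    have pp: "(a [^] N) [^] p = a [^] (N * p)" "(b [^] N) [^] p = b [^] (N * p)"
      using aR b by (simp_all add: nat_pow_pow)
    have bpow: "b [^] i = a [^] i \<otimes> c [^] i" for i :: nat
      unfolding b_def using c aR by (simp add: nat_pow_distrib m_comm)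
    have "Tr (b [^] (N * p) \<otimes> u) = Tr (a [^] (N * p) \<otimes> ((w \<otimes> r) \<otimes> (c [^] (N * p) \<otimes> q)))"
      unfolding bpow u_def using c aR qS wr(4) by (simp add: m_ac)
    also have "\<dots> = a [^] (N * p) \<otimes> ((w \<otimes> r) \<otimes> y)"
      unfolding y_def using Tr_smult aN(5) wr c qS by simp
    also have "(w \<otimes> r) \<otimes> y = \<one> \<oplus> z"
      using rz(3) w(1)[THEN R.R_carrier] rz(1)[THEN R.R_carrier] y(2) by (simp add: m_ac)
    finally have 1: "Tr (b [^] (N * p) \<otimes> u) = a [^] (N * p) \<otimes> (\<one> \<oplus> z)" .
    have "a [^] N \<otimes> \<phi> (\<one> \<oplus> z) = \<phi> (a [^] (N * p) \<otimes> (\<one> \<oplus> z))"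
      using phi_pow[OF aN(1), of "\<one> \<oplus> z"] zR pp by simp
    also have "\<dots> = \<phi> (Tr (b [^] (N * p) \<otimes> u))" using 1 by simp
    also have "\<dots> = Tr (\<psi> ((b [^] N) [^] p \<otimes> u))"
      using trace_psi[of "b [^] (N * p) \<otimes> u"] b(1) uS(1) pp(2) by simp
    also have "\<psi> ((b [^] N) [^] p \<otimes> u) = b [^] N \<otimes> \<psi> u"
      using psi_pow[OF S.R_pow[OF b(1)] uS(1)] .
    also have "\<dots> = a [^] N \<otimes> (c [^] N \<otimes> \<psi> u)"
      unfolding bpow using aR c psi_closed[OF uS(1)] S.R_carrier by (simp add: m_assoc)
    also have "Tr \<dots> = a [^] N \<otimes> Tr (c [^] N \<otimes> \<psi> u)"
      using Tr_smult[OF aN(2)] c psi_closed[OF uS(1)] S.R_carrier by simp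
    finally have 2: "a [^] N \<otimes> \<phi> (\<one> \<oplus> z) = a [^] N \<otimes> Tr (c [^] N \<otimes> \<psi> u)" .
    have aN0: "a [^] N \<noteq> \<zero>"
    proof
      assume "a [^] N = \<zero>"
      then have "a \<in> {\<zero>}" using R.prime_in_pow[OF R.prime_zero aR(1), of N] by simp
      then show False using a by simp
    qed
    have phi1: "\<phi> (\<one> \<oplus> z) = \<one> \<oplus> \<phi> z" "\<phi> z \<in> P" "\<phi> z \<in> carrier L"
      using phi_add[of \<one> z] zR phi_one P(1) rz(2) phi_closed R.R_carrier by (auto simp: CR_iff)
    have t: "Tr (c [^] N \<otimes> \<psi> u) \<in> carrier L"
      using c psi_closed[OF uS(1)] S.R_carrier by auto
    have eq: "Tr (c [^] N \<otimes> \<psi> u) = \<one> \<oplus> \<phi> z"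
      using m_lcancel[OF aN0 aN(3) _ t, of "\<phi> (\<one> \<oplus> z)"] 2 phi1 by simp
    obtain v where v: "v \<in> R" "v \<notin> P" "v \<otimes> Tr (c [^] N \<otimes> \<psi> u) \<in> P"
      using Suc.IH[OF Q(3)[OF uQ]] by (auto simp: N_def)
    have "\<one> \<oplus> \<phi> z \<in> R" using phi_closed zR by simp
    then have "\<one> \<oplus> \<phi> z \<in> P" using v PD(4)[of v "\<one> \<oplus> \<phi> z"] eq by auto
    then have "(\<one> \<oplus> \<phi> z) \<ominus> \<phi> z \<in> P" using R.submodD(7)[OF PD(1)] phi1 by blast
    moreover have "(\<one> \<oplus> \<phi> z) \<ominus> \<phi> z = \<one>" using phi1(3) by algebra
    ultimately show ?thesis using PD(3) by simp
  qed
qed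

lemma common_multiplier:
  assumes P: "R.prime_in P" and y: "\<And>j. j < (n::nat) \<Longrightarrow> y j \<in> carrier L \<and> (\<exists>w\<in>R - P. w \<otimes> y j \<in> R)"
  shows "\<exists>w\<in>R - P. \<forall>j<n. w \<otimes> y j \<in> R"
  using y
proof (induction n)
  case 0
  then show ?case using R.prime_inD(3)[OF P] by (intro bexI[of _ \<one>]) auto
next
  case (Suc n)
  obtain v where v: "v \<in> R" "v \<notin> P" "\<And>j. j < n \<Longrightarrow> v \<otimes> y j \<in> R"
    using Suc.IH Suc.prems less_SucI by (metis Diff_iff)
  obtain w where w: "w \<in> R" "w \<notin> P" "w \<otimes> y n \<in> R" using Suc.prems[of n] by auto
  have cl: "v \<in> carrier L" "w \<in> carrier L" using v w R.R_carrier by auto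
  have "(v \<otimes> w) \<otimes> y j \<in> R" if j: "j < Suc n" for j
  proof (cases "j = n")
    case True
    have "v \<otimes> (w \<otimes> y n) \<in> R" using v w by simp
    then show ?thesis using True cl Suc.prems[of n] by (simp add: m_assoc)
  next
    case False
    then have "w \<otimes> (v \<otimes> y j) \<in> R" using v w j by simp
    then show ?thesis using cl Suc.prems[OF j] by (simp add: m_ac)
  qed
  moreover have "v \<otimes> w \<in> R - P" using v w R.prime_inD(4)[OF P v(1) w(1)] by auto
  ultimately show ?case by blast
qed

text \<open>
  Integrality over a localization of \<open>R\<close>, with denominators \<open>w\<close> made explicit. The relation
  between the powers \<open>c\<^bsup>p^i\<^esup>\<close> is multiplied by \<open>w\<^sub>k\<^bsup>N-1\<^esup>\<close>, \<open>N = p^k\<close>, to turn it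
  into an integral equation of degree \<open>N\<close> for \<open>w\<^sub>k c\<close>; the exponents \<open>N - 1 - p^i\<close> are
  nonnegative since \<open>i < k\<close>.
\<close>

lemma local_integral:
  assumes c: "c \<in> carrier L" and q: "q \<in> carrier L" "q \<noteq> \<zero>" and p1: "p > 1"
    and w: "\<And>k. w k \<in> R" and k: "w k \<otimes> (c [^] (p ^ k) \<otimes> q) \<in> R.rspan ((\<lambda>i. w i \<otimes> (c [^] (p ^ i) \<otimes> q)) ` {..<k})"
  shows "integral_over L R (w k \<otimes> c)"
proof -
  define N where "N = p ^ k"
  have wL: "w i \<in> carrier L" for i using w R.R_carrier by blast
  define x where "x = w k \<otimes> c"
  have x: "x \<in> carrier L" using wL c by (simp add: x_def)
  have N1: "N = Suc (N - 1)" using p1 by (simp add: N_def)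
  define U where "U = {x [^] i | i::nat. i < N}"
  have U: "U \<subseteq> carrier L" using x by (auto simp: U_def)
  let ?d = "inv q \<otimes> w k [^] (N - 1)"
  have iq: "inv q \<in> carrier L" "inv q \<otimes> q = \<one>" using q by (auto simp: field_Units)
  have d: "?d \<in> carrier L" using iq wL by simp
  have cancel: "?d \<otimes> (s \<otimes> (t \<otimes> q)) = w k [^] (N - 1) \<otimes> s \<otimes> t"
    if "s \<in> carrier L" "t \<in> carrier L" for s t
  proof -
    have "?d \<otimes> (s \<otimes> (t \<otimes> q)) = (inv q \<otimes> q) \<otimes> (w k [^] (N - 1) \<otimes> s \<otimes> t)"
      using that iq(1) q(1) wL[of k] by (simp add: m_ac)
    then show ?thesis using that iq(2) wL[of k] by simp
  qed
  have "?d \<otimes> (w k \<otimes> (c [^] N \<otimes> q)) \<in>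
      R.rspan ((\<otimes>) ?d ` (\<lambda>i. w i \<otimes> (c [^] (p ^ i) \<otimes> q)) ` {..<k})"
    unfolding N_def by (rule R.rspan_scale[OF k _ d[unfolded N_def]]) (use wL c q in auto)
  moreover have "(\<otimes>) ?d ` (\<lambda>i. w i \<otimes> (c [^] (p ^ i) \<otimes> q)) ` {..<k} \<subseteq> R.rspan U"
    unfolding image_image
  proof (rule image_subsetI)
    fix i assume "i \<in> {..<k}"
    then have i: "p ^ i < N" using p1 by (simp add: N_def)
    define M where "M = p ^ i"
    have M: "N - 1 = (N - 1 - M) + M" "M < N" using i by (auto simp: M_def)
    have pw: "w k [^] (N - 1) = w k [^] (N - 1 - M) \<otimes> w k [^] M"
      using wL M(1) nat_pow_mult by metis
    have "?d \<otimes> (w i \<otimes> (c [^] M \<otimes> q)) = w k [^] (N - 1) \<otimes> w i \<otimes> c [^] M"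
      using cancel wL c by simp
    also have "\<dots> = (w k [^] (N - 1 - M) \<otimes> w i) \<otimes> x [^] M"
      unfolding pw using wL[of k] wL[of i] c by (simp add: x_def nat_pow_distrib m_ac)
    also have "\<dots> \<in> R.rspan U"
    proof (rule R.submodD(4)[OF R.rspan_submod[OF U]])
      show "w k [^] (N - 1 - M) \<otimes> w i \<in> R" using w by simp
      show "x [^] M \<in> R.rspan U" by (rule R.rspan_gen[OF _ U]) (use M(2) in \<open>auto simp: U_def\<close>)
    qed
    finally show "?d \<otimes> (w i \<otimes> (c [^] (p ^ i) \<otimes> q)) \<in> R.rspan U" by (simp only: M_def)
  qed
  ultimately have "?d \<otimes> (w k \<otimes> (c [^] N \<otimes> q)) \<in> R.rspan U"
    using R.rspan_least R.rspan_submod[OF U] by blast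
  moreover have "?d \<otimes> (w k \<otimes> (c [^] N \<otimes> q)) = w k [^] (N - 1) \<otimes> w k \<otimes> c [^] N"
    using cancel wL c by simp
  moreover have "w k [^] (N - 1) \<otimes> w k = w k [^] N" using N1 nat_pow_Suc by metis
  moreover have "w k [^] N \<otimes> c [^] N = x [^] N"
    using wL[of k] c by (simp add: x_def nat_pow_distrib)
  ultimately have "x [^] N \<in> R.rspan {x [^] i | i::nat. i < N}" by (simp add: U_def)
  then show ?thesis using R.integral_over_iff[OF x] unfolding x_def by blast
qed

text \<open>
  Otherwise all traces lie in a center \<open>P\<close>. Let \<open>Q\<close> over \<open>P\<close> be the denominator ideal of some
  \<open>c \<notin> S\<close>. By hypothesis \<open>\<psi>\<close> preserves \<open>Q\<close>, so by \<open>frobenius_powers_trace\<close> all powers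
  \<open>c\<^bsup>p^k\<^esup>\<close> multiply \<open>Q\<close> into the elements \<open>y\<close> with \<open>Tr (y S) \<subseteq> P\<close>, locally at \<open>P\<close>. These have
  bounded denominators (\<open>trace_span\<close>), so \<open>c\<close> is integral locally at \<open>P\<close>: some \<open>w \<in> R\<close> outside \<open>P\<close>
  satisfies \<open>w c \<in> S\<close>, that is, \<open>w \<in> Q \<inter> R = P\<close>, a contradiction.
\<close>

lemma centers_above_imp_onto:
  assumes above: "CS = {Q. S.prime_in Q \<and> Q \<inter> R \<in> CR}"
  shows "Tr ` S = R"
proof (rule ccontr)
  assume "Tr ` S \<noteq> R"
  then obtain P where P: "P \<in> CR" "Tr ` S \<subseteq> P" using center_above_trace by blast
  have P0: "P \<noteq> {\<zero>}" using trace_nonzero P(2) by blast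
  have Pp: "R.prime_in P" using P(1) by (simp add: CR_iff)
  obtain c where c: "c \<in> carrier L" "c \<notin> S" "S.prime_in (D.denominators c)" "D.denominators c \<inter> R = P"
    using prime_above[OF Pp P0] by blast
  have "D.denominators c \<in> CS" unfolding above using c P by simp
  then have stable: "\<psi> x \<in> D.denominators c" if "x \<in> D.denominators c" for x
    using that by (simp add: CS_iff)
  have pow: "\<exists>w\<in>R - P. w \<otimes> Tr (c [^] (p ^ k) \<otimes> q) \<in> P" if "q \<in> D.denominators c" for q k
    by (rule frobenius_powers_trace[OF P(1) P0 P(2) c(1,3,4) stable that])
  obtain q where q: "q \<in> P" "q \<noteq> \<zero>" using P0 R.submodD(2)[OF R.prime_inD(1)[OF Pp]] by blast
  have qQ: "q \<in> D.denominators c" using q c(4) by blast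
  have qL: "q \<in> carrier L" "q \<in> S" using q qQ S.R_carrier by (auto simp: D.denominators_def)
  obtain n :: nat and a b d where ab: "d \<in> R" "d \<noteq> \<zero>" "\<forall>j. a j \<in> S \<and> b j \<in> S"
    "\<forall>x\<in>carrier L. (\<forall>j<n. Tr (b j \<otimes> x) \<in> R) \<longrightarrow> d \<otimes> x \<in> R.rspan (a ` {..<n})"
    using trace_span by blast
  have abL: "a j \<in> carrier L" "b j \<in> carrier L" "b j \<in> S" for j using ab(3) S.R_carrier by auto
  define x where "x k = c [^] (p ^ k) \<otimes> q" for k :: nat
  have x: "x k \<in> carrier L" for k using c qL by (simp add: x_def)
  have "\<exists>w\<in>R - P. \<forall>j<n. w \<otimes> Tr (b j \<otimes> x k) \<in> R" for k
  proof (rule common_multiplier[OF Pp])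
    fix j
    have bq: "b j \<otimes> q \<in> D.denominators c" using S.submodD(4)[OF S.prime_inD(1)[OF c(3)] abL(3) qQ] .
    have "b j \<otimes> x k = c [^] (p ^ k) \<otimes> (b j \<otimes> q)" using abL c qL by (simp add: x_def m_ac)
    then obtain w where "w \<in> R - P" "w \<otimes> Tr (b j \<otimes> x k) \<in> P" using pow[OF bq, of k] by auto
    then show "Tr (b j \<otimes> x k) \<in> carrier L \<and> (\<exists>w\<in>R - P. w \<otimes> Tr (b j \<otimes> x k) \<in> R)"
      using R.prime_inD(2)[OF Pp] abL x by auto
  qed
  then obtain w where w: "\<And>k. w k \<in> R - P" "\<And>k j. j < n \<Longrightarrow> w k \<otimes> Tr (b j \<otimes> x k) \<in> R" by metis
  have wK: "w k \<in> K" "w k \<in> carrier L" "w k \<in> R" for k using w(1)[of k] R_K R.R_carrier by auto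
  define v where "v k = w k \<otimes> x k" for k
  have v: "v k \<in> carrier L" for k using wK x by (simp add: v_def)
  have "R.noeth_set (range v)"
  proof (rule R.noeth_set_scale)
    show "R.noeth_set (R.rspan (a ` {..<n}))" using abL by (intro R.noeth_set_rspan) auto
    show "d \<otimes> y \<in> R.rspan (a ` {..<n})" if y: "y \<in> range v" for y
    proof -
      obtain k where k: "y = v k" using y by blast
      have "Tr (b j \<otimes> v k) \<in> R" if "j < n" for j
      proof -
        have "b j \<otimes> v k = w k \<otimes> (b j \<otimes> x k)" using abL x wK(2)[of k] by (simp add: v_def m_ac)
        then show ?thesis using Tr_smult[OF wK(1)] abL x w(2)[OF that, of k] by simp
      qed
      then show ?thesis using ab(4) v k by blast
    qed
  qed (use ab R.R_carrier v in auto)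
  then obtain k where k: "v k \<in> R.rspan (v ` {..<k})"
    unfolding R.noeth_set_def by blast
  have "integral_over L R (w k \<otimes> c)"
    by (rule local_integral[OF c(1) qL(1) q(2) prime_gt_1_nat[OF prime_p] wK(3)])
      (use k in \<open>simp add: v_def[abs_def] x_def\<close>)
  then have "c \<otimes> w k \<in> S" using c(1) wK(2)[of k] by (simp add: S_iff m_comm)
  then have "w k \<in> D.denominators c \<inter> R" using wK(3)[of k] R_S by (auto simp: D.denominators_def)
  then show False using c(4) w(1)[of k] by blast
qed

section \<open>The equivalences and the Cohen--Seidenberg properties\<close>

lemma equivalence:
  shows "(\<forall>P\<in>CR. PTr P = rad P) \<longleftrightarrow> CS = {Q. S.prime_in Q \<and> Q \<inter> R \<in> CR}"
    and "CS = {Q. S.prime_in Q \<and> Q \<inter> R \<in> CR} \<longleftrightarrow> Tr ` S = R"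
    and "Tr ` S = R \<longleftrightarrow> (\<forall>P. R.prime_in P \<longrightarrow> PTr P = rad P)"
proof -
  have c_c': "PTr P = rad P" if "Tr ` S = R" "R.prime_in P" for P
    using PTr_subset_rad[OF that(2,1)] rad_subset_PTr[OF that(2)] by (rule equalityI)
  have c'_a: "PTr P = rad P" if "\<forall>P. R.prime_in P \<longrightarrow> PTr P = rad P" "P \<in> CR" for P
    using that by (simp add: CR_iff)
  have a_b: "CS = {Q. S.prime_in Q \<and> Q \<inter> R \<in> CR}" if a: "\<forall>P\<in>CR. PTr P = rad P"
  proof (intro equalityI subsetI CollectI conjI)
    fix Q assume Q: "Q \<in> CS"
    show "S.prime_in Q" using Q by (simp add: CS_iff)
    show "Q \<inter> R \<in> CR" by (rule CS_contraction[OF Q])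
  next
    fix Q assume Q: "Q \<in> {Q. S.prime_in Q \<and> Q \<inter> R \<in> CR}"
    then have Q': "Q \<inter> R \<in> CR" by simp
    show "Q \<in> CS" by (rule tame_imp_center_above[OF Q' bspec[OF a Q'] _ refl]) (use Q in simp)
  qed
  have c_a: "\<forall>P\<in>CR. PTr P = rad P" if "Tr ` S = R"
    by (intro ballI c_c'[OF that]) (simp add: CR_iff)
  show "(\<forall>P\<in>CR. PTr P = rad P) \<longleftrightarrow> CS = {Q. S.prime_in Q \<and> Q \<inter> R \<in> CR}"
    by (rule iffI[OF a_b c_a[OF centers_above_imp_onto]])
  show "CS = {Q. S.prime_in Q \<and> Q \<inter> R \<in> CR} \<longleftrightarrow> Tr ` S = R"
    by (rule iffI[OF centers_above_imp_onto a_b[OF c_a]])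
  show "Tr ` S = R \<longleftrightarrow> (\<forall>P. R.prime_in P \<longrightarrow> PTr P = rad P)"
  proof (rule iffI)
    show "\<forall>P. R.prime_in P \<longrightarrow> PTr P = rad P" if "Tr ` S = R"
      by (intro allI impI c_c'[OF that])
    show "Tr ` S = R" if "\<forall>P. R.prime_in P \<longrightarrow> PTr P = rad P"
      by (rule tame_at_centers_imp_onto) (rule c'_a[OF that])
  qed
qed

lemma comparable_centers:
  assumes "R.prime_in P" "R.prime_in P'" "P \<subseteq> P'"
  shows "P = P' \<or> P = {\<zero>}"
  using dim_one[OF assms(1) _ assms(2,3)] by blast

text \<open>
  The centers of \<open>S\<close> are all primes over centers of \<open>R\<close>, so the statements reduce to those for
  primes. Strict inclusions of primes of \<open>R\<close> start at zero, which leaves little to prove.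
\<close>

lemma cohen_seidenberg:
  assumes b: "CS = {Q. S.prime_in Q \<and> Q \<inter> R \<in> CR}"
  shows "(\<forall>Q\<in>CS. Q \<inter> R \<in> CR) \<and> lying_over R CS CR \<and> incomparability R CS \<and>
    going_up R CS CR \<and> going_down R CS CR"
proof (intro conjI ballI)
  have CRp: "R.prime_in P" if "P \<in> CR" for P using that by (simp add: CR_iff)
  have CSp: "S.prime_in Q" if "Q \<in> CS" for Q using that by (simp add: CS_iff)
  have CSI: "Q \<in> CS" if "S.prime_in Q" "Q \<inter> R \<in> CR" for Q unfolding b using that by simp
  have above: "\<exists>Q\<in>CS. Q \<inter> R = P" if P: "P \<in> CR" for P
  proof -
    obtain Q where "S.prime_in Q" "Q \<inter> R = P" using lying_over_prime[OF CRp[OF P]] by blast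
    then show ?thesis using CSI P by blast
  qed
  have zero_sub: "{\<zero>} \<subseteq> Q" if "Q \<in> CS" for Q
    using S.submodD(2)[OF S.prime_inD(1)[OF CSp[OF that]]] by simp
  have zero_R: "{\<zero>} \<inter> R = {\<zero>}" using R.R_closed(1) by blast
  show "Q \<inter> R \<in> CR" if "Q \<in> CS" for Q by (rule CS_contraction[OF that])
  show "lying_over R CS CR" unfolding lying_over_def using above by blast
  show "incomparability R CS"
    unfolding incomparability_def
  proof (intro ballI impI notI)
    fix Q Q' assume Q: "Q \<in> CS" "Q' \<in> CS" "Q \<subset> Q'" "Q \<inter> R = Q' \<inter> R"
    have "Q = Q'" by (rule incomparable[OF CSp[OF Q(1)] CSp[OF Q(2)] _ Q(4)]) (use Q(3) in blast)
    then show False using Q(3) by blast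
  qed
  show "going_up R CS CR"
    unfolding going_up_def
  proof (intro ballI impI, elim conjE)
    fix P P' Q assume P: "P \<in> CR" "P' \<in> CR" "Q \<in> CS" "P \<subseteq> P'" "Q \<inter> R = P"
    show "\<exists>Q'\<in>CS. Q \<subseteq> Q' \<and> Q' \<inter> R = P'"
    proof (cases "P = P'")
      case True
      then show ?thesis using P by blast
    next
      case False
      then have "P = {\<zero>}" using comparable_centers[OF CRp[OF P(1)] CRp[OF P(2)] P(4)] by blast
      then have "{\<zero>} \<inter> R = Q \<inter> R" using P(5) zero_R by simp
      then have "{\<zero>} = Q" by (rule incomparable[OF S.prime_zero CSp[OF P(3)] zero_sub[OF P(3)]])
      then show ?thesis using above[OF P(2)] zero_sub by blast
    qed
  qed
  show "going_down R CS CR"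
    unfolding going_down_def
  proof (intro ballI impI, elim conjE)
    fix P P' Q' assume P: "P \<in> CR" "P' \<in> CR" "Q' \<in> CS" "P \<subseteq> P'" "Q' \<inter> R = P'"
    show "\<exists>Q\<in>CS. Q \<subseteq> Q' \<and> Q \<inter> R = P"
    proof (cases "P = P'")
      case True
      then show ?thesis using P by blast
    next
      case False
      then have "P = {\<zero>}" using comparable_centers[OF CRp[OF P(1)] CRp[OF P(2)] P(4)] by blast
      then have "{\<zero>} \<in> CS" "{\<zero>} \<inter> R = P" using CSI[OF S.prime_zero] zero_R P(1) by auto
      then show ?thesis using zero_sub[OF P(3)] by blast
    qed
  qed
qed

end

theorem mainTheorem1:
  fixes L :: "('a, 'b) ring_scheme"
    and R K S :: "'a set"
    and p :: nat
    and \<phi> \<psi> :: "'a \<Rightarrow> 'a"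
  assumes "Factorial_Ring.prime p"
    and "finite_galois_extension L K"
    and "is_fraction_field L R K"
    and "dedekind_domain L K R"
    and "has_characteristic (L\<lparr>carrier := R\<rparr>) p"
    and "F_finite p (L\<lparr>carrier := R\<rparr>)"
    and "frobenius_splitting p (L\<lparr>carrier := R\<rparr>) \<phi>"
    and "S = integral_closure L R (carrier L)"
    and "\<psi> \<in> linear_maps (L\<lparr>carrier := S\<rparr>)
               (frobenius_pushforward p (L\<lparr>carrier := S\<rparr>)) (self_module (L\<lparr>carrier := S\<rparr>))"
    and "\<forall>r\<in>R. \<psi> r = \<phi> r"
  shows
    "let CR = centers_of_F_purity (L\<lparr>carrier := R\<rparr>) \<phi>;
         CS = centers_of_F_purity (L\<lparr>carrier := S\<rparr>) \<psi>;
         a = (\<forall>P\<in>CR. tamely_ramified_over L K S P);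
         b = (CS = {Q. primeideal Q (L\<lparr>carrier := S\<rparr>) \<and> Q \<inter> R \<in> CR});
         c = (field_trace L K ` S = R);
         c' = (\<forall>P. primeideal P (L\<lparr>carrier := R\<rparr>) \<longrightarrow> tamely_ramified_over L K S P)
     in (a \<longleftrightarrow> b) \<and> (b \<longleftrightarrow> c) \<and> (c \<longleftrightarrow> c') \<and>
        (a \<longrightarrow> (\<forall>Q\<in>CS. Q \<inter> R \<in> CR) \<and> lying_over R CS CR \<and> incomparability R CS \<and>
               going_up R CS CR \<and> going_down R CS CR)"
proof -
  have "field L" using assms(2) by (simp add: finite_galois_extension_def)
  then interpret frob_setup L K R S p \<phi> \<psi>
    by (intro frob_setup.intro galois_ext.intro galois_ext_axioms.intro frob_setup_axioms.intro)
      (use assms in auto)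
  have tr: "field_trace L K ` S = Tr ` S"
    by (rule image_cong[OF refl field_trace_eq[OF S.R_carrier]])
  have "(\<forall>P\<in>CR. PTr P = rad P) \<longrightarrow> (\<forall>Q\<in>CS. Q \<inter> R \<in> CR) \<and> lying_over R CS CR \<and>
      incomparability R CS \<and> going_up R CS CR \<and> going_down R CS CR"
    by (rule impI, rule cohen_seidenberg, rule equivalence(1)[THEN iffD1])
  then show ?thesis
    unfolding Let_def tamely_ramified_over_def tr R.primeideal_iff S.primeideal_iff
    by (intro conjI equivalence)
qed

end
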